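(* The variety $\mathsf{RPA}$ of rational product algebras is $\mathcal{Q}$-universal. Consequently, the lattice of extensions of rational product logic $\mathbf{R\Pi}$ has the cardinality of the continuum and does not satisfy any nontrivial lattice equation.
   Context: A BL-algebra is an algebra $\langle A;\wedge,\vee,\cdot,\to,0,1\rangle$ such that $\langle A;\wedge,\vee,0,1\rangle$ is a bounded lattice, $\langle A;\cdot,1\rangle$ is a commutative monoid, $a\cdot b\le c\iff a\le b\to c$, $(a\to c)\vee(c\to a)=1$ and $a\wedge c=a\cdot(a\to c)$. The standard product algebra $[0,1]_\Pi$ is the BL-algebra on $[0,1]$ with usual order, real multiplication and $a\to c=1$ if $a\le c$, $c/a$ otherwise; product algebras are the members of the variety it generates. With new constants $\{\mathbf{c}_q:q\in[0,1]\cap\mathbb{Q}\}$, a rational product algebra is an algebra in the BL language expanded by these constants whose BL-reduct is a product algebra and satisfying $\mathbf{c}_p\cdot\mathbf{c}_q\approx\mathbf{c}_{pq}$, $\mathbf{c}_p\to\mathbf{c}_q\approx\mathbf{c}_{p\to q}$ (computed in $[0,1]_\Pi$), $\mathbf{c}_0\approx0$, $\mathbf{c}_1\approx1$; $\mathsf{RPA}$ is their variety. Rational product logic $\mathbf{R\Pi}$ is the consequence relation on formulas of this language given by $\Gamma\vdash\varphi$ iff there is a finite $\Delta\subseteq\Gamma$ with $\{\delta\approx1:\delta\in\Delta\}\models_{\mathsf{RPA}}\varphi\approx1$. An extension of a logic is a finitary substitution-invariant consequence relation on the same formulas containing it. For a quasivariety $\mathsf{K}$, $\mathcal{Q}(\mathsf{K})$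 denotes the lattice of its subquasivarieties. A quasivariety $\mathsf{K}$ is $\mathcal{Q}$-universal if for every quasivariety $\mathsf{M}$ in a finite language, $\mathcal{Q}(\mathsf{M})$ is a homomorphic image of a sublattice of $\mathcal{Q}(\mathsf{K})$ (the language of $\mathsf{K}$ itself need not be finite). *)

theory Defs
  imports "HOL-Algebra.Complete_Lattice" "HOL-Library.Equipollence" Complex_Main
begin

section \<open>Universal algebra\<close>

text \<open>
  A language is a partial arity function: its symbols are the elements of its domain. Terms are
  built over countably many variables and are cut down to the language by \<open>wf_term\<close>.
\<close>

type_synonym 'f lang = "'f \<rightharpoonup> nat"

datatype 'f trm = Var nat | Fun 'f "'f trm list"

fun wf_term :: "'f lang \<Rightarrow> 'f trm \<Rightarrow> bool" where
  "wf_term L (Var x) \<longleftrightarrow> True"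
| "wf_term L (Fun f ts) \<longleftrightarrow> L f = Some (length ts) \<and> (\<forall>t\<in>set ts. wf_term L t)"

primrec subst :: "(nat \<Rightarrow> 'f trm) \<Rightarrow> 'f trm \<Rightarrow> 'f trm" where
  "subst \<sigma> (Var x) = \<sigma> x"
| "subst \<sigma> (Fun f ts) = Fun f (map (subst \<sigma>) ts)"

record ('f, 'a) ualg = "'a partial_object" +
  interp :: "'f \<Rightarrow> 'a list \<Rightarrow> 'a"

definition algebra_of :: "'f lang \<Rightarrow> ('f, 'a) ualg \<Rightarrow> bool" where
  "algebra_of L A \<longleftrightarrow> carrier A \<noteq> {} \<and>
     (\<forall>f xs. L f = Some (length xs) \<longrightarrow> set xs \<subseteq> carrier A \<longrightarrow> interp A f xs \<in> carrier A)"

primrec eval :: "('f, 'a) ualg \<Rightarrow> (nat \<Rightarrow> 'a) \<Rightarrow> 'f trm \<Rightarrow> 'a" where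
  "eval A v (Var x) = v x"
| "eval A v (Fun f ts) = interp A f (map (eval A v) ts)"

type_synonym 'f eqn = "'f trm \<times> 'f trm"
type_synonym 'f qeqn = "'f eqn list \<times> 'f eqn"

definition eqns :: "'f lang \<Rightarrow> 'f eqn set" where
  "eqns L = {(s, t). wf_term L s \<and> wf_term L t}"

definition qeqns :: "'f lang \<Rightarrow> 'f qeqn set" where
  "qeqns L = {(ps, c). set ps \<subseteq> eqns L \<and> c \<in> eqns L}"

definition holds_at :: "('f, 'a) ualg \<Rightarrow> (nat \<Rightarrow> 'a) \<Rightarrow> 'f eqn \<Rightarrow> bool" where
  "holds_at A v e \<longleftrightarrow> eval A v (fst e) = eval A v (snd e)"

definition sat_eqn :: "('f, 'a) ualg \<Rightarrow> 'f eqn \<Rightarrow> bool" where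
  "sat_eqn A e \<longleftrightarrow> (\<forall>v \<in> UNIV \<rightarrow> carrier A. holds_at A v e)"

definition sat_qeqn :: "('f, 'a) ualg \<Rightarrow> 'f qeqn \<Rightarrow> bool" where
  "sat_qeqn A q \<longleftrightarrow>
     (\<forall>v \<in> UNIV \<rightarrow> carrier A. (\<forall>p \<in> set (fst q). holds_at A v p) \<longrightarrow> holds_at A v (snd q))"

text \<open>
  Classes of algebras are sets of algebras whose carriers are subsets of a type \<open>'a\<close>. If \<open>'a\<close> is
  infinite and the language countable, \<open>'a\<close> contains a copy of every finitely generated algebra,
  and these determine a quasivariety.
\<close>

definition variety :: "'f lang \<Rightarrow> ('f, 'a) ualg set \<Rightarrow> bool" where
  "variety L K \<longleftrightarrow> (\<exists>E \<subseteq> eqns L. K = {A. algebra_of L A \<and> (\<forall>e\<in>E. sat_eqn A e)})"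

definition quasivariety :: "'f lang \<Rightarrow> ('f, 'a) ualg set \<Rightarrow> bool" where
  "quasivariety L K \<longleftrightarrow> (\<exists>Q \<subseteq> qeqns L. K = {A. algebra_of L A \<and> (\<forall>q\<in>Q. sat_qeqn A q)})"

text \<open>
  The generators may live on another type than the members of the variety, so that
  the interval $[0,1]$ generates a variety of algebras over an arbitrary type. On a single type this
  is the least variety containing the generators (lemma \<open>variety_generated_least\<close>).
\<close>

definition variety_generated :: "'f lang \<Rightarrow> ('f, 'b) ualg set \<Rightarrow> ('f, 'a) ualg set" where
  "variety_generated L K =
     {A. algebra_of L A \<and> (\<forall>e \<in> eqns L. (\<forall>B\<in>K. sat_eqn B e) \<longrightarrow> sat_eqn A e)}"

lemma variety_variety_generated: "variety L (variety_generated L K)"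
  unfolding variety_def variety_generated_def
  by (rule exI[of _ "{e \<in> eqns L. \<forall>B\<in>K. sat_eqn B e}"]) auto

lemma variety_generated_least:
  assumes "variety L V" "K \<subseteq> V"
  shows "variety_generated L K \<subseteq> V"
  using assms unfolding variety_def variety_generated_def by blast

lemma variety_imp_quasivariety:
  assumes "variety L K"
  shows "quasivariety L K"
proof -
  obtain E where E: "E \<subseteq> eqns L" "K = {A. algebra_of L A \<and> (\<forall>e\<in>E. sat_eqn A e)}"
    using assms unfolding variety_def by blast
  show ?thesis
    unfolding quasivariety_def
    by (rule exI[of _ "Pair [] ` E"])
      (use E in \<open>auto simp: qeqns_def sat_qeqn_def sat_eqn_def\<close>)
qed


section \<open>Lattices\<close>

definition sublattice :: "'a set \<Rightarrow> 'a gorder \<Rightarrow> bool" where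
  "sublattice S L \<longleftrightarrow> S \<subseteq> carrier L \<and>
     (\<forall>x\<in>S. \<forall>y\<in>S. x \<squnion>\<^bsub>L\<^esub> y \<in> S \<and> x \<sqinter>\<^bsub>L\<^esub> y \<in> S)"

definition hom_image_of_sublattice :: "'b gorder \<Rightarrow> 'a gorder \<Rightarrow> bool" where
  "hom_image_of_sublattice M L \<longleftrightarrow>
     (\<exists>S h. sublattice S L \<and> join_pres (L\<lparr>carrier := S\<rparr>) M h \<and> meet_pres (L\<lparr>carrier := S\<rparr>) M h \<and>
            h ` S = carrier M)"

datatype lat_term = LVar nat | LJoin lat_term lat_term | LMeet lat_term lat_term

primrec lat_eval :: "'a gorder \<Rightarrow> (nat \<Rightarrow> 'a) \<Rightarrow> lat_term \<Rightarrow> 'a" where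
  "lat_eval L v (LVar x) = v x"
| "lat_eval L v (LJoin s t) = lat_eval L v s \<squnion>\<^bsub>L\<^esub> lat_eval L v t"
| "lat_eval L v (LMeet s t) = lat_eval L v s \<sqinter>\<^bsub>L\<^esub> lat_eval L v t"

definition sat_lat_eqn :: "'a gorder \<Rightarrow> lat_term \<Rightarrow> lat_term \<Rightarrow> bool" where
  "sat_lat_eqn L s t \<longleftrightarrow> (\<forall>v \<in> UNIV \<rightarrow> carrier L. lat_eval L v s = lat_eval L v t)"

definition incl_order :: "'a set set \<Rightarrow> 'a set gorder" where
  "incl_order C = \<lparr>carrier = C, eq = (=), le = (\<subseteq>)\<rparr>"

lemma complete_lattice_incl_order:
  assumes "T \<in> C" "\<And>X. X \<in> C \<Longrightarrow> X \<subseteq> T"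
    and "\<And>D. D \<subseteq> C \<Longrightarrow> D \<noteq> {} \<Longrightarrow> \<Inter>D \<in> C"
  shows "complete_lattice (incl_order C)"
proof -
  interpret partial_order "incl_order C"
    by unfold_locales (auto simp: incl_order_def)
  show ?thesis
  proof (rule complete_lattice_criterion1)
    show "\<exists>g. greatest (incl_order C) g (carrier (incl_order C))"
      using assms(1,2) by (auto simp: greatest_def incl_order_def)
    fix D assume D: "D \<subseteq> carrier (incl_order C)" "D \<noteq> {}"
    then have "\<Inter>D \<in> C"
      using assms(3) by (simp add: incl_order_def)
    then have "greatest (incl_order C) (\<Inter>D) (Lower (incl_order C) D)"
      using D by (auto simp: greatest_def Lower_def incl_order_def)
    then show "\<exists>i. greatest (incl_order C) i (Lower (incl_order C) D)" ..
  qed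
qed


section \<open>Subquasivarieties and Q-universality\<close>

definition subquasivarieties :: "'f lang \<Rightarrow> ('f, 'a) ualg set \<Rightarrow> ('f, 'a) ualg set gorder" where
  "subquasivarieties L K = incl_order {K'. quasivariety L K' \<and> K' \<subseteq> K}"

lemma quasivariety_Inter:
  fixes D :: "('f, 'a) ualg set set"
  assumes "\<And>K. K \<in> D \<Longrightarrow> quasivariety L K" "D \<noteq> {}"
  shows "quasivariety L (\<Inter>D)"
proof -
  define Q where "Q = {q \<in> qeqns L. \<exists>K\<in>D. \<forall>A\<in>K. sat_qeqn A q}"
  have "\<Inter>D = {A. algebra_of L A \<and> (\<forall>q\<in>Q. sat_qeqn A q)}"
  proof (intro subset_antisym subsetI)
    fix A assume "A \<in> \<Inter>D"
    then show "A \<in> {A. algebra_of L A \<and> (\<forall>q\<in>Q. sat_qeqn A q)}"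
      using assms by (fastforce simp: Q_def quasivariety_def)
  next
    fix A :: "('f, 'a) ualg" assume A: "A \<in> {A. algebra_of L A \<and> (\<forall>q\<in>Q. sat_qeqn A q)}"
    show "A \<in> \<Inter>D"
    proof
      fix K assume K: "K \<in> D"
      from assms(1)[OF this] obtain Q' where Q': "Q' \<subseteq> qeqns L"
        "\<And>B. B \<in> K \<longleftrightarrow> algebra_of L B \<and> (\<forall>q\<in>Q'. sat_qeqn B q)"
        unfolding quasivariety_def by auto
      from Q' K have "Q' \<subseteq> Q"
        unfolding Q_def by blast
      with A show "A \<in> K"
        unfolding Q'(2) by auto
    qed
  qed
  then show ?thesis
    unfolding quasivariety_def by (intro exI[of _ Q]) (auto simp: Q_def)
qed

lemma complete_lattice_subquasivarieties:
  assumes "quasivariety L K"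
  shows "complete_lattice (subquasivarieties L K)"
  unfolding subquasivarieties_def
  using assms by (intro complete_lattice_incl_order[of K]) (auto intro!: quasivariety_Inter)

text \<open>
  The types of the symbols and of the elements of the competing algebras are parameters, since HOL
  does not quantify over types inside a definition.
\<close>

definition Q_universal ::
  "'g itself \<Rightarrow> 'b itself \<Rightarrow> 'f lang \<Rightarrow> ('f, 'a) ualg set \<Rightarrow> bool" where
  "Q_universal _ _ L K \<longleftrightarrow> quasivariety L K \<and>
     (\<forall>(L' :: 'g lang) (M :: ('g, 'b) ualg set). finite (dom L') \<longrightarrow> quasivariety L' M \<longrightarrow>
        hom_image_of_sublattice (subquasivarieties L' M) (subquasivarieties L K))"


section \<open>Rational product algebras\<close>

datatype bl_sym = BMeet | BJoin | BMult | BImp | BZero | BOne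

fun bl_arity :: "bl_sym \<Rightarrow> nat" where
  "bl_arity BMeet = 2"
| "bl_arity BJoin = 2"
| "bl_arity BMult = 2"
| "bl_arity BImp = 2"
| "bl_arity BZero = 0"
| "bl_arity BOne = 0"

definition bl_lang :: "bl_sym lang" where
  "bl_lang s = Some (bl_arity s)"

definition bl_algebra :: "(bl_sym, 'a) ualg \<Rightarrow> bool" where
  "bl_algebra A \<longleftrightarrow> algebra_of bl_lang A \<and>
    (let meet = (\<lambda>a b. interp A BMeet [a, b]); join = (\<lambda>a b. interp A BJoin [a, b]);
         mult = (\<lambda>a b. interp A BMult [a, b]); imp = (\<lambda>a b. interp A BImp [a, b]);
         zero = interp A BZero []; one = interp A BOne []; leq = (\<lambda>a b. meet a b = a)
     in \<forall>a\<in>carrier A. \<forall>b\<in>carrier A. \<forall>c\<in>carrier A.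
          meet a b = meet b a \<and> meet (meet a b) c = meet a (meet b c) \<and>
          join a b = join b a \<and> join (join a b) c = join a (join b c) \<and>
          meet a (join a b) = a \<and> join a (meet a b) = a \<and> leq zero a \<and> leq a one \<and>
          mult a b = mult b a \<and> mult (mult a b) c = mult a (mult b c) \<and> mult a one = a \<and>
          (leq (mult a b) c \<longleftrightarrow> leq a (imp b c)) \<and>
          join (imp a c) (imp c a) = one \<and> meet a c = mult a (imp a c))"

definition prod_imp :: "'a::linordered_field \<Rightarrow> 'a \<Rightarrow> 'a" where
  "prod_imp a c = (if a \<le> c then 1 else c / a)"

fun std_product_op :: "bl_sym \<Rightarrow> real list \<Rightarrow> real" where
  "std_product_op BMeet [a, b] = min a b"
| "std_product_op BJoin [a, b] = max a b"
| "std_product_op BMult [a, b] = a * b"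
| "std_product_op BImp [a, b] = prod_imp a b"
| "std_product_op BZero [] = 0"
| "std_product_op BOne [] = 1"
| "std_product_op _ _ = undefined"

definition std_product_algebra :: "(bl_sym, real) ualg" where
  "std_product_algebra = \<lparr>carrier = {0..1}, interp = std_product_op\<rparr>"

lemma algebra_of_std_product_algebra: "algebra_of bl_lang std_product_algebra"
proof -
  have "std_product_op f xs \<in> {0..1}"
    if "bl_arity f = length xs" "set xs \<subseteq> {0..1}" for f xs
    using that(2) that(1)[symmetric]
    by (cases f)
      (auto simp: prod_imp_def mult_le_one divide_le_eq_1 numeral_2_eq_2 length_Suc_conv
        le_max_iff_disj min_le_iff_disj)
  then show ?thesis
    by (auto simp: algebra_of_def bl_lang_def std_product_algebra_def)
qed

lemma bl_algebra_std_product_algebra: "bl_algebra std_product_algebra"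
proof -
  have res: "min (a * b) c = a * b \<longleftrightarrow> min a (prod_imp b c) = a"
    if "0 \<le> a" "a \<le> 1" "0 \<le> b" "b \<le> 1" "0 \<le> c" "c \<le> 1" for a b c :: real
  proof (cases "b \<le> c")
    case True
    moreover have "a * b \<le> 1 * b"
      using that by (intro mult_right_mono) auto
    ultimately show ?thesis
      using that by (auto simp: prod_imp_def)
  next
    case False
    then show ?thesis
      using that by (auto simp: prod_imp_def min_def field_simps)
  qed
  have div: "min a c = a * prod_imp a c" if "0 \<le> a" "0 \<le> c" for a c :: real
    using that by (auto simp: prod_imp_def min_def)
  have lin: "max (prod_imp a c) (prod_imp c a) = 1" if "0 \<le> a" "0 \<le> c" for a c :: real
    using that by (auto simp: prod_imp_def max_def divide_le_eq_1)
  show ?thesis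
    unfolding bl_algebra_def Let_def
  proof (intro conjI ballI algebra_of_std_product_algebra, goal_cases)
    case (12 a b c)
    then show ?case
      using res[of a b c] by (simp add: std_product_algebra_def)
  next
    case (14 a b c)
    then show ?case
      using div[of a c] by (simp add: std_product_algebra_def)
  qed (simp_all add: std_product_algebra_def lin min.commute max.commute min.left_commute
      max.left_commute min.assoc max.assoc mult.commute mult.assoc)
qed

definition product_algebras :: "(bl_sym, 'a) ualg set" where
  "product_algebras = variety_generated bl_lang {std_product_algebra}"

datatype rp_sym = BL bl_sym | Const rat

fun rp_lang :: "rp_sym lang" where
  "rp_lang (BL s) = bl_lang s"
| "rp_lang (Const q) = (if 0 \<le> q \<and> q \<le> 1 then Some 0 else None)"

definition bl_reduct :: "(rp_sym, 'a) ualg \<Rightarrow> (bl_sym, 'a) ualg" where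
  "bl_reduct A = \<lparr>carrier = carrier A, interp = (\<lambda>s. interp A (BL s))\<rparr>"

abbreviation cst :: "rat \<Rightarrow> rp_sym trm" where
  "cst q \<equiv> Fun (Const q) []"

definition bookkeeping :: "rp_sym eqn set" where
  "bookkeeping =
     {(Fun (BL BMult) [cst p, cst q], cst (p * q)) | p q. p \<in> {0..1} \<and> q \<in> {0..1}} \<union>
     {(Fun (BL BImp) [cst p, cst q], cst (prod_imp p q)) | p q. p \<in> {0..1} \<and> q \<in> {0..1}} \<union>
     {(cst 0, Fun (BL BZero) []), (cst 1, Fun (BL BOne) [])}"

definition RPA :: "(rp_sym, 'a) ualg set" where
  "RPA = {A. algebra_of rp_lang A \<and> bl_reduct A \<in> product_algebras \<and>
             (\<forall>e \<in> bookkeeping. sat_eqn A e)}"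

lemma bookkeeping_eqns: "bookkeeping \<subseteq> eqns rp_lang"
  by (auto simp: bookkeeping_def eqns_def bl_lang_def prod_imp_def mult_le_one divide_le_eq_1)

lemma variety_RPA: "variety rp_lang RPA"
proof -
  define E where "E = {e \<in> eqns bl_lang. sat_eqn std_product_algebra e}"
  define emb where "emb = (map_trm BL :: bl_sym trm \<Rightarrow> rp_sym trm)"
  have wf: "wf_term rp_lang (emb t) \<longleftrightarrow> wf_term bl_lang t" for t
    by (induction t) (auto simp: emb_def)
  have ev: "eval A v (emb t) = eval (bl_reduct A) v t" for A :: "(rp_sym, 'a) ualg" and v t
    by (induction t) (auto simp: emb_def bl_reduct_def intro!: arg_cong[of _ _ "interp A _"])
  have sat: "sat_eqn A (map_prod emb emb e) \<longleftrightarrow> sat_eqn (bl_reduct A) e"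
    for A :: "(rp_sym, 'a) ualg" and e
    by (auto simp: sat_eqn_def holds_at_def ev) (auto simp: bl_reduct_def)
  have red: "algebra_of bl_lang (bl_reduct A)" if "algebra_of rp_lang A" for A :: "(rp_sym, 'a) ualg"
    using that by (auto simp: algebra_of_def bl_reduct_def)
  have "map_prod emb emb ` E \<union> bookkeeping \<subseteq> eqns rp_lang"
    using bookkeeping_eqns by (auto simp: E_def eqns_def wf)
  moreover have "RPA = {A :: (rp_sym, 'a) ualg. algebra_of rp_lang A \<and>
      (\<forall>e \<in> map_prod emb emb ` E \<union> bookkeeping. sat_eqn A e)}"
    using red
    by (auto simp: RPA_def product_algebras_def variety_generated_def E_def ball_Un sat)
  ultimately show ?thesis
    unfolding variety_def by blast
qed


section \<open>Rational product logic and its extensions\<close>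

definition formulas :: "'f lang \<Rightarrow> 'f trm set" where
  "formulas L = {t. wf_term L t}"

type_synonym 'f consequence = "('f trm set \<times> 'f trm) set"

definition finitary_logic :: "'f lang \<Rightarrow> 'f consequence \<Rightarrow> bool" where
  "finitary_logic L C \<longleftrightarrow>
     C \<subseteq> Pow (formulas L) \<times> formulas L \<and>
     (\<forall>\<Gamma> \<phi>. \<Gamma> \<subseteq> formulas L \<longrightarrow> \<phi> \<in> \<Gamma> \<longrightarrow> (\<Gamma>, \<phi>) \<in> C) \<and>
     (\<forall>\<Gamma> \<Delta> \<phi>. \<Gamma> \<subseteq> formulas L \<longrightarrow> (\<forall>\<delta>\<in>\<Delta>. (\<Gamma>, \<delta>) \<in> C) \<longrightarrow> (\<Delta>, \<phi>) \<in> C \<longrightarrow> (\<Gamma>, \<phi>) \<in> C) \<and>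
     (\<forall>\<Gamma> \<phi>. (\<Gamma>, \<phi>) \<in> C \<longrightarrow> (\<exists>\<Delta> \<subseteq> \<Gamma>. finite \<Delta> \<and> (\<Delta>, \<phi>) \<in> C)) \<and>
     (\<forall>\<Gamma> \<phi> \<sigma>. (\<Gamma>, \<phi>) \<in> C \<longrightarrow> range \<sigma> \<subseteq> formulas L \<longrightarrow> (subst \<sigma> ` \<Gamma>, subst \<sigma> \<phi>) \<in> C)"

definition extensions :: "'f lang \<Rightarrow> 'f consequence \<Rightarrow> 'f consequence gorder" where
  "extensions L C = incl_order {C'. finitary_logic L C' \<and> C \<subseteq> C'}"

definition eq_consequence :: "('f, 'a) ualg set \<Rightarrow> 'f eqn set \<Rightarrow> 'f eqn \<Rightarrow> bool" where
  "eq_consequence K E e \<longleftrightarrow>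
     (\<forall>A\<in>K. \<forall>v \<in> UNIV \<rightarrow> carrier A. (\<forall>d\<in>E. holds_at A v d) \<longrightarrow> holds_at A v e)"

text \<open>The type parameter is the one over which the algebras in \<open>RPA\<close> are taken.\<close>

definition rational_product_logic :: "'a itself \<Rightarrow> rp_sym consequence" where
  "rational_product_logic _ =
     {(\<Gamma>, \<phi>). \<Gamma> \<subseteq> formulas rp_lang \<and> \<phi> \<in> formulas rp_lang \<and>
        (\<exists>\<Delta> \<subseteq> \<Gamma>. finite \<Delta> \<and>
           eq_consequence (RPA :: (rp_sym, 'a) ualg set)
             ((\<lambda>\<delta>. (\<delta>, Fun (BL BOne) [])) ` \<Delta>) (\<phi>, Fun (BL BOne) []))}"

lemma eval_subst: "eval A v (subst \<sigma> t) = eval A (\<lambda>x. eval A v (\<sigma> x)) t"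
  by (induction t) (auto intro!: arg_cong[of _ _ "interp A _"])

lemma eval_closed:
  assumes "algebra_of L A" "v \<in> UNIV \<rightarrow> carrier A" "wf_term L t"
  shows "eval A v t \<in> carrier A"
  using assms(3)
proof (induction t)
  case (Var x)
  then show ?case using assms(2) by auto
next
  case (Fun f ts)
  then have "L f = Some (length (map (eval A v) ts))" "set (map (eval A v) ts) \<subseteq> carrier A"
    by auto
  with assms(1) show ?case
    unfolding algebra_of_def by (metis eval.simps(2))
qed

lemma wf_subst:
  assumes "range \<sigma> \<subseteq> formulas L" "wf_term L t"
  shows "wf_term L (subst \<sigma> t)"
  using assms(2)
proof (induction t)
  case (Var x)
  then show ?case using assms(1) by (auto simp: formulas_def)
qed auto

lemma finitary_logic_rational_product_logic:
  "finitary_logic rp_lang (rational_product_logic TYPE('a))" (is "finitary_logic _ ?C")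
proof -
  let ?K = "RPA :: (rp_sym, 'a) ualg set"
  let ?E = "\<lambda>\<Delta>. (\<lambda>\<delta>. (\<delta>, Fun (BL BOne) [] :: rp_sym trm)) ` \<Delta>"
  let ?e = "\<lambda>\<phi>. (\<phi>, Fun (BL BOne) [] :: rp_sym trm)"
  have memI: "(\<Gamma>, \<phi>) \<in> ?C"
    if "\<Gamma> \<subseteq> formulas rp_lang" "\<phi> \<in> formulas rp_lang" "\<Delta> \<subseteq> \<Gamma>" "finite \<Delta>"
      "eq_consequence ?K (?E \<Delta>) (?e \<phi>)" for \<Gamma> \<Delta> \<phi>
    using that unfolding rational_product_logic_def by blast
  have memD: "\<Gamma> \<subseteq> formulas rp_lang \<and> \<phi> \<in> formulas rp_lang \<and>
      (\<exists>\<Delta> \<subseteq> \<Gamma>. finite \<Delta> \<and> eq_consequence ?K (?E \<Delta>) (?e \<phi>))"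
    if "(\<Gamma>, \<phi>) \<in> ?C" for \<Gamma> \<phi>
    using that unfolding rational_product_logic_def by blast
  show ?thesis
    unfolding finitary_logic_def
  proof (intro conjI allI impI)
    show "?C \<subseteq> Pow (formulas rp_lang) \<times> formulas rp_lang"
      by (auto dest: memD)
  next
    fix \<Gamma> \<phi> assume "\<Gamma> \<subseteq> formulas rp_lang" "\<phi> \<in> \<Gamma>"
    then show "(\<Gamma>, \<phi>) \<in> ?C"
      by (intro memI[of _ _ "{\<phi>}"]) (auto simp: eq_consequence_def)
  next
    fix \<Gamma> \<Delta> \<phi>
    assume *: "\<Gamma> \<subseteq> formulas rp_lang" "\<forall>\<delta>\<in>\<Delta>. (\<Gamma>, \<delta>) \<in> ?C" "(\<Delta>, \<phi>) \<in> ?C"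
    obtain D where D: "D \<subseteq> \<Delta>" "finite D" "eq_consequence ?K (?E D) (?e \<phi>)"
      using memD[OF *(3)] by blast
    have "\<forall>\<delta>\<in>D. \<exists>G \<subseteq> \<Gamma>. finite G \<and> eq_consequence ?K (?E G) (?e \<delta>)"
    proof
      fix \<delta> assume "\<delta> \<in> D"
      with D(1) *(2) have "(\<Gamma>, \<delta>) \<in> ?C" by blast
      from memD[OF this] show "\<exists>G \<subseteq> \<Gamma>. finite G \<and> eq_consequence ?K (?E G) (?e \<delta>)" by blast
    qed
    then obtain G where G: "\<forall>\<delta>\<in>D. G \<delta> \<subseteq> \<Gamma> \<and> finite (G \<delta>) \<and> eq_consequence ?K (?E (G \<delta>)) (?e \<delta>)"
      by metis
    have "eq_consequence ?K (?E (\<Union>(G ` D))) (?e \<phi>)"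
      unfolding eq_consequence_def
    proof (intro ballI impI)
      fix A v assume A: "A \<in> ?K" "v \<in> UNIV \<rightarrow> carrier A"
        "\<forall>d\<in>?E (\<Union>(G ` D)). holds_at A v d"
      have "holds_at A v (?e \<delta>)" if "\<delta> \<in> D" for \<delta>
      proof -
        have "eq_consequence ?K (?E (G \<delta>)) (?e \<delta>)" using G that by blast
        moreover have "\<forall>d\<in>?E (G \<delta>). holds_at A v d" using A(3) that by blast
        ultimately show ?thesis using A(1,2) unfolding eq_consequence_def by blast
      qed
      then show "holds_at A v (?e \<phi>)"
        using D(3) A(1,2) unfolding eq_consequence_def by blast
    qed
    moreover have "\<Union>(G ` D) \<subseteq> \<Gamma>" "finite (\<Union>(G ` D))"
      using G D(2) by blast+
    moreover have "\<phi> \<in> formulas rp_lang"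
      using memD[OF *(3)] by blast
    ultimately show "(\<Gamma>, \<phi>) \<in> ?C"
      by (intro memI[of _ _ "\<Union>(G ` D)"] *(1))
  next
    fix \<Gamma> \<phi> assume *: "(\<Gamma>, \<phi>) \<in> ?C"
    obtain D where "\<Gamma> \<subseteq> formulas rp_lang" "\<phi> \<in> formulas rp_lang" "D \<subseteq> \<Gamma>" "finite D"
      "eq_consequence ?K (?E D) (?e \<phi>)"
      using memD[OF *] by blast
    then show "\<exists>\<Delta> \<subseteq> \<Gamma>. finite \<Delta> \<and> (\<Delta>, \<phi>) \<in> ?C"
      by (intro exI[of _ D] conjI memI[of _ _ D]) auto
  next
    fix \<Gamma> \<phi> and \<sigma> :: "nat \<Rightarrow> rp_sym trm" assume *: "(\<Gamma>, \<phi>) \<in> ?C" "range \<sigma> \<subseteq> formulas rp_lang"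
    obtain D where D: "\<Gamma> \<subseteq> formulas rp_lang" "\<phi> \<in> formulas rp_lang" "D \<subseteq> \<Gamma>" "finite D"
      "eq_consequence ?K (?E D) (?e \<phi>)"
      using memD[OF *(1)] by blast
    have holds: "holds_at A v (?e (subst \<sigma> t)) \<longleftrightarrow> holds_at A (\<lambda>x. eval A v (\<sigma> x)) (?e t)"
      for A :: "(rp_sym, 'a) ualg" and v t
      by (simp add: holds_at_def eval_subst)
    have "eq_consequence ?K (?E (subst \<sigma> ` D)) (?e (subst \<sigma> \<phi>))"
      unfolding eq_consequence_def
    proof (intro ballI impI)
      fix A v assume A: "A \<in> ?K" "v \<in> UNIV \<rightarrow> carrier A"
        "\<forall>d\<in>?E (subst \<sigma> ` D). holds_at A v d"
      have "(\<lambda>x. eval A v (\<sigma> x)) \<in> UNIV \<rightarrow> carrier A"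
        using A(1,2) *(2) by (auto simp: RPA_def formulas_def intro!: eval_closed)
      moreover have "\<forall>d\<in>?E D. holds_at A (\<lambda>x. eval A v (\<sigma> x)) d"
        using A(3) by (simp add: holds)
      ultimately show "holds_at A v (?e (subst \<sigma> \<phi>))"
        using D(5) A(1) unfolding eq_consequence_def holds by blast
    qed
    with D * show "(subst \<sigma> ` \<Gamma>, subst \<sigma> \<phi>) \<in> ?C"
      by (intro memI[of _ _ "subst \<sigma> ` D"]) (auto simp: formulas_def intro!: wf_subst)
  qed
qed

end

theory Submission
  imports Defs "HOL-Analysis.Abstract_Topology_2" "HOL-Computational_Algebra.Primes"
begin

text \<open>
  Everything passes through the lattice \<open>S\<close> of semilattices of finite subsets of \<open>nat\<close> (containing
  the empty set and closed under binary unions).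

  For a finite set \<open>X\<close> let \<open>A\<^sub>X\<close> be the product over \<open>x \<in> X\<close> of the chains of those elements of
  $[0,1]$ that are rational or a rational multiple of $p_x^{-1/2}$, where $p_x$ is the \<open>x\<close>-th prime.
  Since no chain contains the square root of the reciprocal of another prime, the only element of
  \<open>A\<^sub>X\<close> whose square has all coordinates in $\{1/p_y : y \in Y\}$ is $(p_x^{-1/2})_{x \in X}$, and it
  exists only if \<open>X \<subseteq> Y\<close>. A semilattice \<open>W\<close> is thus recovered from every quasivariety
  between the one generated by the \<open>A\<^sub>X\<close> with \<open>X \<in> W\<close> and the largest one in which only members of
  \<open>W\<close> occur as minimal such \<open>Y\<close>, which makes \<open>S\<close> a homomorphic image of a sublattice of
  the lattice of subquasivarieties of \<open>RPA\<close>.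

  Conversely, the lattice of subquasivarieties of any quasivariety in a countable language is a
  homomorphic image of a sublattice of \<open>S\<close>: an algebra is coded by the finite sets of equations
  that fail in it, and failure in a product is a union of failures in the factors. Every lattice
  equation that fails in some lattice already fails in \<open>S\<close>. Finally, the lattice of extensions is
  dual to the lattice of subquasivarieties, since \<open>s = t\<close> amounts to \<open>s \<rightarrow> t = 1\<close> and \<open>t \<rightarrow> s = 1\<close>.
\<close>

section \<open>Lattices of sets and their quotients\<close>

text \<open>Each end of the intervals respects only one lattice operation: generated quasivarieties
  are shown to be compatible with joins, classes cut out by rules with meets. A homomorphic image of
  a sublattice asks for no more, since the intervals between the two ends absorb both defects.

  Square roots are dictated by the constants. Every rational of $[0,1]$ is already named, so a
  property that separates chains has to concern irrational elements. As the operations on $[0,1]$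
  involve multiplication and division but no sums, adjoining one square root to the positive
  rationals adds just one multiplicative coset.

  Finite sets under union suit both directions for the same reason: a union of index sets yields a
  product of algebras, and in a product the failures of equations form unions.

  A lattice that refutes a given lattice equation is arbitrary and need not be a lattice of
  subquasivarieties, so that Q-universality alone does not settle the last claim. Only the subterms
  of one term matter there, and these are finitely many.\<close>

lemma incl_order_simps [simp]:
  "carrier (incl_order C) = C" "le (incl_order C) = (\<subseteq>)" "eq (incl_order C) = (=)"
  by (simp_all add: incl_order_def)

lemma (in partial_order) join_eqI:
  assumes "x \<in> carrier L" "y \<in> carrier L" "z \<in> carrier L" "x \<sqsubseteq> z" "y \<sqsubseteq> z"
    and "\<And>w. w \<in> carrier L \<Longrightarrow> x \<sqsubseteq> w \<Longrightarrow> y \<sqsubseteq> w \<Longrightarrow> z \<sqsubseteq> w"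
  shows "x \<squnion> y = z"
proof -
  have "least L z (Upper L {x, y})"
    using assms by (intro least_UpperI) (auto simp: Upper_def)
  then show ?thesis
    unfolding join_def sup_def by (metis (mono_tags, lifting) least_unique someI)
qed

lemma (in partial_order) meet_eqI:
  assumes "x \<in> carrier L" "y \<in> carrier L" "z \<in> carrier L" "z \<sqsubseteq> x" "z \<sqsubseteq> y"
    and "\<And>w. w \<in> carrier L \<Longrightarrow> w \<sqsubseteq> x \<Longrightarrow> w \<sqsubseteq> y \<Longrightarrow> w \<sqsubseteq> z"
  shows "x \<sqinter> y = z"
proof -
  have "greatest L z (Lower L {x, y})"
    using assms by (intro greatest_LowerI) (auto simp: Lower_def)
  then show ?thesis
    unfolding meet_def inf_def by (metis (mono_tags, lifting) greatest_unique someI)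
qed

lemma partial_order_incl_order: "partial_order (incl_order C)"
  by unfold_locales auto

lemma incl_order_join_eqI:
  assumes "X \<in> C" "Y \<in> C" "Z \<in> C" "X \<subseteq> Z" "Y \<subseteq> Z"
    and "\<And>W. W \<in> C \<Longrightarrow> X \<subseteq> W \<Longrightarrow> Y \<subseteq> W \<Longrightarrow> Z \<subseteq> W"
  shows "X \<squnion>\<^bsub>incl_order C\<^esub> Y = Z"
  using assms by (intro partial_order.join_eqI partial_order_incl_order) auto

lemma incl_order_meet_eqI:
  assumes "X \<in> C" "Y \<in> C" "X \<inter> Y \<in> C"
  shows "X \<sqinter>\<^bsub>incl_order C\<^esub> Y = X \<inter> Y"
  using assms by (intro partial_order.meet_eqI partial_order_incl_order) auto

text \<open>Joins and meets are chosen bounds relative to the carrier, so shrinking the carrier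
  could change them. The ambient bounds lie in \<open>S\<close>, hence remain the extremal ones
  there.\<close>

lemma sublattice_restrict:
  assumes "lattice L" "sublattice S L"
  shows "lattice (L\<lparr>carrier := S\<rparr>)"
    and "x \<in> S \<Longrightarrow> y \<in> S \<Longrightarrow> x \<squnion>\<^bsub>L\<lparr>carrier := S\<rparr>\<^esub> y = x \<squnion>\<^bsub>L\<^esub> y"
    and "x \<in> S \<Longrightarrow> y \<in> S \<Longrightarrow> x \<sqinter>\<^bsub>L\<lparr>carrier := S\<rparr>\<^esub> y = x \<sqinter>\<^bsub>L\<^esub> y"
proof -
  interpret L: lattice L by fact
  have S: "\<And>x. x \<in> S \<Longrightarrow> x \<in> carrier L"
    "\<And>x y. x \<in> S \<Longrightarrow> y \<in> S \<Longrightarrow> x \<squnion>\<^bsub>L\<^esub> y \<in> S" "\<And>x y. x \<in> S \<Longrightarrow> y \<in> S \<Longrightarrow> x \<sqinter>\<^bsub>L\<^esub> y \<in> S"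
    using assms(2) by (auto simp: sublattice_def)
  interpret LS: partial_order "L\<lparr>carrier := S\<rparr>"
    using S(1) by unfold_locales
      (auto intro: L.le_trans L.le_antisym simp: L.eq_is_equal)
  have least: "least (L\<lparr>carrier := S\<rparr>) (x \<squnion>\<^bsub>L\<^esub> y) (Upper (L\<lparr>carrier := S\<rparr>) {x, y})"
    if "x \<in> S" "y \<in> S" for x y
    using that S L.join_left L.join_right L.join_le
    by (intro least_UpperI) (auto simp: Upper_def)
  have greatest: "greatest (L\<lparr>carrier := S\<rparr>) (x \<sqinter>\<^bsub>L\<^esub> y) (Lower (L\<lparr>carrier := S\<rparr>) {x, y})"
    if "x \<in> S" "y \<in> S" for x y
    using that S L.meet_left L.meet_right L.meet_le
    by (intro greatest_LowerI) (auto simp: Lower_def)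
  show "lattice (L\<lparr>carrier := S\<rparr>)"
    using least greatest by unfold_locales force+
  show "x \<in> S \<Longrightarrow> y \<in> S \<Longrightarrow> x \<squnion>\<^bsub>L\<lparr>carrier := S\<rparr>\<^esub> y = x \<squnion>\<^bsub>L\<^esub> y"
    using least unfolding join_def[of "L\<lparr>carrier := S\<rparr>"] sup_def
    by (metis (mono_tags, lifting) LS.least_unique someI)
  show "x \<in> S \<Longrightarrow> y \<in> S \<Longrightarrow> x \<sqinter>\<^bsub>L\<lparr>carrier := S\<rparr>\<^esub> y = x \<sqinter>\<^bsub>L\<^esub> y"
    using greatest unfolding meet_def[of "L\<lparr>carrier := S\<rparr>"] inf_def
    by (metis (mono_tags, lifting) LS.greatest_unique someI)
qed

lemma hom_image_of_sublattice_iff: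
  assumes "lattice L" "lattice M"
  shows "hom_image_of_sublattice M L \<longleftrightarrow>
    (\<exists>S h. sublattice S L \<and> h ` S = carrier M \<and>
      (\<forall>x\<in>S. \<forall>y\<in>S. h (x \<squnion>\<^bsub>L\<^esub> y) = h x \<squnion>\<^bsub>M\<^esub> h y) \<and>
      (\<forall>x\<in>S. \<forall>y\<in>S. h (x \<sqinter>\<^bsub>L\<^esub> y) = h x \<sqinter>\<^bsub>M\<^esub> h y))"
  unfolding hom_image_of_sublattice_def join_pres_def meet_pres_def
  using assms sublattice_restrict[OF assms(1)] by (intro ex_cong1) auto

text \<open>The inner sublattice is pulled back along the outer homomorphism.\<close>

lemma hom_image_of_sublattice_trans:
  assumes "lattice K" "lattice L" "lattice M"
    and "hom_image_of_sublattice K L" "hom_image_of_sublattice L M"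
  shows "hom_image_of_sublattice K M"
proof -
  obtain S f where S: "sublattice S L" "f ` S = carrier K"
    "\<forall>x\<in>S. \<forall>y\<in>S. f (x \<squnion>\<^bsub>L\<^esub> y) = f x \<squnion>\<^bsub>K\<^esub> f y"
    "\<forall>x\<in>S. \<forall>y\<in>S. f (x \<sqinter>\<^bsub>L\<^esub> y) = f x \<sqinter>\<^bsub>K\<^esub> f y"
    using assms(4) unfolding hom_image_of_sublattice_iff[OF assms(2,1)] by blast
  obtain T g where T: "sublattice T M" "g ` T = carrier L"
    "\<forall>x\<in>T. \<forall>y\<in>T. g (x \<squnion>\<^bsub>M\<^esub> y) = g x \<squnion>\<^bsub>L\<^esub> g y"
    "\<forall>x\<in>T. \<forall>y\<in>T. g (x \<sqinter>\<^bsub>M\<^esub> y) = g x \<sqinter>\<^bsub>L\<^esub> g y"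
    using assms(5) unfolding hom_image_of_sublattice_iff[OF assms(3,2)] by blast
  have "sublattice {x \<in> T. g x \<in> S} M"
    using S(1) T(1,3,4) by (auto simp: sublattice_def)
  moreover have "(f \<circ> g) ` {x \<in> T. g x \<in> S} = carrier K"
  proof -
    have "g ` {x \<in> T. g x \<in> S} = S"
      using S(1) unfolding T(2)[symmetric] sublattice_def by blast
    then show ?thesis using S(2) by (metis image_comp)
  qed
  ultimately show ?thesis
    unfolding hom_image_of_sublattice_iff[OF assms(3,1)]
    by (intro exI[of _ "{x \<in> T. g x \<in> S}"] exI[of _ "f \<circ> g"] conjI)
      (simp_all add: S(3,4) T(3,4))
qed

text \<open>
  The sublattice is the union of the intervals between \<open>lo x\<close> and \<open>hi x\<close>, which are pairwise
  disjoint, and the homomorphism collapses each of them to \<open>x\<close>.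
\<close>

lemma hom_image_of_sublattice_intervals:
  assumes K: "lattice K" and L: "lattice L"
    and lo: "\<And>x. x \<in> carrier K \<Longrightarrow> lo x \<in> carrier L" and hi: "\<And>x. x \<in> carrier K \<Longrightarrow> hi x \<in> carrier L"
    and lo_hi: "\<And>x y. x \<in> carrier K \<Longrightarrow> y \<in> carrier K \<Longrightarrow> lo x \<sqsubseteq>\<^bsub>L\<^esub> hi y \<longleftrightarrow> x \<sqsubseteq>\<^bsub>K\<^esub> y"
    and mono_lo: "\<And>x y. x \<in> carrier K \<Longrightarrow> y \<in> carrier K \<Longrightarrow> x \<sqsubseteq>\<^bsub>K\<^esub> y \<Longrightarrow> lo x \<sqsubseteq>\<^bsub>L\<^esub> lo y"
    and mono_hi: "\<And>x y. x \<in> carrier K \<Longrightarrow> y \<in> carrier K \<Longrightarrow> x \<sqsubseteq>\<^bsub>K\<^esub> y \<Longrightarrow> hi x \<sqsubseteq>\<^bsub>L\<^esub> hi y"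
    and join: "\<And>x y. x \<in> carrier K \<Longrightarrow> y \<in> carrier K \<Longrightarrow> lo (x \<squnion>\<^bsub>K\<^esub> y) \<sqsubseteq>\<^bsub>L\<^esub> lo x \<squnion>\<^bsub>L\<^esub> lo y"
    and meet: "\<And>x y. x \<in> carrier K \<Longrightarrow> y \<in> carrier K \<Longrightarrow> hi x \<sqinter>\<^bsub>L\<^esub> hi y \<sqsubseteq>\<^bsub>L\<^esub> hi (x \<sqinter>\<^bsub>K\<^esub> y)"
  shows "hom_image_of_sublattice K L"
proof -
  interpret K: lattice K by fact
  interpret L: lattice L by fact
  define I where "I z x \<longleftrightarrow> x \<in> carrier K \<and> z \<in> carrier L \<and> lo x \<sqsubseteq>\<^bsub>L\<^esub> z \<and> z \<sqsubseteq>\<^bsub>L\<^esub> hi x" for z x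
  define h where "h z = (THE x. I z x)" for z
  \<comment> \<open>Two intervals sharing \<open>z\<close> give \<open>lo x\<close> below
    \<open>hi y\<close> and \<open>lo y\<close> below \<open>hi x\<close>, which
    \<open>lo_hi\<close> turns into comparability of \<open>x\<close> and \<open>y\<close> both
    ways.\<close>
  have unique: "x = y" if "I z x" "I z y" for x y z
  proof (rule K.le_antisym)
    have c: "x \<in> carrier K" "y \<in> carrier K" "lo x \<in> carrier L" "lo y \<in> carrier L"
      "hi x \<in> carrier L" "hi y \<in> carrier L" "z \<in> carrier L"
      using that lo hi by (auto simp: I_def)
    show "x \<sqsubseteq>\<^bsub>K\<^esub> y" "y \<sqsubseteq>\<^bsub>K\<^esub> x"
      using that lo_hi c L.le_trans unfolding I_def by meson+
    show "x \<in> carrier K" "y \<in> carrier K" by fact+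
  qed
  then have h: "h z = x" if "I z x" for z x
    unfolding h_def using that by blast
  \<comment> \<open>Only the lower end needs the hypothesis \<open>join\<close>; the upper end
    follows from monotonicity of \<open>hi\<close>. For meets the two ends exchange their
    roles.\<close>
  have I_join: "I (z \<squnion>\<^bsub>L\<^esub> w) (x \<squnion>\<^bsub>K\<^esub> y)" if "I z x" "I w y" for z w x y
  proof -
    have c: "x \<in> carrier K" "y \<in> carrier K" "z \<in> carrier L" "w \<in> carrier L" "x \<squnion>\<^bsub>K\<^esub> y \<in> carrier K"
      using that by (auto simp: I_def)
    note d = lo[OF c(1)] lo[OF c(2)] hi[OF c(1)] hi[OF c(2)] lo[OF c(5)] hi[OF c(5)]
    have "lo x \<squnion>\<^bsub>L\<^esub> lo y \<sqsubseteq>\<^bsub>L\<^esub> z \<squnion>\<^bsub>L\<^esub> w"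
      using that c d L.le_trans[OF _ L.join_left] L.le_trans[OF _ L.join_right]
      by (intro L.join_le) (auto simp: I_def)
    then have "lo (x \<squnion>\<^bsub>K\<^esub> y) \<sqsubseteq>\<^bsub>L\<^esub> z \<squnion>\<^bsub>L\<^esub> w"
      using L.le_trans[OF join[OF c(1,2)]] c d by simp
    moreover have "hi x \<sqsubseteq>\<^bsub>L\<^esub> hi (x \<squnion>\<^bsub>K\<^esub> y)" "hi y \<sqsubseteq>\<^bsub>L\<^esub> hi (x \<squnion>\<^bsub>K\<^esub> y)"
      using c K.join_left K.join_right by (auto intro!: mono_hi)
    then have "z \<squnion>\<^bsub>L\<^esub> w \<sqsubseteq>\<^bsub>L\<^esub> hi (x \<squnion>\<^bsub>K\<^esub> y)"
      using that c d by (intro L.join_le) (auto simp: I_def intro: L.le_trans)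
    ultimately show ?thesis using c by (simp add: I_def)
  qed
  have I_meet: "I (z \<sqinter>\<^bsub>L\<^esub> w) (x \<sqinter>\<^bsub>K\<^esub> y)" if "I z x" "I w y" for z w x y
  proof -
    have c: "x \<in> carrier K" "y \<in> carrier K" "z \<in> carrier L" "w \<in> carrier L" "x \<sqinter>\<^bsub>K\<^esub> y \<in> carrier K"
      using that by (auto simp: I_def)
    note d = lo[OF c(1)] lo[OF c(2)] hi[OF c(1)] hi[OF c(2)] lo[OF c(5)] hi[OF c(5)]
    have "z \<sqinter>\<^bsub>L\<^esub> w \<sqsubseteq>\<^bsub>L\<^esub> hi x \<sqinter>\<^bsub>L\<^esub> hi y"
      using that c d L.le_trans[OF L.meet_left] L.le_trans[OF L.meet_right]
      by (intro L.meet_le) (auto simp: I_def)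
    then have "z \<sqinter>\<^bsub>L\<^esub> w \<sqsubseteq>\<^bsub>L\<^esub> hi (x \<sqinter>\<^bsub>K\<^esub> y)"
      using L.le_trans[OF _ meet[OF c(1,2)]] c d by simp
    moreover have "lo (x \<sqinter>\<^bsub>K\<^esub> y) \<sqsubseteq>\<^bsub>L\<^esub> lo x" "lo (x \<sqinter>\<^bsub>K\<^esub> y) \<sqsubseteq>\<^bsub>L\<^esub> lo y"
      using c K.meet_left K.meet_right by (auto intro!: mono_lo)
    then have "lo (x \<sqinter>\<^bsub>K\<^esub> y) \<sqsubseteq>\<^bsub>L\<^esub> z \<sqinter>\<^bsub>L\<^esub> w"
      using that c d by (intro L.meet_le) (auto simp: I_def intro: L.le_trans)
    ultimately show ?thesis using c by (simp add: I_def)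
  qed
  define S where "S = {z. \<exists>x. I z x}"
  have "sublattice S L"
    unfolding sublattice_def
  proof (intro conjI ballI)
    show "S \<subseteq> carrier L" by (auto simp: S_def I_def)
  qed (auto simp: S_def intro: I_join I_meet)
  moreover have "h ` S = carrier K"
  proof -
    have "I (lo x) x" if "x \<in> carrier K" for x
      using that lo lo_hi by (simp add: I_def)
    then have "x \<in> h ` S" if "x \<in> carrier K" for x
      using that h[of "lo x" x] unfolding S_def by (intro image_eqI[of _ _ "lo x"]) auto
    moreover have "h z \<in> carrier K" if z: "z \<in> S" for z
    proof -
      obtain x where "I z x" using z by (auto simp: S_def)
      then show ?thesis using h[of z x] by (simp add: I_def)
    qed
    ultimately show ?thesis by blast
  qed
  moreover have "h (z \<squnion>\<^bsub>L\<^esub> w) = h z \<squnion>\<^bsub>K\<^esub> h w" "h (z \<sqinter>\<^bsub>L\<^esub> w) = h z \<sqinter>\<^bsub>K\<^esub> h w"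
    if zw: "z \<in> S" "w \<in> S" for z w
  proof -
    obtain x y where "I z x" "I w y" using zw by (auto simp: S_def)
    then show "h (z \<squnion>\<^bsub>L\<^esub> w) = h z \<squnion>\<^bsub>K\<^esub> h w" "h (z \<sqinter>\<^bsub>L\<^esub> w) = h z \<sqinter>\<^bsub>K\<^esub> h w"
      using h[OF I_join] h[OF I_meet] h[of z x] h[of w y] by simp_all
  qed
  ultimately show ?thesis
    unfolding hom_image_of_sublattice_iff[OF L K]
    by (intro exI[of _ S] exI[of _ h]) simp
qed

section \<open>Lattice equations under homomorphic images and duality\<close>

lemma lat_eval_closed:
  assumes "lattice L" "v \<in> UNIV \<rightarrow> carrier L"
  shows "lat_eval L v t \<in> carrier L"
proof -
  interpret lattice L by fact
  show ?thesis using assms(2) by (induction t) auto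
qed

lemma sat_lat_eqn_hom_image:
  assumes "lattice L" "lattice M" "hom_image_of_sublattice M L" "sat_lat_eqn L s t"
  shows "sat_lat_eqn M s t"
proof -
  obtain S h where S: "sublattice S L" "h ` S = carrier M"
    "\<forall>x\<in>S. \<forall>y\<in>S. h (x \<squnion>\<^bsub>L\<^esub> y) = h x \<squnion>\<^bsub>M\<^esub> h y"
    "\<forall>x\<in>S. \<forall>y\<in>S. h (x \<sqinter>\<^bsub>L\<^esub> y) = h x \<sqinter>\<^bsub>M\<^esub> h y"
    using assms(3) unfolding hom_image_of_sublattice_iff[OF assms(1,2)] by blast
  show ?thesis
    unfolding sat_lat_eqn_def
  proof
    fix v :: "nat \<Rightarrow> 'b" assume "v \<in> UNIV \<rightarrow> carrier M"
    then have "\<forall>i. \<exists>x\<in>S. h x = v i" unfolding S(2)[symmetric]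
      by (metis PiE UNIV_I imageE)
    then obtain w where w: "\<And>i. w i \<in> S" "\<And>i. h (w i) = v i" by metis
    have "lat_eval L w r \<in> S \<and> h (lat_eval L w r) = lat_eval M v r" for r
      using S(1,3,4) w by (induction r) (auto simp: sublattice_def)
    moreover have "lat_eval L w s = lat_eval L w t"
      using assms(4) S(1) w(1) by (auto simp: sat_lat_eqn_def sublattice_def)
    ultimately show "lat_eval M v s = lat_eval M v t" by metis
  qed
qed

primrec dual_term :: "lat_term \<Rightarrow> lat_term" where
  "dual_term (LVar x) = LVar x"
| "dual_term (LJoin s t) = LMeet (dual_term s) (dual_term t)"
| "dual_term (LMeet s t) = LJoin (dual_term s) (dual_term t)"

lemma lat_eval_inv_gorder: "lat_eval (inv_gorder L) v (dual_term t) = lat_eval L v t"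
  by (induction t) auto

lemma sat_lat_eqn_inv_gorder:
  "sat_lat_eqn (inv_gorder L) (dual_term s) (dual_term t) \<longleftrightarrow> sat_lat_eqn L s t"
  by (simp add: sat_lat_eqn_def lat_eval_inv_gorder)

text \<open>An order-reversing bijection exchanges joins and meets. The bounds in \<open>M\<close>
  are found as images of those in \<open>L\<close>, so a partial order suffices on that
  side.\<close>

lemma sat_lat_eqn_dual_iso:
  fixes L :: "'a gorder"
  assumes "lattice L" "partial_order M" "bij_betw f (carrier L) (carrier M)"
    and anti: "\<And>x y. x \<in> carrier L \<Longrightarrow> y \<in> carrier L \<Longrightarrow> f x \<sqsubseteq>\<^bsub>M\<^esub> f y \<longleftrightarrow> y \<sqsubseteq>\<^bsub>L\<^esub> x"
    and "sat_lat_eqn M s t"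
  shows "sat_lat_eqn L (dual_term s) (dual_term t)"
proof -
  interpret L: lattice L by fact
  interpret M: partial_order M by fact
  have f: "\<And>x. x \<in> carrier L \<Longrightarrow> f x \<in> carrier M" "inj_on f (carrier L)"
    "\<And>y. y \<in> carrier M \<Longrightarrow> \<exists>x\<in>carrier L. y = f x"
    using assms(3) by (auto simp: bij_betw_def)
  have join: "f x \<squnion>\<^bsub>M\<^esub> f y = f (x \<sqinter>\<^bsub>L\<^esub> y)" if "x \<in> carrier L" "y \<in> carrier L" for x y
  proof (rule M.join_eqI)
    fix w assume "w \<in> carrier M" "f x \<sqsubseteq>\<^bsub>M\<^esub> w" "f y \<sqsubseteq>\<^bsub>M\<^esub> w"
    then show "f (x \<sqinter>\<^bsub>L\<^esub> y) \<sqsubseteq>\<^bsub>M\<^esub> w"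
      using that f(3)[of w] anti L.meet_le by auto
  qed (use that f(1) anti L.meet_left L.meet_right in auto)
  have meet: "f x \<sqinter>\<^bsub>M\<^esub> f y = f (x \<squnion>\<^bsub>L\<^esub> y)" if "x \<in> carrier L" "y \<in> carrier L" for x y
  proof (rule M.meet_eqI)
    fix w assume "w \<in> carrier M" "w \<sqsubseteq>\<^bsub>M\<^esub> f x" "w \<sqsubseteq>\<^bsub>M\<^esub> f y"
    then show "w \<sqsubseteq>\<^bsub>M\<^esub> f (x \<squnion>\<^bsub>L\<^esub> y)"
      using that f(3)[of w] anti L.join_le by auto
  qed (use that f(1) anti L.join_left L.join_right in auto)
  show ?thesis
    unfolding sat_lat_eqn_def
  proof
    fix v :: "nat \<Rightarrow> 'a" assume v: "v \<in> UNIV \<rightarrow> carrier L"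
    have eval: "f (lat_eval L v (dual_term r)) = lat_eval M (f \<circ> v) r" for r
      by (induction r) (simp_all add: join[symmetric] meet[symmetric] lat_eval_closed[OF assms(1) v])
    have "f \<circ> v \<in> UNIV \<rightarrow> carrier M" using v f(1) by (simp add: Pi_iff)
    then have "lat_eval M (f \<circ> v) s = lat_eval M (f \<circ> v) t"
      using assms(5) by (simp add: sat_lat_eqn_def)
    then show "lat_eval L v (dual_term s) = lat_eval L v (dual_term t)"
      using f(2) lat_eval_closed[OF assms(1) v] eval by (metis inj_on_contraD)
  qed
qed


section \<open>Quotients of the term algebra\<close>

instance trm :: (countable) countable
  by countable_datatype

text \<open>The type of symbols may be uncountable. Relabelling the symbols of the language by
  natural numbers places all formulas in the image of a countable type of terms.\<close>

lemma countable_formulas: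
  assumes "countable (dom L)"
  shows "countable (formulas L)"
proof -
  have "set_trm t \<subseteq> dom L" if "wf_term L t" for t
    using that by (induction t) auto
  then have "t \<in> range (map_trm (from_nat_into (dom L)))" if "t \<in> formulas L" for t
    using that assms
    by (intro image_eqI[of _ _ "map_trm (to_nat_on (dom L)) t"])
      (fastforce simp: formulas_def trm.map_comp intro!: trm.map_ident_strong[symmetric]
        from_nat_into_to_nat_on)+
  then have "formulas L \<subseteq> range (map_trm (from_nat_into (dom L)) :: nat trm \<Rightarrow> 'a trm)"
    by blast
  then show ?thesis
    by (rule countable_subset) simp
qed

lemma eqns_eq: "eqns L = formulas L \<times> formulas L"
  by (auto simp: eqns_def formulas_def)

lemma countable_eqns: "countable (dom L) \<Longrightarrow> countable (eqns L)"
  by (simp add: eqns_eq countable_formulas)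

lemma countable_qeqns: "countable (dom L) \<Longrightarrow> countable (qeqns L)"
proof -
  assume "countable (dom L)"
  then have "countable (lists (eqns L) \<times> eqns L)"
    by (intro countable_SIGMA countable_lists countable_eqns)
  moreover have "qeqns L = lists (eqns L) \<times> eqns L"
    by (auto simp: qeqns_def lists_eq_set)
  ultimately show ?thesis by simp
qed

lemma qeqns_iff: "q \<in> qeqns L \<longleftrightarrow> set (fst q) \<subseteq> eqns L \<and> snd q \<in> eqns L"
  by (cases q) (simp add: qeqns_def)

abbreviation subst_eqn :: "(nat \<Rightarrow> 'f trm) \<Rightarrow> 'f eqn \<Rightarrow> 'f eqn" where
  "subst_eqn \<sigma> \<equiv> map_prod (subst \<sigma>) (subst \<sigma>)"

abbreviation subst_qeqn :: "(nat \<Rightarrow> 'f trm) \<Rightarrow> 'f qeqn \<Rightarrow> 'f qeqn" where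
  "subst_qeqn \<sigma> \<equiv> map_prod (map (subst_eqn \<sigma>)) (subst_eqn \<sigma>)"

lemma subst_eqn_closed: "range \<sigma> \<subseteq> formulas L \<Longrightarrow> e \<in> eqns L \<Longrightarrow> subst_eqn \<sigma> e \<in> eqns L"
  by (auto simp: eqns_def wf_subst)

lemma subst_qeqn_closed: "range \<sigma> \<subseteq> formulas L \<Longrightarrow> q \<in> qeqns L \<Longrightarrow> subst_qeqn \<sigma> q \<in> qeqns L"
  unfolding qeqns_iff fst_map_prod snd_map_prod set_map
  by (intro conjI image_subsetI) (rule subst_eqn_closed; blast)+

lemma holds_at_subst: "holds_at A v (subst_eqn \<sigma> e) \<longleftrightarrow> holds_at A (\<lambda>x. eval A v (\<sigma> x)) e"
  by (cases e) (simp add: holds_at_def eval_subst)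

lemma valuation_subst:
  assumes "algebra_of L A" "v \<in> UNIV \<rightarrow> carrier A" "range \<sigma> \<subseteq> formulas L"
  shows "(\<lambda>x. eval A v (\<sigma> x)) \<in> UNIV \<rightarrow> carrier A"
  using assms by (auto simp: formulas_def intro!: eval_closed)

lemma sat_qeqn_subst:
  assumes "algebra_of L A" "range \<sigma> \<subseteq> formulas L" "sat_qeqn A q"
  shows "sat_qeqn A (subst_qeqn \<sigma> q)"
  using assms valuation_subst[OF assms(1) _ assms(2)]
  by (simp add: sat_qeqn_def holds_at_subst)

lemma subst_Var: "subst Var t = t"
  by (induction t) (auto simp: map_idI)

lemma Var_formulas: "range Var \<subseteq> formulas L"
  by (auto simp: formulas_def)

section \<open>Congruences on terms and their quotients over a prescribed type\<close>

definition term_congruence :: "'f lang \<Rightarrow> 'f eqn set \<Rightarrow> bool" where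
  "term_congruence L P \<longleftrightarrow> P \<subseteq> eqns L \<and> equiv (formulas L) P \<and>
     (\<forall>f ss ts. L f = Some (length ss) \<longrightarrow> list_all2 (\<lambda>s t. (s, t) \<in> P) ss ts \<longrightarrow>
        (Fun f ss, Fun f ts) \<in> P)"

text \<open>The quotient has countably many classes, so it can be carried by the given infinite
  type. Every valuation into it lifts to a substitution; truth in the quotient thus becomes
  membership in \<open>P\<close>, and later arguments about it are purely syntactic.\<close>

lemma term_quotient:
  fixes L :: "'f lang"
  assumes L: "countable (dom L)" and inf: "infinite (UNIV :: 'b set)" and P: "term_congruence L P"
  obtains B :: "('f, 'b) ualg" and k where "algebra_of L B"
    and "\<And>v :: nat \<Rightarrow> 'b. v \<in> UNIV \<rightarrow> carrier B \<longleftrightarrow> (\<exists>\<sigma>. range \<sigma> \<subseteq> formulas L \<and> v = k \<circ> \<sigma>)"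
    and "\<And>\<sigma> e. range \<sigma> \<subseteq> formulas L \<Longrightarrow> e \<in> eqns L \<Longrightarrow>
           holds_at B (k \<circ> \<sigma>) e \<longleftrightarrow> subst_eqn \<sigma> e \<in> P"
proof -
  let ?F = "formulas L"
  have eq: "equiv ?F P" and cong: "\<And>f ss ts. L f = Some (length ss) \<Longrightarrow>
      list_all2 (\<lambda>s t. (s, t) \<in> P) ss ts \<Longrightarrow> (Fun f ss, Fun f ts) \<in> P"
    using P by (auto simp: term_congruence_def)
  obtain g :: "nat \<Rightarrow> 'b" where g: "inj g"
    using inf infinite_countable_subset by blast
  have cC: "countable (?F // P)"
    using countable_formulas[OF L] by (simp add: quotient_def)
  define k where "k t = g (to_nat_on (?F // P) (P `` {t}))" for t
  have k: "k s = k t \<longleftrightarrow> (s, t) \<in> P" if "s \<in> ?F" "t \<in> ?F" for s t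
  proof -
    have "k s = k t \<longleftrightarrow> P `` {s} = P `` {t}"
      unfolding k_def using that cC
      by (simp add: inj_eq[OF g] inj_on_eq_iff[OF inj_on_to_nat_on[OF cC]] quotientI)
    then show ?thesis using eq_equiv_class_iff[OF eq that] by simp
  qed
  \<comment> \<open>The operations are computed on chosen representatives; compatibility of
    \<open>P\<close> with the symbols makes the choice irrelevant.\<close>
  define r where "r x = (SOME t. t \<in> ?F \<and> k t = x)" for x
  have r: "r x \<in> ?F \<and> k (r x) = x" if "x \<in> k ` ?F" for x
    unfolding r_def by (rule someI_ex) (use that in auto)
  define B where "B = \<lparr>carrier = k ` ?F, interp = \<lambda>f xs. k (Fun f (map r xs))\<rparr>"
  have B: "algebra_of L B"
    unfolding algebra_of_def
  proof (intro conjI allI impI)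
    show "carrier B \<noteq> {}" using Var_formulas[of L] by (auto simp: B_def)
    fix f xs assume "L f = Some (length xs)" "set xs \<subseteq> carrier B"
    then have "Fun f (map r xs) \<in> ?F"
      using r by (auto simp: B_def formulas_def)
    then show "interp B f xs \<in> carrier B" by (simp add: B_def)
  qed
  have eval: "eval B (k \<circ> \<sigma>) t = k (subst \<sigma> t)" if \<sigma>: "range \<sigma> \<subseteq> ?F" and "t \<in> ?F" for \<sigma> t
    using that(2)
  proof (induction t)
    case (Fun f ts)
    then have ts: "\<And>t. t \<in> set ts \<Longrightarrow> t \<in> ?F" "L f = Some (length ts)"
      by (auto simp: formulas_def)
    have sub: "subst \<sigma> t \<in> ?F" if "t \<in> set ts" for t
      using ts(1)[OF that] wf_subst[OF \<sigma>] by (simp add: formulas_def)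
    have IH: "map (eval B (k \<circ> \<sigma>)) ts = map (k \<circ> subst \<sigma>) ts"
      by (intro map_cong refl) (subst comp_apply, rule Fun.IH, auto intro: ts(1))
    have r': "(r (k (subst \<sigma> t)), subst \<sigma> t) \<in> P" if "t \<in> set ts" for t
      using r[of "k (subst \<sigma> t)"] sub[OF that] k by blast
    have "(Fun f (map (r \<circ> (k \<circ> subst \<sigma>)) ts), Fun f (map (subst \<sigma>) ts)) \<in> P"
      by (rule cong) (auto simp: ts(2) list_all2_conv_all_nth r')
    moreover have "Fun f (map (r \<circ> (k \<circ> subst \<sigma>)) ts) \<in> ?F" "Fun f (map (subst \<sigma>) ts) \<in> ?F"
      using ts sub r by (auto simp: formulas_def)
    ultimately have "k (Fun f (map (r \<circ> (k \<circ> subst \<sigma>)) ts)) = k (Fun f (map (subst \<sigma>) ts))"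
      using k by blast
    then show ?case
      by (simp only: eval.simps subst.simps IH) (simp add: B_def)
  qed simp
  show thesis
  proof (rule that[OF B])
    fix v :: "nat \<Rightarrow> 'b"
    show "v \<in> UNIV \<rightarrow> carrier B \<longleftrightarrow> (\<exists>\<sigma>. range \<sigma> \<subseteq> ?F \<and> v = k \<circ> \<sigma>)"
    proof
      assume v: "v \<in> UNIV \<rightarrow> carrier B"
      then have "range (r \<circ> v) \<subseteq> ?F" "v = k \<circ> (r \<circ> v)"
        using r by (auto simp: B_def Pi_iff fun_eq_iff)
      then show "\<exists>\<sigma>. range \<sigma> \<subseteq> ?F \<and> v = k \<circ> \<sigma>" by blast
    qed (auto simp: B_def)
  next
    fix \<sigma> :: "nat \<Rightarrow> 'f trm" and e assume *: "range \<sigma> \<subseteq> ?F" "e \<in> eqns L"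
    then have "fst e \<in> ?F" "snd e \<in> ?F" "subst_eqn \<sigma> e \<in> eqns L"
      using subst_eqn_closed[OF *] by (auto simp: eqns_eq)
    then show "holds_at B (k \<circ> \<sigma>) e \<longleftrightarrow> subst_eqn \<sigma> e \<in> P"
      using * k by (cases e) (auto simp: holds_at_def eval eqns_eq)
  qed
qed

lemma Fun_eqns:
  assumes "L f = Some (length ss)" "list_all2 (\<lambda>s t. (s, t) \<in> P) ss ts" "P \<subseteq> eqns L"
  shows "(Fun f ss, Fun f ts) \<in> eqns L"
proof -
  have "(\<forall>s\<in>set ss. wf_term L s) \<and> (\<forall>t\<in>set ts. wf_term L t)"
    using assms(2) by induction (use assms(3) in \<open>auto simp: eqns_def\<close>)
  then show ?thesis
    using assms(1) list_all2_lengthD[OF assms(2)] by (simp add: eqns_def)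
qed

lemma term_congruenceI:
  assumes "P \<subseteq> eqns L" "\<And>t. t \<in> formulas L \<Longrightarrow> (t, t) \<in> P"
    and "\<And>s t. (s, t) \<in> P \<Longrightarrow> (t, s) \<in> P"
    and "\<And>s t u. (s, t) \<in> P \<Longrightarrow> (t, u) \<in> P \<Longrightarrow> (s, u) \<in> P"
    and "\<And>f ss ts. L f = Some (length ss) \<Longrightarrow> list_all2 (\<lambda>s t. (s, t) \<in> P) ss ts \<Longrightarrow>
          (Fun f ss, Fun f ts) \<in> P"
  shows "term_congruence L P"
  unfolding term_congruence_def
proof (intro conjI allI impI equivI)
  show "refl_on (formulas L) P" using assms(1,2) by (auto simp: refl_on_def eqns_eq)
  show "sym P" using assms(3) by (rule symI)
  show "trans P" using assms(4) by (rule transI)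
qed (use assms(1,5) in \<open>auto simp: eqns_eq\<close>)

text \<open>A subalgebra generated by countably many elements has a copy over every infinite type.\<close>

lemma countable_transfer:
  fixes A :: "('f, 'c) ualg"
  assumes L: "countable (dom L)" and inf: "infinite (UNIV :: 'b set)"
    and A: "algebra_of L A" and v: "v \<in> UNIV \<rightarrow> carrier A"
  obtains B :: "('f, 'b) ualg" and w where "algebra_of L B" "w \<in> UNIV \<rightarrow> carrier B"
    and "\<And>e. e \<in> eqns L \<Longrightarrow> holds_at B w e \<longleftrightarrow> holds_at A v e"
    and "\<And>q. q \<in> qeqns L \<Longrightarrow> sat_qeqn A q \<Longrightarrow> sat_qeqn B q"
proof -
  \<comment> \<open>This is the kernel of evaluation at \<open>v\<close>, so the quotient is a copy
    of the subalgebra generated by the values of \<open>v\<close>.\<close>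
  define P where "P = {e \<in> eqns L. holds_at A v e}"
  have cong: "term_congruence L P"
  proof (rule term_congruenceI)
    fix f ss ts assume *: "L f = Some (length ss)" "list_all2 (\<lambda>s t. (s, t) \<in> P) ss ts"
    then have "map (eval A v) ss = map (eval A v) ts"
      by (auto simp: list_all2_conv_all_nth P_def holds_at_def intro!: nth_equalityI)
    moreover have "(Fun f ss, Fun f ts) \<in> eqns L"
      by (rule Fun_eqns[where P = P]) (use * in \<open>auto simp: P_def\<close>)
    ultimately show "(Fun f ss, Fun f ts) \<in> P"
      unfolding P_def holds_at_def by (simp only: mem_Collect_eq fst_conv snd_conv eval.simps)
  qed (auto simp: P_def holds_at_def eqns_eq)
  obtain B :: "('f, 'b) ualg" and k where B: "algebra_of L B"
    and val: "\<And>v :: nat \<Rightarrow> 'b. v \<in> UNIV \<rightarrow> carrier B \<longleftrightarrow> (\<exists>\<sigma>. range \<sigma> \<subseteq> formulas L \<and> v = k \<circ> \<sigma>)"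
    and holds: "\<And>\<sigma> e. range \<sigma> \<subseteq> formulas L \<Longrightarrow> e \<in> eqns L \<Longrightarrow>
           holds_at B (k \<circ> \<sigma>) e \<longleftrightarrow> subst_eqn \<sigma> e \<in> P"
    by (rule term_quotient[OF L inf cong]) (rule that; assumption)
  show thesis
  proof (rule that[OF B, of "k \<circ> Var"])
    show "k \<circ> Var \<in> UNIV \<rightarrow> carrier B"
      unfolding val by (intro exI[of _ Var] conjI Var_formulas refl)
    show "holds_at B (k \<circ> Var) e \<longleftrightarrow> holds_at A v e" if "e \<in> eqns L" for e
      using holds[OF Var_formulas that] that by (cases e) (simp add: P_def subst_Var)
    fix q assume q: "q \<in> qeqns L" "sat_qeqn A q"
    then have e: "set (fst q) \<subseteq> eqns L" "snd q \<in> eqns L" by (auto simp: qeqns_def)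
    have inP: "subst_eqn \<sigma> d \<in> P \<longleftrightarrow> holds_at A (\<lambda>x. eval A v (\<sigma> x)) d"
      if "range \<sigma> \<subseteq> formulas L" "d \<in> eqns L" for \<sigma> d
      using subst_eqn_closed[OF that] by (simp add: P_def holds_at_subst)
    show "sat_qeqn B q"
      unfolding sat_qeqn_def
    proof (intro ballI impI)
      fix w assume w: "w \<in> UNIV \<rightarrow> carrier B" "\<forall>p\<in>set (fst q). holds_at B w p"
      then obtain \<sigma> where \<sigma>: "range \<sigma> \<subseteq> formulas L" "w = k \<circ> \<sigma>"
        unfolding val by blast
      have "\<forall>p\<in>set (fst q). holds_at A (\<lambda>x. eval A v (\<sigma> x)) p"
        using w(2) e \<sigma> holds inP by blast
      then have "holds_at A (\<lambda>x. eval A v (\<sigma> x)) (snd q)"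
        using q(2) valuation_subst[OF A v \<sigma>(1)] unfolding sat_qeqn_def by blast
      then show "holds_at B w (snd q)"
        using holds inP e(2) \<sigma> by blast
    qed
  qed
qed

text \<open>Reflexivity, symmetry, transitivity and compatibility with the symbols are themselves
  quasi-equations true in every algebra, so a set of equations closed under the rules of
  \<open>K\<close> is a congruence. The quotient lies in \<open>K\<close> because substitution
  instances of valid rules are valid. \<open>P\<close> need not be closed under substitution: it is
  the theory of one valuation.\<close>

lemma quasivariety_term_quotient:
  fixes K :: "('f, 'b) ualg set"
  assumes L: "countable (dom L)" and inf: "infinite (UNIV :: 'b set)" and K: "quasivariety L K"
    and P: "P \<subseteq> eqns L"
    and closed: "\<And>q. q \<in> qeqns L \<Longrightarrow> (\<And>A. A \<in> K \<Longrightarrow> sat_qeqn A q) \<Longrightarrow> set (fst q) \<subseteq> P \<Longrightarrow> snd q \<in> P"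
  obtains B k where "B \<in> K"
    and "\<And>v :: nat \<Rightarrow> 'b. v \<in> UNIV \<rightarrow> carrier B \<longleftrightarrow> (\<exists>\<sigma>. range \<sigma> \<subseteq> formulas L \<and> v = k \<circ> \<sigma>)"
    and "\<And>\<sigma> e. range \<sigma> \<subseteq> formulas L \<Longrightarrow> e \<in> eqns L \<Longrightarrow>
           holds_at B (k \<circ> \<sigma>) e \<longleftrightarrow> subst_eqn \<sigma> e \<in> P"
proof -
  have cong: "term_congruence L P"
  proof (rule term_congruenceI[OF P])
    show "(t, t) \<in> P" if "t \<in> formulas L" for t
      using closed[of "([], (t, t))"] that by (auto simp: qeqns_def eqns_eq sat_qeqn_def holds_at_def)
    show "(t, s) \<in> P" if "(s, t) \<in> P" for s t
      using closed[of "([(s, t)], (t, s))"] that P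
      by (auto simp: qeqns_def eqns_eq sat_qeqn_def holds_at_def)
    show "(s, u) \<in> P" if "(s, t) \<in> P" "(t, u) \<in> P" for s t u
      using closed[of "([(s, t), (t, u)], (s, u))"] that P
      by (auto simp: qeqns_def eqns_eq sat_qeqn_def holds_at_def)
    fix f ss ts assume *: "L f = Some (length ss)" "list_all2 (\<lambda>s t. (s, t) \<in> P) ss ts"
    then have len: "length ts = length ss" and zip: "set (zip ss ts) \<subseteq> P"
      by (auto simp: list_all2_iff)
    have "(Fun f ss, Fun f ts) \<in> eqns L"
      by (rule Fun_eqns[where P = P]) fact+
    moreover have "map (eval A v) ss = map (eval A v) ts"
      if "\<forall>p\<in>set (zip ss ts). holds_at A v p" for A :: "('f, 'b) ualg" and v
      using that len by (induction ss ts rule: list_induct2') (auto simp: holds_at_def)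
    ultimately show "(Fun f ss, Fun f ts) \<in> P"
      using closed[of "(zip ss ts, (Fun f ss, Fun f ts))"] zip P
      by (auto simp: qeqns_def sat_qeqn_def holds_at_def[of _ _ "(_, _)"] simp del: map_eq_conv)
  qed
  obtain B :: "('f, 'b) ualg" and k where B: "algebra_of L B"
    and val: "\<And>v :: nat \<Rightarrow> 'b. v \<in> UNIV \<rightarrow> carrier B \<longleftrightarrow> (\<exists>\<sigma>. range \<sigma> \<subseteq> formulas L \<and> v = k \<circ> \<sigma>)"
    and holds: "\<And>\<sigma> e. range \<sigma> \<subseteq> formulas L \<Longrightarrow> e \<in> eqns L \<Longrightarrow>
           holds_at B (k \<circ> \<sigma>) e \<longleftrightarrow> subst_eqn \<sigma> e \<in> P"
    by (rule term_quotient[OF L inf cong]) (rule that; assumption)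
  obtain Q where Q: "Q \<subseteq> qeqns L" "K = {A. algebra_of L A \<and> (\<forall>q\<in>Q. sat_qeqn A q)}"
    using K unfolding quasivariety_def by blast
  have "sat_qeqn B q" if q: "q \<in> Q" for q
    unfolding sat_qeqn_def
  proof (intro ballI impI)
    fix w assume w: "w \<in> UNIV \<rightarrow> carrier B" "\<forall>p\<in>set (fst q). holds_at B w p"
    then obtain \<sigma> where \<sigma>: "range \<sigma> \<subseteq> formulas L" "w = k \<circ> \<sigma>"
        unfolding val by blast
    have e: "q \<in> qeqns L" "set (fst q) \<subseteq> eqns L" "snd q \<in> eqns L"
      using q Q(1) qeqns_iff by blast+
    have "snd (subst_qeqn \<sigma> q) \<in> P"
    proof (rule closed)
      show "subst_qeqn \<sigma> q \<in> qeqns L" by (rule subst_qeqn_closed) fact+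
      show "sat_qeqn A (subst_qeqn \<sigma> q)" if "A \<in> K" for A
        using that q \<sigma>(1) unfolding Q(2) by (blast intro: sat_qeqn_subst)
      show "set (fst (subst_qeqn \<sigma> q)) \<subseteq> P"
        unfolding fst_map_prod set_map
      proof (rule image_subsetI)
        fix p assume p: "p \<in> set (fst q)"
        then have "p \<in> eqns L" using e(2) by blast
        from holds[OF \<sigma>(1) this] show "subst_eqn \<sigma> p \<in> P"
          using w(2) p unfolding \<sigma>(2) by blast
      qed
    qed
    then show "holds_at B w (snd q)"
      using holds[OF \<sigma>(1) e(3)] unfolding \<sigma>(2) snd_map_prod by blast
  qed
  then have "B \<in> K" unfolding Q(2) using B by blast
  then show thesis using val holds that by blast
qed

section \<open>Lattices of subquasivarieties\<close>

lemma quasivariety_restrict: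
  assumes "quasivariety L K" "Q \<subseteq> qeqns L"
  shows "quasivariety L {A \<in> K. \<forall>q\<in>Q. sat_qeqn A q}"
proof -
  obtain Q' where "Q' \<subseteq> qeqns L" "K = {A. algebra_of L A \<and> (\<forall>q\<in>Q'. sat_qeqn A q)}"
    using assms(1) unfolding quasivariety_def by blast
  then show ?thesis
    unfolding quasivariety_def using assms(2) by (intro exI[of _ "Q' \<union> Q"]) auto
qed

lemma quasivariety_member:
  assumes "quasivariety L K"
  shows "A \<in> K \<longleftrightarrow> algebra_of L A \<and> (\<forall>q\<in>qeqns L. (\<forall>B\<in>K. sat_qeqn B q) \<longrightarrow> sat_qeqn A q)"
  using assms unfolding quasivariety_def by blast

lemma subquasivarieties_carrier:
  "carrier (subquasivarieties L K) = {K'. quasivariety L K' \<and> K' \<subseteq> K}"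
  "le (subquasivarieties L K) = (\<subseteq>)"
  by (simp_all add: subquasivarieties_def)

lemma lattice_subquasivarieties: "quasivariety L K \<Longrightarrow> lattice (subquasivarieties L K)"
  by (intro complete_lattice_lattice complete_lattice_subquasivarieties)

lemma subquasivarieties_join:
  assumes "quasivariety L K" "quasivariety L M" "quasivariety L N" "M \<subseteq> K" "N \<subseteq> K"
  shows "M \<squnion>\<^bsub>subquasivarieties L K\<^esub> N =
    {A \<in> K. \<forall>q\<in>qeqns L. (\<forall>B\<in>M \<union> N. sat_qeqn B q) \<longrightarrow> sat_qeqn A q}" (is "_ = ?J")
  unfolding subquasivarieties_def
proof (rule incl_order_join_eqI)
  have "?J = {A \<in> K. \<forall>q\<in>{q\<in>qeqns L. \<forall>B\<in>M \<union> N. sat_qeqn B q}. sat_qeqn A q}" by blast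
  then show "?J \<in> {K'. quasivariety L K' \<and> K' \<subseteq> K}"
    using quasivariety_restrict[OF assms(1), of "{q\<in>qeqns L. \<forall>B\<in>M \<union> N. sat_qeqn B q}"] by auto
  show "?J \<subseteq> W" if W: "W \<in> {K'. quasivariety L K' \<and> K' \<subseteq> K}" "M \<subseteq> W" "N \<subseteq> W" for W
  proof
    fix A assume A: "A \<in> ?J"
    then have "algebra_of L A" using quasivariety_member[OF assms(1)] by blast
    moreover have "quasivariety L W" using W by blast
    ultimately show "A \<in> W"
      unfolding quasivariety_member[OF \<open>quasivariety L W\<close>, of A] using A W(2,3) by blast
  qed
qed (use assms in auto)

lemma subquasivarieties_meet:
  assumes "quasivariety L M" "quasivariety L N" "M \<subseteq> K" "N \<subseteq> K"
  shows "M \<sqinter>\<^bsub>subquasivarieties L K\<^esub> N = M \<inter> N"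
proof -
  have "quasivariety L (M \<inter> N)" using quasivariety_Inter[of "{M, N}" L] assms by auto
  then show ?thesis
    unfolding subquasivarieties_def using assms by (intro incl_order_meet_eqI) auto
qed


section \<open>The lattice of semilattices of finite sets\<close>

text \<open>The empty set stands for the trivial algebra: as an index set it gives the empty
  product, and as a set of failures it says that no equation fails.\<close>

definition union_semilattices :: "nat set set set" where
  "union_semilattices = {W. W \<subseteq> Collect finite \<and> {} \<in> W \<and> (\<forall>X\<in>W. \<forall>Y\<in>W. X \<union> Y \<in> W)}"

abbreviation semilattice_lattice :: "nat set set gorder" where
  "semilattice_lattice \<equiv> incl_order union_semilattices"

lemma union_semilatticesD:
  assumes "W \<in> union_semilattices"
  shows "X \<in> W \<Longrightarrow> finite X" "{} \<in> W" "X \<in> W \<Longrightarrow> Y \<in> W \<Longrightarrow> X \<union> Y \<in> W"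
  using assms by (auto simp: union_semilattices_def)

lemma lattice_semilattice_lattice: "lattice semilattice_lattice"
  by (intro complete_lattice_lattice complete_lattice_incl_order[of "Collect finite"])
    (auto simp: union_semilattices_def)

lemma semilattice_join:
  assumes "V \<in> union_semilattices" "W \<in> union_semilattices"
  shows "V \<squnion>\<^bsub>semilattice_lattice\<^esub> W = {X \<union> Y |X Y. X \<in> V \<and> Y \<in> W}" (is "_ = ?J")
proof (rule incl_order_join_eqI)
  show "?J \<in> union_semilattices"
    unfolding union_semilattices_def
  proof (rule CollectI, intro conjI ballI)
    show "?J \<subseteq> Collect finite" "{} \<in> ?J"
      using assms by (auto simp: union_semilattices_def)
    fix Z Z' assume "Z \<in> ?J" "Z' \<in> ?J"
    then obtain X Y X' Y' where *: "X \<in> V" "Y \<in> W" "X' \<in> V" "Y' \<in> W" "Z = X \<union> Y" "Z' = X' \<union> Y'"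
      by blast
    then have "Z \<union> Z' = (X \<union> X') \<union> (Y \<union> Y')" "X \<union> X' \<in> V" "Y \<union> Y' \<in> W"
      using assms union_semilatticesD(3) by auto
    then show "Z \<union> Z' \<in> ?J" by blast
  qed
  show "V \<subseteq> ?J" "W \<subseteq> ?J"
    using assms union_semilatticesD(2) by blast+
  show "?J \<subseteq> U" if "U \<in> union_semilattices" "V \<subseteq> U" "W \<subseteq> U" for U
    using that union_semilatticesD(3) by blast
qed fact+

lemma semilattice_Int:
  "V \<in> union_semilattices \<Longrightarrow> W \<in> union_semilattices \<Longrightarrow> V \<inter> W \<in> union_semilattices"
  by (auto simp: union_semilattices_def)

lemma semilattice_meet:
  assumes "V \<in> union_semilattices" "W \<in> union_semilattices"
  shows "V \<sqinter>\<^bsub>semilattice_lattice\<^esub> W = V \<inter> W"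
  by (rule incl_order_meet_eqI) (use assms semilattice_Int in auto)

lemma semilattice_Union:
  assumes "W \<in> union_semilattices" "finite D" "D \<subseteq> W"
  shows "\<Union>D \<in> W"
  using assms(2,3) by induction (use assms(1) union_semilatticesD in auto)

text \<open>The interior operator belonging to \<open>W\<close>: for finite \<open>X\<close> and a
  semilattice \<open>W\<close> it yields the largest member of \<open>W\<close> inside
  \<open>X\<close>.\<close>

definition semilattice_core :: "nat set set \<Rightarrow> nat set \<Rightarrow> nat set" where
  "semilattice_core W X = \<Union>{Z \<in> W. Z \<subseteq> X}"

lemma semilattice_core_subset: "semilattice_core W X \<subseteq> X"
  by (auto simp: semilattice_core_def)

lemma semilattice_core_mono: "V \<subseteq> W \<Longrightarrow> X \<subseteq> Y \<Longrightarrow> semilattice_core V X \<subseteq> semilattice_core W Y"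
  by (auto simp: semilattice_core_def)

lemma semilattice_core_in:
  assumes "W \<in> union_semilattices" "finite X"
  shows "semilattice_core W X \<in> W"
proof -
  have "finite {Z \<in> W. Z \<subseteq> X}"
    using assms(2) by (rule finite_subset[rotated, OF finite_Pow_iff[THEN iffD2]]) blast
  then show ?thesis unfolding semilattice_core_def by (rule semilattice_Union[OF assms(1)]) blast
qed

lemma semilattice_core_eq: "X \<in> W \<Longrightarrow> semilattice_core W X = X"
  by (auto simp: semilattice_core_def)


section \<open>Direct products\<close>

text \<open>The factors share the operations \<open>op\<close> and differ only in their carriers.
  Evaluation never consults the carrier, which is why a factor may appear below with an arbitrary
  carrier \<open>S\<close>.\<close>

definition direct_product ::
  "'i set \<Rightarrow> ('i \<Rightarrow> 'x set) \<Rightarrow> ('f \<Rightarrow> 'x list \<Rightarrow> 'x) \<Rightarrow> ('f, 'i \<Rightarrow> 'x) ualg" where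
  "direct_product I C op =
     \<lparr>carrier = Pi\<^sub>E I C, interp = \<lambda>f as. \<lambda>i\<in>I. op f (map (\<lambda>a. a i) as)\<rparr>"

lemma carrier_direct_product [simp]: "carrier (direct_product I C op) = Pi\<^sub>E I C"
  by (simp add: direct_product_def)

lemma algebra_of_direct_product:
  assumes "\<And>i. i \<in> I \<Longrightarrow> algebra_of L \<lparr>carrier = C i, interp = op\<rparr>"
  shows "algebra_of L (direct_product I C op)"
  unfolding algebra_of_def
proof (intro conjI allI impI)
  show "carrier (direct_product I C op) \<noteq> {}"
    using assms by (auto simp: PiE_eq_empty_iff algebra_of_def)
  fix f as assume *: "L f = Some (length as)" "set as \<subseteq> carrier (direct_product I C op)"
  have "op f (map (\<lambda>a. a i) as) \<in> C i" if "i \<in> I" for i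
  proof -
    have "set (map (\<lambda>a. a i) as) \<subseteq> C i" "L f = Some (length (map (\<lambda>a. a i) as))"
      using * that by auto
    then show ?thesis using assms[OF that] unfolding algebra_of_def by fastforce
  qed
  then show "interp (direct_product I C op) f as \<in> carrier (direct_product I C op)"
    by (simp add: direct_product_def)
qed

lemma eval_direct_product:
  assumes "v \<in> UNIV \<rightarrow> Pi\<^sub>E I C"
  shows "eval (direct_product I C op) v t = (\<lambda>i\<in>I. eval \<lparr>carrier = S, interp = op\<rparr> (\<lambda>x. v x i) t)"
proof (induction t)
  case (Var x)
  have "v x \<in> Pi\<^sub>E I C" using assms by auto
  then show ?case by (simp add: PiE_restrict)
next
  case (Fun f ts)
  have "\<And>i. i \<in> I \<Longrightarrow> map ((\<lambda>a. a i) \<circ> eval (direct_product I C op) v) ts =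
      map (eval \<lparr>carrier = S, interp = op\<rparr> (\<lambda>x. v x i)) ts"
    using Fun.IH by simp
  then have "(\<lambda>i\<in>I. op f (map ((\<lambda>a. a i) \<circ> eval (direct_product I C op) v) ts)) =
      (\<lambda>i\<in>I. eval \<lparr>carrier = S, interp = op\<rparr> (\<lambda>x. v x i) (Fun f ts))"
    by (intro restrict_ext) (simp only: eval.simps ualg.select_convs)
  moreover have "eval (direct_product I C op) v (Fun f ts) =
      (\<lambda>i\<in>I. op f (map ((\<lambda>a. a i) \<circ> eval (direct_product I C op) v) ts))"
    by (simp add: direct_product_def)
  ultimately show ?case by simp
qed

lemma restrict_eq_iff: "restrict f I = restrict g I \<longleftrightarrow> (\<forall>i\<in>I. f i = g i)"
  by (metis restrict_apply' restrict_ext)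

lemma holds_at_direct_product:
  assumes "v \<in> UNIV \<rightarrow> Pi\<^sub>E I C"
  shows "holds_at (direct_product I C op) v e \<longleftrightarrow>
    (\<forall>i\<in>I. holds_at \<lparr>carrier = S, interp = op\<rparr> (\<lambda>x. v x i) e)"
  unfolding holds_at_def eval_direct_product[OF assms, of _ _ S] by (rule restrict_eq_iff)

lemma sat_eqn_direct_product:
  assumes "sat_eqn \<lparr>carrier = S, interp = op\<rparr> e" "\<And>i. i \<in> I \<Longrightarrow> C i \<subseteq> S"
  shows "sat_eqn (direct_product I C op) e"
  unfolding sat_eqn_def
proof
  fix v :: "nat \<Rightarrow> 'c \<Rightarrow> 'a" assume v: "v \<in> UNIV \<rightarrow> carrier (direct_product I C op)"
  then have "(\<lambda>x. v x i) \<in> UNIV \<rightarrow> S" if "i \<in> I" for i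
    using assms(2)[OF that] that by (auto simp: Pi_iff PiE_iff)
  then show "holds_at (direct_product I C op) v e"
    using assms(1) v by (subst holds_at_direct_product[where S = S]) (auto simp: sat_eqn_def)
qed

text \<open>A valuation restricts to both index sets. True premises stay true under restriction, and
  the conclusion is then verified at every coordinate of the union. Overlapping index sets cause no
  conflict.\<close>

lemma sat_qeqn_direct_product_Un:
  assumes "sat_qeqn (direct_product I C op) q" "sat_qeqn (direct_product J C op) q"
  shows "sat_qeqn (direct_product (I \<union> J) C op) q"
  unfolding sat_qeqn_def
proof (intro ballI impI)
  fix v assume v: "v \<in> UNIV \<rightarrow> carrier (direct_product (I \<union> J) C op)"
    and prem: "\<forall>p\<in>set (fst q). holds_at (direct_product (I \<union> J) C op) v p"
  define S :: "'b set" where "S = UNIV"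
  have vIJ: "v \<in> UNIV \<rightarrow> Pi\<^sub>E (I \<union> J) C" using v by simp
  have *: "\<forall>i\<in>K. holds_at \<lparr>carrier = S, interp = op\<rparr> (\<lambda>x. v x i) (snd q)"
    if K: "sat_qeqn (direct_product K C op) q" "K \<subseteq> I \<union> J" for K
  proof -
    define w where "w x = restrict (v x) K" for x
    have w: "w \<in> UNIV \<rightarrow> Pi\<^sub>E K C" using vIJ K(2) by (auto simp: w_def Pi_iff PiE_iff)
    have holds: "holds_at (direct_product K C op) w e \<longleftrightarrow>
        (\<forall>i\<in>K. holds_at \<lparr>carrier = S, interp = op\<rparr> (\<lambda>x. v x i) e)" for e
      by (subst holds_at_direct_product[OF w, where S = S]) (simp add: w_def)
    have "\<forall>p\<in>set (fst q). holds_at (direct_product K C op) w p"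
      using prem K(2) unfolding holds holds_at_direct_product[OF vIJ, where S = S] by blast
    then show ?thesis
      using K(1) w unfolding sat_qeqn_def holds[symmetric] by simp
  qed
  show "holds_at (direct_product (I \<union> J) C op) v (snd q)"
    unfolding holds_at_direct_product[OF vIJ, where S = S] using *[OF assms(1)] *[OF assms(2)] by blast
qed


section \<open>Rational product algebras of real numbers\<close>

text \<open>One set of axioms in the language with constants makes membership in \<open>RPA\<close>
  comparable across types, as needed to pass from algebras of real tuples to algebras over an
  arbitrary infinite type.\<close>

definition rpa_axioms :: "rp_sym eqn set" where
  "rpa_axioms = map_prod (map_trm BL) (map_trm BL) `
     {e \<in> eqns bl_lang. sat_eqn std_product_algebra e} \<union> bookkeeping"

lemma RPA_iff: "A \<in> RPA \<longleftrightarrow> algebra_of rp_lang A \<and> (\<forall>e\<in>rpa_axioms. sat_eqn A e)"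
proof -
  have ev: "eval A v (map_trm BL t) = eval (bl_reduct A) v t" for v t
    by (induction t) (auto simp: bl_reduct_def intro!: arg_cong[of _ _ "interp A _"])
  have sat: "sat_eqn A (map_prod (map_trm BL) (map_trm BL) e) \<longleftrightarrow> sat_eqn (bl_reduct A) e" for e
    by (auto simp: sat_eqn_def holds_at_def ev) (auto simp: bl_reduct_def)
  have red: "algebra_of bl_lang (bl_reduct A)" if "algebra_of rp_lang A"
    using that by (auto simp: algebra_of_def bl_reduct_def)
  show ?thesis
    using red by (auto simp: RPA_def product_algebras_def variety_generated_def rpa_axioms_def
        ball_Un sat)
qed

lemma rpa_axioms_eqns: "rpa_axioms \<subseteq> eqns rp_lang"
proof -
  have wf: "wf_term rp_lang (map_trm BL t) \<longleftrightarrow> wf_term bl_lang t" for t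
    by (induction t) auto
  show ?thesis
    using bookkeeping_eqns by (auto simp: rpa_axioms_def eqns_def wf)
qed

fun real_rp_op :: "rp_sym \<Rightarrow> real list \<Rightarrow> real" where
  "real_rp_op (BL s) xs = std_product_op s xs"
| "real_rp_op (Const q) xs = of_rat q"

definition real_rpa :: "(rp_sym, real) ualg" where
  "real_rpa = \<lparr>carrier = {0..1}, interp = real_rp_op\<rparr>"

lemma real_rpa_RPA: "real_rpa \<in> RPA"
  unfolding RPA_def
proof (intro CollectI conjI ballI)
  show "algebra_of rp_lang real_rpa"
    unfolding algebra_of_def
  proof (intro conjI allI impI)
    fix f xs assume *: "rp_lang f = Some (length xs)" "set xs \<subseteq> carrier real_rpa"
    show "interp real_rpa f xs \<in> carrier real_rpa"
    proof (cases f)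
      case (BL s)
      then show ?thesis
        using * algebra_of_std_product_algebra
        by (simp add: real_rpa_def algebra_of_def std_product_algebra_def)
    next
      case (Const q)
      then show ?thesis
        using * by (auto simp: real_rpa_def split: if_splits)
    qed
  qed (simp add: real_rpa_def)
  have "bl_reduct real_rpa = std_product_algebra"
    by (simp add: bl_reduct_def real_rpa_def std_product_algebra_def fun_eq_iff)
  then show "bl_reduct real_rpa \<in> product_algebras"
    by (simp add: product_algebras_def variety_generated_def algebra_of_std_product_algebra)
  have "prod_imp (of_rat p :: real) (of_rat q) = of_rat (prod_imp p q)" for p q
    by (simp add: prod_imp_def of_rat_less_eq of_rat_divide)
  then show "sat_eqn real_rpa e" if "e \<in> bookkeeping" for e
    using that by (auto simp: bookkeeping_def sat_eqn_def holds_at_def real_rpa_def of_rat_mult)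
qed

section \<open>Chains with the square root of a single prime\<close>

definition nth_prime :: "nat \<Rightarrow> nat" where
  "nth_prime = enumerate {p. prime p}"

lemma prime_nth_prime: "prime (nth_prime n)"
  using enumerate_in_set[OF primes_infinite] by (simp add: nth_prime_def)

lemma nth_prime_pos: "nth_prime n > 0"
  using prime_nth_prime by (rule prime_gt_0_nat)

lemma nth_prime_eq_iff: "nth_prime m = nth_prime n \<longleftrightarrow> m = n"
  using strict_mono_enumerate[OF primes_infinite] by (simp add: nth_prime_def strict_mono_eq)

text \<open>\<open>p\<close> divides \<open>p * m\<close> exactly once, and an odd exponent cannot
  occur in the square of a rational.\<close>

lemma prime_mult_not_rat_square:
  assumes "prime p" "\<not> p dvd m" "(r :: real) \<in> \<rat>"
  shows "r\<^sup>2 \<noteq> real (p * m)"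
proof
  assume r: "r\<^sup>2 = real (p * m)"
  obtain a b :: nat where ab: "b \<noteq> 0" "\<bar>r\<bar> = real a / real b" "coprime a b"
    using Rats_abs_nat_div_natE[OF assms(3)] by metis
  have "r\<^sup>2 = (real a / real b)\<^sup>2" using ab(2) by (metis power2_abs)
  then have "real (a\<^sup>2) = real (p * m * b\<^sup>2)"
    using r ab(1) by (simp add: power_divide field_simps)
  then have eq: "a\<^sup>2 = p * m * b\<^sup>2" by (simp only: of_nat_eq_iff)
  then have "p dvd a\<^sup>2" by simp
  then have "p dvd a" using prime_dvd_power[OF assms(1)] by blast
  then obtain k where k: "a = p * k" by blast
  have "p * (p * k\<^sup>2) = p * (m * b\<^sup>2)"
    using eq unfolding k by (simp add: power2_eq_square ac_simps)
  then have "p dvd m * b\<^sup>2"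
    using assms(1) by (metis dvd_triv_left mult_cancel1 not_prime_0)
  then have "p dvd b"
    using assms(1,2) prime_dvd_multD prime_dvd_power by blast
  with \<open>p dvd a\<close> ab(3) assms(1) show False
    by (meson coprime_common_divisor not_prime_unit)
qed

definition chain :: "nat \<Rightarrow> real set" where
  "chain n = {s \<in> {0..1}. s \<in> \<rat> \<or> s * sqrt (nth_prime n) \<in> \<rat>}"

text \<open>The positive rationals and their multiples by the square root of the prime form a
  multiplicative group, since two elements of the second coset multiply to a rational. Implication
  yields either 1 or a quotient of two elements.\<close>

lemma algebra_of_chain: "algebra_of rp_lang \<lparr>carrier = chain n, interp = real_rp_op\<rparr>"
  unfolding algebra_of_def
proof (intro conjI allI impI)
  have "0 \<in> chain n" by (simp add: chain_def)
  then show "carrier \<lparr>carrier = chain n, interp = real_rp_op\<rparr> \<noteq> {}" by auto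
  let ?p = "real (nth_prime n)"
  have p: "?p > 0" "sqrt ?p * sqrt ?p = ?p" "?p \<in> \<rat>" "sqrt ?p > 0"
    using nth_prime_pos by simp_all
  fix f xs assume *: "rp_lang f = Some (length xs)"
    "set xs \<subseteq> carrier \<lparr>carrier = chain n, interp = real_rp_op\<rparr>"
  then have xs: "set xs \<subseteq> chain n" by simp
  have "set xs \<subseteq> carrier real_rpa"
    using xs by (auto simp: chain_def real_rpa_def)
  then have range: "real_rp_op f xs \<in> {0..1}"
    using real_rpa_RPA * unfolding RPA_def algebra_of_def by (auto simp: real_rpa_def)
  \<comment> \<open>The bounds of the interval are dropped so that division can be treated without
    restriction; they are recovered from the closure of the full interval, stored in
    \<open>range\<close>.\<close>
  define T where "T = {r. r \<in> \<rat> \<or> r * sqrt ?p \<in> \<rat>}"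
  have chain: "a \<in> T" if "a \<in> chain n" for a
    using that by (auto simp: chain_def T_def)
  have mult: "a * b \<in> T" if "a \<in> T" "b \<in> T" for a b
  proof -
    have "a * b = (a * sqrt ?p) * (b * sqrt ?p) / ?p" using p by (simp add: field_simps)
    then have "a * b \<in> \<rat>" if "a * sqrt ?p \<in> \<rat>" "b * sqrt ?p \<in> \<rat>"
      using that p(3) by (metis Rats_divide Rats_mult)
    moreover have "a * b * sqrt ?p = a * (b * sqrt ?p)" "a * b * sqrt ?p = b * (a * sqrt ?p)"
      by simp_all
    ultimately show ?thesis
      using that unfolding T_def by (metis (mono_tags, lifting) Rats_mult mem_Collect_eq)
  qed
  have divide: "b / a \<in> T" if "a \<in> T" "b \<in> T" "a \<noteq> 0" for a b
  proof -
    have "b / a = (b * sqrt ?p) / (a * sqrt ?p)" "b / a * sqrt ?p = (b * sqrt ?p) / a"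
      "b / a * sqrt ?p = b * ?p / (a * sqrt ?p)"
      using p that(3) by (simp_all add: field_simps)
    then show ?thesis
      using that(1,2) p(3) unfolding T_def
      by (metis (mono_tags, lifting) Rats_divide Rats_mult mem_Collect_eq)
  qed
  have const: "of_rat q \<in> T" "0 \<in> T" "1 \<in> T" for q by (simp_all add: T_def)
  have "real_rp_op f xs \<in> T"
  proof (cases f)
    case (BL s)
    have "prod_imp a b \<in> T" if "a \<in> chain n" "b \<in> chain n" for a b
      using that chain divide const by (auto simp: prod_imp_def chain_def)
    then show ?thesis
      using *(1) xs mult chain const BL
      by (cases s) (auto simp: bl_lang_def length_Suc_conv numeral_2_eq_2 min_def max_def
          eq_commute[of _ "length xs"])
  qed (simp add: const)
  then show "interp \<lparr>carrier = chain n, interp = real_rp_op\<rparr> f xs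
      \<in> carrier \<lparr>carrier = chain n, interp = real_rp_op\<rparr>"
    using range by (simp add: chain_def T_def)
qed

text \<open>With \<open>p\<close> and \<open>q\<close> the primes of \<open>m\<close> and
  \<open>n\<close>, clearing denominators would make \<open>q\<close> or \<open>q * p\<close> the
  square of a rational, according to whether \<open>s\<close> or its multiple by the root of
  \<open>p\<close> is rational.\<close>

lemma chain_square:
  assumes "s \<in> chain m" "s * s = 1 / nth_prime n"
  shows "m = n"
proof (rule ccontr)
  assume "m \<noteq> n"
  let ?p = "nth_prime m" and ?q = "nth_prime n"
  have pos: "real ?p > 0" "real ?q > 0" using nth_prime_pos by simp_all
  consider "s \<in> \<rat>" | "s * sqrt ?p \<in> \<rat>" using assms(1) by (auto simp: chain_def)
  then show False
  proof cases
    case 1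
    have "(s * ?q)\<^sup>2 = real (?q * 1)"
      using assms(2) pos by (simp add: power2_eq_square field_simps)
    moreover have "s * ?q \<in> \<rat>" using 1 by simp
    ultimately show False
      using prime_mult_not_rat_square[of ?q 1 "s * ?q"] prime_nth_prime by (simp add: prime_nat_iff)
  next
    case 2
    have "(s * sqrt ?p * ?q)\<^sup>2 = (s * s) * ?p * ?q * ?q"
      using pos by (simp add: power2_eq_square)
    then have "(s * sqrt ?p * ?q)\<^sup>2 = real (?q * ?p)"
      using pos unfolding assms(2) by simp
    moreover have "s * sqrt ?p * ?q \<in> \<rat>" using 2 by simp
    moreover have "\<not> ?q dvd ?p"
      using prime_nth_prime \<open>m \<noteq> n\<close> nth_prime_eq_iff primes_dvd_imp_eq by metis
    ultimately show False
      using prime_mult_not_rat_square[OF prime_nth_prime] by blast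
  qed
qed

lemma sqrt_in_chain: "sqrt (1 / nth_prime n) \<in> chain n"
proof -
  have "real (nth_prime n) \<ge> 1" using nth_prime_pos[of n] by linarith
  then show ?thesis by (simp add: chain_def real_sqrt_divide)
qed

text \<open>In $[0,1]$ a finite join is 1 only if one of its entries is, and \<open>biimp\<close> is
  1 only at equal arguments. A finite disjunction of equations is therefore expressed by one
  equation; the empty disjunction becomes 0, which differs from 1.\<close>

fun join_list :: "rp_sym trm list \<Rightarrow> rp_sym trm" where
  "join_list [] = Fun (BL BZero) []"
| "join_list (t # ts) = Fun (BL BJoin) [t, join_list ts]"

definition biimp :: "rp_sym trm \<Rightarrow> rp_sym trm \<Rightarrow> rp_sym trm" where
  "biimp s t = Fun (BL BMult) [Fun (BL BImp) [s, t], Fun (BL BImp) [t, s]]"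

text \<open>In a chain, the equation says that the square of \<open>Var 0\<close> is the reciprocal of one of the
  primes indexed by \<open>X\<close>.\<close>

definition square_eqn :: "nat set \<Rightarrow> rp_sym eqn" where
  "square_eqn X = (join_list (map (\<lambda>x. biimp (Fun (BL BMult) [Var 0, Var 0])
     (cst (1 / of_nat (nth_prime x)))) (sorted_list_of_set X)), Fun (BL BOne) [])"

lemma square_eqn_closed: "square_eqn X \<in> eqns rp_lang"
proof -
  have wf: "wf_term rp_lang (join_list ts) \<longleftrightarrow> (\<forall>t\<in>set ts. wf_term rp_lang t)" for ts
    by (induction ts) (auto simp: bl_lang_def)
  have "1 / of_nat (nth_prime x) \<le> (1 :: rat)" for x
    using nth_prime_pos[of x] by (simp add: divide_le_eq_1)
  then show ?thesis
    by (auto simp: square_eqn_def eqns_def wf biimp_def bl_lang_def)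
qed

lemma holds_at_square_eqn:
  assumes "finite X" "v 0 \<in> {0..1}"
  shows "holds_at \<lparr>carrier = S, interp = real_rp_op\<rparr> v (square_eqn X) \<longleftrightarrow>
    (\<exists>x\<in>X. v 0 * v 0 = 1 / nth_prime x)"
proof -
  let ?A = "\<lparr>carrier = S, interp = real_rp_op\<rparr>"
  have join: "eval ?A v (join_list ts) = 1 \<longleftrightarrow> (\<exists>t\<in>set ts. eval ?A v t = 1)"
    "eval ?A v (join_list ts) \<le> 1"
    if "\<forall>t\<in>set ts. eval ?A v t \<le> 1" for ts
    using that by (induction ts) (auto simp: max_def)
  have imp: "prod_imp a b * prod_imp b a \<le> 1" "prod_imp a b * prod_imp b a = 1 \<longleftrightarrow> a = b"
    if "0 \<le> a" "0 \<le> b" for a b :: real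
    using that by (auto simp: prod_imp_def divide_simps)
  show ?thesis
    using assms unfolding square_eqn_def holds_at_def
    by (simp add: join imp biimp_def of_rat_divide)
qed

text \<open>For empty \<open>X\<close> this has a single element and satisfies every equation,
  including \<open>square_eqn {}\<close>, which has no solution in a chain.\<close>

definition prime_algebra :: "nat set \<Rightarrow> (rp_sym, nat \<Rightarrow> real) ualg" where
  "prime_algebra X = direct_product X chain real_rp_op"

lemma algebra_of_prime_algebra: "algebra_of rp_lang (prime_algebra X)"
  unfolding prime_algebra_def by (rule algebra_of_direct_product) (rule algebra_of_chain)

lemma sat_eqn_prime_algebra: "e \<in> rpa_axioms \<Longrightarrow> sat_eqn (prime_algebra X) e"
  unfolding prime_algebra_def using real_rpa_RPA
  by (intro sat_eqn_direct_product[where S = "{0..1}"])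
    (auto simp: RPA_iff real_rpa_def chain_def)

text \<open>By \<open>chain_square\<close> the prime whose reciprocal occurs at coordinate
  \<open>x\<close> must be the one belonging to \<open>x\<close>. A solution for \<open>Y\<close>
  thus exists only when \<open>X\<close> is contained in \<open>Y\<close>.\<close>

lemma holds_at_prime_algebra:
  assumes "finite Y" "v \<in> UNIV \<rightarrow> carrier (prime_algebra X)"
  shows "holds_at (prime_algebra X) v (square_eqn Y) \<longleftrightarrow>
    (\<forall>x\<in>X. x \<in> Y \<and> v 0 x * v 0 x = 1 / nth_prime x)"
proof -
  have v: "v \<in> UNIV \<rightarrow> Pi\<^sub>E X chain" using assms(2) by (simp add: prime_algebra_def)
  then have chain: "v 0 x \<in> chain x" if "x \<in> X" for x
    using that by (auto simp: Pi_iff PiE_iff)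
  have "v 0 x \<in> {0..1}" if "x \<in> X" for x
    using chain[OF that] by (simp add: chain_def)
  then have "holds_at (prime_algebra X) v (square_eqn Y) \<longleftrightarrow>
      (\<forall>x\<in>X. \<exists>y\<in>Y. v 0 x * v 0 x = 1 / nth_prime y)"
    unfolding prime_algebra_def holds_at_direct_product[OF v, where S = UNIV]
    using holds_at_square_eqn[OF assms(1)] by simp
  then show ?thesis
    using chain_square[OF chain] by metis
qed


section \<open>Semilattices inside the lattice of quasivarieties of rational product algebras\<close>

instance bl_sym :: countable
  by countable_datatype

instance rp_sym :: countable
  by countable_datatype

lemma countable_rp_lang: "countable (dom rp_lang)"
  by (rule countableI_type)

lemma quasivariety_RPA: "quasivariety rp_lang RPA"
  by (intro variety_imp_quasivariety variety_RPA)

text \<open>The quasivariety generated by the prime algebras of \<open>W\<close>, described by their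
  common quasi-equations because the generators are not algebras over \<open>'a\<close>.\<close>

definition semilattice_lo :: "nat set set \<Rightarrow> (rp_sym, 'a) ualg set" where
  "semilattice_lo W =
     {A \<in> RPA. \<forall>q \<in> {q \<in> qeqns rp_lang. \<forall>X\<in>W. sat_qeqn (prime_algebra X) q}. sat_qeqn A q}"

text \<open>The rules say that a solution for \<open>X\<close> is already one for the largest member
  of \<open>W\<close> inside \<open>X\<close>. Admitting every finite \<open>Y\<close> above that
  member makes the rules for a larger semilattice a subset of those for a smaller one, whence
  monotonicity.\<close>

definition semilattice_hi :: "nat set set \<Rightarrow> (rp_sym, 'a) ualg set" where
  "semilattice_hi W =
     {A \<in> RPA. \<forall>q \<in> {([square_eqn X], square_eqn Y) |X Y.
        finite X \<and> finite Y \<and> semilattice_core W X \<subseteq> Y}. sat_qeqn A q}"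

lemma semilattice_hiD:
  assumes "A \<in> semilattice_hi W" "finite X" "finite Y" "semilattice_core W X \<subseteq> Y"
    and "v \<in> UNIV \<rightarrow> carrier A" "holds_at A v (square_eqn X)"
  shows "holds_at A v (square_eqn Y)"
proof -
  have "sat_qeqn A ([square_eqn X], square_eqn Y)"
    using assms(1-4) unfolding semilattice_hi_def by blast
  then show ?thesis using assms(5,6) by (simp add: sat_qeqn_def)
qed

lemma semilattice_hiI:
  assumes "A \<in> RPA" "\<And>X Y v. finite X \<Longrightarrow> finite Y \<Longrightarrow> semilattice_core W X \<subseteq> Y \<Longrightarrow>
    v \<in> UNIV \<rightarrow> carrier A \<Longrightarrow> holds_at A v (square_eqn X) \<Longrightarrow> holds_at A v (square_eqn Y)"
  shows "A \<in> semilattice_hi W"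
  using assms unfolding semilattice_hi_def by (auto simp: sat_qeqn_def)

lemma semilattice_hi_lo_closed:
  "quasivariety rp_lang (semilattice_lo W)" "quasivariety rp_lang (semilattice_hi W)"
  unfolding semilattice_lo_def semilattice_hi_def
  by (intro quasivariety_restrict quasivariety_RPA;
      auto simp: qeqns_def square_eqn_closed)+

lemma prime_algebra_transfer:
  fixes v :: "nat \<Rightarrow> nat \<Rightarrow> real"
  assumes "infinite (UNIV :: 'a set)" "X \<in> W" "v \<in> UNIV \<rightarrow> carrier (prime_algebra X)"
  obtains B :: "(rp_sym, 'a) ualg" and w where "B \<in> semilattice_lo W" "w \<in> UNIV \<rightarrow> carrier B"
    and "\<And>e. e \<in> eqns rp_lang \<Longrightarrow> holds_at B w e \<longleftrightarrow> holds_at (prime_algebra X) v e"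
proof -
  obtain B :: "(rp_sym, 'a) ualg" and w where B: "algebra_of rp_lang B" "w \<in> UNIV \<rightarrow> carrier B"
    and e: "\<And>e. e \<in> eqns rp_lang \<Longrightarrow> holds_at B w e \<longleftrightarrow> holds_at (prime_algebra X) v e"
    and q: "\<And>q. q \<in> qeqns rp_lang \<Longrightarrow> sat_qeqn (prime_algebra X) q \<Longrightarrow> sat_qeqn B q"
    by (rule countable_transfer[OF countable_rp_lang assms(1) algebra_of_prime_algebra assms(3)])
      (rule that; assumption)
  have "sat_eqn B e" if "e \<in> rpa_axioms" for e
    using q[of "([], e)"] sat_eqn_prime_algebra[OF that, of X] that rpa_axioms_eqns
    by (auto simp: qeqns_def sat_qeqn_def sat_eqn_def)
  then have "B \<in> RPA" using B(1) by (simp add: RPA_iff)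
  then have "B \<in> semilattice_lo W" using q assms(2) by (auto simp: semilattice_lo_def)
  then show thesis using B(2) e that by blast
qed

text \<open>The prime algebras generate \<open>semilattice_lo W\<close> without being members of it.
  A failing valuation in one of them would survive in a countably generated copy over
  \<open>'a\<close>, which is a member.\<close>

lemma prime_algebra_sat_qeqn:
  assumes "infinite (UNIV :: 'a set)" "X \<in> W" "q \<in> qeqns rp_lang"
    and "\<And>B :: (rp_sym, 'a) ualg. B \<in> semilattice_lo W \<Longrightarrow> sat_qeqn B q"
  shows "sat_qeqn (prime_algebra X) q"
  unfolding sat_qeqn_def
proof (intro ballI impI)
  fix v assume v: "v \<in> UNIV \<rightarrow> carrier (prime_algebra X)"
    and prem: "\<forall>p\<in>set (fst q). holds_at (prime_algebra X) v p"
  obtain B :: "(rp_sym, 'a) ualg" and w where B: "B \<in> semilattice_lo W" "w \<in> UNIV \<rightarrow> carrier B"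
    and e: "\<And>e. e \<in> eqns rp_lang \<Longrightarrow> holds_at B w e \<longleftrightarrow> holds_at (prime_algebra X) v e"
    by (rule prime_algebra_transfer[OF assms(1,2) v]) (rule that; assumption)
  have "\<forall>p\<in>set (fst q). holds_at B w p"
    using prem e assms(3) unfolding qeqns_iff by blast
  then have "holds_at B w (snd q)"
    using assms(4)[OF B(1)] B(2) unfolding sat_qeqn_def by blast
  then show "holds_at (prime_algebra X) v (snd q)"
    using e assms(3) unfolding qeqns_iff by blast
qed

lemma semilattice_lo_hi:
  assumes inf: "infinite (UNIV :: 'a set)" and V: "V \<in> union_semilattices" and W: "W \<in> union_semilattices"
  shows "(semilattice_lo V :: (rp_sym, 'a) ualg set) \<subseteq> semilattice_hi W \<longleftrightarrow> V \<subseteq> W"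
proof
  assume sub: "(semilattice_lo V :: (rp_sym, 'a) ualg set) \<subseteq> semilattice_hi W"
  show "V \<subseteq> W"
  proof
    fix X assume X: "X \<in> V"
    then have fin: "finite X" using V union_semilatticesD by blast
    \<comment> \<open>The tuple of inverse square roots solves \<open>square_eqn X\<close>. The
      rules of \<open>semilattice_hi W\<close> force it to solve the equation for the core of
      \<open>X\<close> as well, which is possible only if the core is all of
      \<open>X\<close>.\<close>
    define u where "u = (\<lambda>x\<in>X. sqrt (1 / nth_prime x))"
    let ?Y = "semilattice_core W X"
    have u: "(\<lambda>_. u) \<in> UNIV \<rightarrow> carrier (prime_algebra X)"
      by (auto simp: u_def prime_algebra_def sqrt_in_chain)
    obtain B :: "(rp_sym, 'a) ualg" and w where B: "B \<in> semilattice_lo V" "w \<in> UNIV \<rightarrow> carrier B"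
      and e: "\<And>e. e \<in> eqns rp_lang \<Longrightarrow> holds_at B w e \<longleftrightarrow> holds_at (prime_algebra X) (\<lambda>_. u) e"
      by (rule prime_algebra_transfer[OF inf X u]) (rule that; assumption)
    have finY: "finite ?Y" using fin semilattice_core_subset finite_subset by blast
    have "holds_at (prime_algebra X) (\<lambda>_. u) (square_eqn X)"
      by (subst holds_at_prime_algebra[OF fin u]) (simp add: u_def)
    then have "holds_at B w (square_eqn X)" using e square_eqn_closed by blast
    then have "holds_at B w (square_eqn ?Y)"
      using semilattice_hiD[OF _ fin finY _ B(2)] sub B(1) by blast
    then have "holds_at (prime_algebra X) (\<lambda>_. u) (square_eqn ?Y)" using e square_eqn_closed by blast
    then have "X \<subseteq> ?Y" by (subst (asm) holds_at_prime_algebra[OF finY u]) blast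
    then have "X = ?Y" using semilattice_core_subset by blast
    then show "X \<in> W" using semilattice_core_in[OF W fin] by simp
  qed
next
  assume sub: "V \<subseteq> W"
  show "(semilattice_lo V :: (rp_sym, 'a) ualg set) \<subseteq> semilattice_hi W"
  proof
    fix A :: "(rp_sym, 'a) ualg" assume A: "A \<in> semilattice_lo V"
    show "A \<in> semilattice_hi W"
    proof (rule semilattice_hiI)
      show "A \<in> RPA" using A by (simp add: semilattice_lo_def)
      fix X Y and v :: "nat \<Rightarrow> 'a"
      assume XY: "finite X" "finite Y" "semilattice_core W X \<subseteq> Y"
        and v: "v \<in> UNIV \<rightarrow> carrier A" "holds_at A v (square_eqn X)"
      have "sat_qeqn (prime_algebra Z) ([square_eqn X], square_eqn Y)" if Z: "Z \<in> V" for Z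
      proof -
        \<comment> \<open>If \<open>Z\<close> is not inside \<open>X\<close> the premise has no
          solution in the algebra of \<open>Z\<close>. Otherwise \<open>Z\<close> takes part in the
          core of \<open>X\<close>.\<close>
        have "Z \<subseteq> Y" if "Z \<subseteq> X"
          using that Z sub XY(3) by (auto simp: semilattice_core_def)
        then show ?thesis
          using holds_at_prime_algebra[OF XY(1), of _ Z] holds_at_prime_algebra[OF XY(2), of _ Z]
          by (auto simp: sat_qeqn_def)
      qed
      moreover have "([square_eqn X], square_eqn Y) \<in> qeqns rp_lang"
        by (simp add: qeqns_def square_eqn_closed)
      ultimately have "sat_qeqn A ([square_eqn X], square_eqn Y)"
        using A unfolding semilattice_lo_def by blast
      then show "holds_at A v (square_eqn Y)" using v by (simp add: sat_qeqn_def)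
    qed
  qed
qed

theorem hom_image_semilattice_lattice:
  assumes inf: "infinite (UNIV :: 'a set)"
  shows "hom_image_of_sublattice semilattice_lattice
    (subquasivarieties rp_lang (RPA :: (rp_sym, 'a) ualg set))"
proof (rule hom_image_of_sublattice_intervals[where lo = semilattice_lo and hi = semilattice_hi])
  let ?L = "subquasivarieties rp_lang (RPA :: (rp_sym, 'a) ualg set)"
  show "lattice semilattice_lattice" by (rule lattice_semilattice_lattice)
  show "lattice ?L" by (intro lattice_subquasivarieties quasivariety_RPA)
  have sub: "semilattice_lo V \<subseteq> (RPA :: (rp_sym, 'a) ualg set)"
    "semilattice_hi V \<subseteq> (RPA :: (rp_sym, 'a) ualg set)" for V
    by (auto simp: semilattice_lo_def semilattice_hi_def)
  show "semilattice_lo V \<in> carrier ?L" "semilattice_hi V \<in> carrier ?L" for V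
    using sub by (auto simp: subquasivarieties_carrier semilattice_hi_lo_closed)
  fix V W assume "V \<in> carrier semilattice_lattice" "W \<in> carrier semilattice_lattice"
  then have VW: "V \<in> union_semilattices" "W \<in> union_semilattices" by simp_all
  show "semilattice_lo V \<sqsubseteq>\<^bsub>?L\<^esub> semilattice_hi W \<longleftrightarrow> V \<sqsubseteq>\<^bsub>semilattice_lattice\<^esub> W"
    using semilattice_lo_hi[OF inf VW] by (simp add: subquasivarieties_carrier)
  show "semilattice_lo V \<sqsubseteq>\<^bsub>?L\<^esub> semilattice_lo W" if "V \<sqsubseteq>\<^bsub>semilattice_lattice\<^esub> W"
    using that unfolding subquasivarieties_carrier semilattice_lo_def incl_order_simps by blast
  show "semilattice_hi V \<sqsubseteq>\<^bsub>?L\<^esub> semilattice_hi W" if "V \<sqsubseteq>\<^bsub>semilattice_lattice\<^esub> W"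
  proof -
    have "semilattice_core V X \<subseteq> semilattice_core W X" for X
      using that by (intro semilattice_core_mono) auto
    then show ?thesis
      unfolding subquasivarieties_carrier semilattice_hi_def by (blast intro: order_trans)
  qed
  show "semilattice_lo (V \<squnion>\<^bsub>semilattice_lattice\<^esub> W) \<sqsubseteq>\<^bsub>?L\<^esub> semilattice_lo V \<squnion>\<^bsub>?L\<^esub> semilattice_lo W"
  proof -
    \<comment> \<open>Members of the join are unions of members, and the algebra of a union inherits
      the quasi-equations common to the two parts.\<close>
    have "sat_qeqn (prime_algebra Z) q"
      if q: "q \<in> qeqns rp_lang" "\<forall>B\<in>semilattice_lo V \<union> semilattice_lo W. sat_qeqn (B :: (rp_sym, 'a) ualg) q"
        and Z: "Z \<in> V \<squnion>\<^bsub>semilattice_lattice\<^esub> W" for q Z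
    proof -
      obtain X Y where XY: "X \<in> V" "Y \<in> W" "Z = X \<union> Y"
        using Z unfolding semilattice_join[OF VW] by blast
      have "sat_qeqn (prime_algebra X) q" "sat_qeqn (prime_algebra Y) q"
        using prime_algebra_sat_qeqn[OF inf XY(1) q(1)] prime_algebra_sat_qeqn[OF inf XY(2) q(1)] q(2)
        by blast+
      then show ?thesis
        unfolding XY(3) prime_algebra_def by (rule sat_qeqn_direct_product_Un)
    qed
    then show ?thesis
      unfolding subquasivarieties_carrier
        subquasivarieties_join[OF quasivariety_RPA semilattice_hi_lo_closed(1,1) sub(1,1)]
      unfolding semilattice_lo_def[of "V \<squnion>\<^bsub>semilattice_lattice\<^esub> W"] by blast
  qed
  show "semilattice_hi V \<sqinter>\<^bsub>?L\<^esub> semilattice_hi W \<sqsubseteq>\<^bsub>?L\<^esub> semilattice_hi (V \<sqinter>\<^bsub>semilattice_lattice\<^esub> W)"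
    unfolding subquasivarieties_carrier semilattice_meet[OF VW]
      subquasivarieties_meet[OF semilattice_hi_lo_closed(2,2) sub(2,2)]
  proof
    fix A :: "(rp_sym, 'a) ualg" assume A: "A \<in> semilattice_hi V \<inter> semilattice_hi W"
    show "A \<in> semilattice_hi (V \<inter> W)"
    proof (rule semilattice_hiI)
      show "A \<in> RPA" using A sub by blast
      fix X Y and v :: "nat \<Rightarrow> 'a"
      assume "finite X" "finite Y" "semilattice_core (V \<inter> W) X \<subseteq> Y"
        and v: "v \<in> UNIV \<rightarrow> carrier A" "holds_at A v (square_eqn X)"
      then show "holds_at A v (square_eqn Y)"
      \<comment> \<open>The rules of \<open>V\<close> and \<open>W\<close> shrink \<open>X\<close>
        to its cores in any order. The finite set stops shrinking when it belongs to both
        semilattices, and it is then its own core for \<open>V \<inter> W\<close>.\<close>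
      proof (induction X rule: finite_psubset_induct)
        case (psubset X)
        have step: "holds_at A v (square_eqn Y)"
          if U: "U = V \<or> U = W" "semilattice_core U X \<noteq> X" for U
        proof -
          have *: "semilattice_core U X \<subset> X" using U(2) semilattice_core_subset by blast
          then have fin: "finite (semilattice_core U X)"
            using psubset.hyps finite_subset by blast
          have "holds_at A v (square_eqn (semilattice_core U X))"
            using semilattice_hiD[OF _ psubset.hyps(1) fin order_refl v(1) psubset.prems(4)] A U(1) by blast
          moreover have "semilattice_core (V \<inter> W) (semilattice_core U X) \<subseteq> Y"
            using semilattice_core_mono[OF order_refl, of "semilattice_core U X" X "V \<inter> W"]
              psubset.prems(2) * by blast
          ultimately show ?thesis using psubset.IH[OF *] psubset.prems(1,3) by blast
        qed
        show ?case
        proof (cases "semilattice_core V X = X \<and> semilattice_core W X = X")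
          case True
          then have "X \<in> V \<inter> W"
            using semilattice_core_in[OF VW(1) psubset.hyps(1)]
              semilattice_core_in[OF VW(2) psubset.hyps(1)] by simp
          then have "semilattice_core V X \<subseteq> Y"
            using psubset.prems(2) semilattice_core_eq True by metis
          then show ?thesis
            using semilattice_hiD[OF _ psubset.hyps(1) psubset.prems(1) _ v(1) psubset.prems(4)] A by blast
        qed (use step in blast)
      qed
    qed
  qed
qed


section \<open>Coding quasivarieties by semilattices\<close>

text \<open>A diagonal form of Konig's lemma: each finite window \<open>E m\<close> allows finitely
  many traces, so nested infinite sets of indices with constant traces can be chosen. The limit
  \<open>Z\<close> collects these traces.\<close>

lemma finite_branching_limit:
  fixes D E :: "nat \<Rightarrow> 'x set"
  assumes fin: "\<And>m. finite (E m)" and mono: "mono E" and I: "infinite I"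
  obtains Z where "\<And>m. infinite {n \<in> I. D n \<inter> E m = Z \<inter> E m}"
proof -
  have refine: "\<exists>K. infinite K \<and> K \<subseteq> J \<and> (\<exists>T. \<forall>n\<in>K. D n \<inter> E m = T)" if J: "infinite J" for J m
  proof -
    have "finite ((\<lambda>n. D n \<inter> E m) ` J)"
      by (rule finite_subset[of _ "Pow (E m)"]) (use fin in auto)
    then obtain a where "a \<in> J" "infinite {b \<in> J. D b \<inter> E m = D a \<inter> E m}"
      using pigeonhole_infinite[OF J] by auto
    then show ?thesis by (intro exI[of _ "{b \<in> J. D b \<inter> E m = D a \<inter> E m}"]) auto
  qed
  have "\<exists>J. \<forall>m. (infinite (J m) \<and> J m \<subseteq> I \<and> (\<exists>T. \<forall>n\<in>J m. D n \<inter> E m = T)) \<and> J (Suc m) \<subseteq> J m"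
  proof (rule dependent_nat_choice)
    show "\<exists>K. infinite K \<and> K \<subseteq> I \<and> (\<exists>T. \<forall>n\<in>K. D n \<inter> E 0 = T)"
      using refine[OF I] by blast
    fix K m assume K: "infinite K \<and> K \<subseteq> I \<and> (\<exists>T. \<forall>n\<in>K. D n \<inter> E m = T)"
    then obtain K' where "infinite K'" "K' \<subseteq> K" "\<exists>T. \<forall>n\<in>K'. D n \<inter> E (Suc m) = T"
      using refine[of K "Suc m"] by blast
    moreover from this(2) have "K' \<subseteq> I" using K by blast
    ultimately show "\<exists>K'. (infinite K' \<and> K' \<subseteq> I \<and> (\<exists>T. \<forall>n\<in>K'. D n \<inter> E (Suc m) = T)) \<and> K' \<subseteq> K"
      by blast
  qed
  then obtain J where "\<forall>m. (infinite (J m) \<and> J m \<subseteq> I \<and> (\<exists>T. \<forall>n\<in>J m. D n \<inter> E m = T)) \<and>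
      J (Suc m) \<subseteq> J m" ..
  then have J: "\<And>m. infinite (J m)" "\<And>m. J m \<subseteq> I" "\<And>m. \<exists>T. \<forall>n\<in>J m. D n \<inter> E m = T"
    "\<And>m. J (Suc m) \<subseteq> J m" by simp_all
  obtain T where T: "\<And>m n. n \<in> J m \<Longrightarrow> D n \<inter> E m = T m" using J(3) by metis
  have anti: "J m \<subseteq> J k" if "k \<le> m" for k m
    using that by (rule lift_Suc_antimono_le[of J, OF J(4)])
  \<comment> \<open>The traces at two windows are both realised by a single index from the later
    set, so they cohere.\<close>
  have "x \<in> T m" if "x \<in> T k" "x \<in> E m" for x k m
  proof -
    obtain n where n: "n \<in> J (max k m)" using infinite_imp_nonempty[OF J(1)] by blast
    then have "n \<in> J k" "n \<in> J m" using anti[of k "max k m"] anti[of m "max k m"] by auto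
    then show ?thesis using T that by blast
  qed
  moreover have TE: "T m \<subseteq> E m" for m
  proof -
    obtain n where "n \<in> J m" using infinite_imp_nonempty[OF J(1)] by blast
    then show ?thesis using T by blast
  qed
  ultimately have *: "(\<Union>k. T k) \<inter> E m = T m" for m by blast
  show thesis
  proof (rule that[of "\<Union>k. T k"])
    have "J m \<subseteq> {n \<in> I. D n \<inter> E m = (\<Union>k. T k) \<inter> E m}" for m
      using T[of _ m] J(2)[of m] unfolding * by (simp add: subset_iff)
    then show "infinite {n \<in> I. D n \<inter> E m = (\<Union>k. T k) \<inter> E m}" for m
      using infinite_super J(1) by metis
  qed
qed

text \<open>
  The equations that fail under a valuation are recorded stage by stage: stage \<open>n\<close> keeps those
  among the first \<open>n\<close>. An equation failing in a product of algebras fails in one of the factors, so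
  joins of quasivarieties become joins of semilattices. A single stage does not suffice, because
  the consequences of a quasi-equation among the first \<open>n\<close> equations may have to pass through later
  ones: an algebra is recovered from all of its stages by a compactness argument.
\<close>

locale coded_quasivariety =
  fixes L :: "'f lang" and M :: "('f, 'b) ualg set"
  assumes L: "countable (dom L)" and inf: "infinite (UNIV :: 'b set)" and M: "quasivariety L M"
begin

section \<open>Failure sets, their codes and the corresponding models\<close>

definition stage :: "nat \<Rightarrow> 'f eqn set" where
  "stage n = {d \<in> eqns L. to_nat_on (eqns L) d < n}"

text \<open>The stage is part of the code, so failure sets of different stages stay disjoint and
  \<open>level\<close> can recover each from a union.\<close>

definition point :: "nat \<Rightarrow> 'f eqn \<Rightarrow> nat" where
  "point n d = prod_encode (n, to_nat_on (eqns L) d)"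

definition level :: "nat \<Rightarrow> nat set \<Rightarrow> 'f eqn set" where
  "level n X = {d \<in> eqns L. point n d \<in> X}"

definition failures :: "nat \<Rightarrow> ('f, 'b) ualg \<Rightarrow> (nat \<Rightarrow> 'b) \<Rightarrow> 'f eqn set" where
  "failures n A v = {d \<in> stage n. \<not> holds_at A v d}"

text \<open>\<open>D\<close> plays the part of the failing equations, so its complement within the
  stage should be closed under the rules of \<open>K\<close>. A rule whose conclusion leaves the
  stage imposes nothing.\<close>

definition rule_closed :: "('f, 'b) ualg set \<Rightarrow> nat \<Rightarrow> 'f eqn set \<Rightarrow> bool" where
  "rule_closed K n D \<longleftrightarrow> D \<subseteq> stage n \<and>
     (\<forall>q\<in>qeqns L. (\<forall>A\<in>K. sat_qeqn A q) \<longrightarrow> set (fst q) \<subseteq> stage n - D \<longrightarrow> snd q \<notin> D)"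

definition pullback :: "(nat \<Rightarrow> 'f trm) \<Rightarrow> nat \<Rightarrow> 'f eqn set \<Rightarrow> 'f eqn set" where
  "pullback \<sigma> n D = {d \<in> stage n. subst_eqn \<sigma> d \<in> D}"

text \<open>Both conditions prepare the passage to a limit: rule closure makes the complement of a
  limit the set of true equations of an algebra in \<open>M\<close>, and closure under pullback
  accounts for all other valuations in that algebra.\<close>

definition codes :: "nat set set set" where
  "codes = {W \<in> union_semilattices. \<forall>X\<in>W. (\<forall>n. rule_closed M n (level n X)) \<and>
     (\<forall>\<sigma> n m. range \<sigma> \<subseteq> formulas L \<longrightarrow> subst_eqn \<sigma> ` stage n \<subseteq> stage m \<longrightarrow>
        point n ` pullback \<sigma> n (level m X) \<in> W)}"

definition models :: "nat set set \<Rightarrow> ('f, 'b) ualg set" where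
  "models W = {A \<in> M. \<forall>v \<in> UNIV \<rightarrow> carrier A. \<forall>n. point n ` failures n A v \<in> W}"

lemma algebra_of_M: "A \<in> M \<Longrightarrow> algebra_of L A"
  using M quasivariety_member by blast

lemma stage_eqns: "stage n \<subseteq> eqns L"
  by (auto simp: stage_def)

lemma point_eq_iff: "d \<in> eqns L \<Longrightarrow> d' \<in> eqns L \<Longrightarrow> point n d = point m d' \<longleftrightarrow> n = m \<and> d = d'"
  using inj_on_to_nat_on[OF countable_eqns[OF L]] by (auto simp: point_def inj_on_def)

lemma finite_stage: "finite (stage n)"
proof (rule finite_imageD)
  show "finite (to_nat_on (eqns L) ` stage n)"
    by (rule finite_subset[of _ "{..<n}"]) (auto simp: stage_def)
  show "inj_on (to_nat_on (eqns L)) (stage n)"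
    using inj_on_to_nat_on[OF countable_eqns[OF L]] stage_eqns by (rule inj_on_subset)
qed

lemma stage_mono: "m \<le> n \<Longrightarrow> stage m \<subseteq> stage n"
  by (auto simp: stage_def)

lemma stage_exhausts: "finite D \<Longrightarrow> D \<subseteq> eqns L \<Longrightarrow> \<exists>n. D \<subseteq> stage n"
proof (induction rule: finite_induct)
  case (insert d D)
  then obtain n where n: "D \<subseteq> stage n" by auto
  let ?m = "max n (Suc (to_nat_on (eqns L) d))"
  have "D \<subseteq> stage ?m" using n stage_mono[of n ?m] by auto
  moreover have "d \<in> stage ?m" using insert.prems by (simp add: stage_def)
  ultimately show ?case by blast
qed simp

lemma level_point: "D \<subseteq> eqns L \<Longrightarrow> level m (point n ` D) = (if n = m then D else {})"
  by (auto simp: level_def point_eq_iff subset_iff image_iff)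

lemma level_Un: "level n (X \<union> Y) = level n X \<union> level n Y"
  by (auto simp: level_def)

lemma level_empty: "level n {} = {}"
  by (simp add: level_def)

lemma pullback_Un: "pullback \<sigma> n (D \<union> D') = pullback \<sigma> n D \<union> pullback \<sigma> n D'"
  by (auto simp: pullback_def)

lemma pullback_empty: "pullback \<sigma> n {} = {}"
  by (simp add: pullback_def)

lemma failures_subset: "failures n A v \<subseteq> stage n"
  by (auto simp: failures_def)

lemma failures_eqns: "failures n A v \<subseteq> eqns L"
  using failures_subset stage_eqns by blast

lemma rule_closed_Un: "rule_closed K n D \<Longrightarrow> rule_closed K n D' \<Longrightarrow> rule_closed K n (D \<union> D')"
  unfolding rule_closed_def by blast

lemma rule_closed_empty: "rule_closed K n {}"
  by (simp add: rule_closed_def)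

lemma rule_closed_antimono: "rule_closed K n D \<Longrightarrow> K \<subseteq> K' \<Longrightarrow> rule_closed K' n D"
  unfolding rule_closed_def by blast

lemma rule_closed_failures:
  assumes "A \<in> K" "v \<in> UNIV \<rightarrow> carrier A"
  shows "rule_closed K n (failures n A v)"
  unfolding rule_closed_def
proof (intro conjI ballI impI failures_subset)
  fix q assume q: "q \<in> qeqns L" "\<forall>A\<in>K. sat_qeqn A q" "set (fst q) \<subseteq> stage n - failures n A v"
  then have "\<forall>p\<in>set (fst q). holds_at A v p" by (auto simp: failures_def)
  then have "holds_at A v (snd q)" using q(2) assms unfolding sat_qeqn_def by blast
  then show "snd q \<notin> failures n A v" by (simp add: failures_def)
qed

text \<open>Substituting into equations amounts to changing the valuation. The stage
  \<open>m\<close> must be late enough to record the substituted equations.\<close>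

lemma pullback_failures:
  assumes "subst_eqn \<sigma> ` stage n \<subseteq> stage m"
  shows "pullback \<sigma> n (failures m A v) = failures n A (\<lambda>x. eval A v (\<sigma> x))"
  using assms unfolding pullback_def failures_def
  by (auto simp: holds_at_subst[symmetric] simp del: map_prod_simp)

lemma codesD:
  assumes "W \<in> codes"
  shows "W \<in> union_semilattices" "X \<in> W \<Longrightarrow> rule_closed M n (level n X)"
    "X \<in> W \<Longrightarrow> range \<sigma> \<subseteq> formulas L \<Longrightarrow> subst_eqn \<sigma> ` stage n \<subseteq> stage m \<Longrightarrow>
      point n ` pullback \<sigma> n (level m X) \<in> W"
  using assms unfolding codes_def by blast+

lemma codesI:
  assumes "W \<in> union_semilattices" "\<And>X n. X \<in> W \<Longrightarrow> rule_closed M n (level n X)"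
    and "\<And>X \<sigma> n m. X \<in> W \<Longrightarrow> range \<sigma> \<subseteq> formulas L \<Longrightarrow> subst_eqn \<sigma> ` stage n \<subseteq> stage m \<Longrightarrow>
      point n ` pullback \<sigma> n (level m X) \<in> W"
  shows "W \<in> codes"
  using assms by (simp add: codes_def)

lemma codes_Int:
  assumes "V \<in> codes" "W \<in> codes"
  shows "V \<inter> W \<in> codes"
proof (rule codesI)
  show "V \<inter> W \<in> union_semilattices"
    by (intro semilattice_Int codesD(1) assms)
qed (use codesD(2,3)[OF assms(1)] codesD(2,3)[OF assms(2)] in \<open>simp_all\<close>)

lemma codes_join:
  assumes "V \<in> codes" "W \<in> codes"
  shows "V \<squnion>\<^bsub>semilattice_lattice\<^esub> W \<in> codes"
proof -
  note VW = codesD(1)[OF assms(1)] codesD(1)[OF assms(2)]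
  have "V \<squnion>\<^bsub>semilattice_lattice\<^esub> W \<in> carrier semilattice_lattice"
  proof -
    interpret S: lattice semilattice_lattice by (rule lattice_semilattice_lattice)
    show ?thesis using S.join_closed[of V W] VW by (simp del: S.join_closed)
  qed
  then have "V \<squnion>\<^bsub>semilattice_lattice\<^esub> W \<in> union_semilattices" by simp
  then show ?thesis
  proof (rule codesI)
    fix Z assume "Z \<in> V \<squnion>\<^bsub>semilattice_lattice\<^esub> W"
    then obtain X Y where XY: "X \<in> V" "Y \<in> W" "Z = X \<union> Y"
      unfolding semilattice_join[OF VW] by blast
    show "rule_closed M n (level n Z)" for n
      unfolding XY(3) level_Un using XY assms by (intro rule_closed_Un codesD(2))
    fix \<sigma> n m assume "range \<sigma> \<subseteq> formulas L" "subst_eqn \<sigma> ` stage n \<subseteq> stage m"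
    with XY assms have "point n ` pullback \<sigma> n (level m X) \<in> V" "point n ` pullback \<sigma> n (level m Y) \<in> W"
      by (simp_all add: codesD(3))
    then show "point n ` pullback \<sigma> n (level m Z) \<in> V \<squnion>\<^bsub>semilattice_lattice\<^esub> W"
      unfolding semilattice_join[OF VW] XY(3) level_Un pullback_Un image_Un by blast
  qed
qed

lemma sublattice_codes: "sublattice codes semilattice_lattice"
  unfolding sublattice_def
  using codes_join codes_Int codesD(1) by (auto simp: semilattice_meet)

text \<open>Take as premises all equations of the stage that hold at \<open>v\<close>, and
  \<open>d\<close> as conclusion. This quasi-equation fails in \<open>A\<close>, hence in some
  member of \<open>K\<close>; the valuation refuting it fails \<open>d\<close> and nothing beyond
  the failures in \<open>A\<close>.\<close>

lemma failures_cover: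
  assumes A: "\<And>q. q \<in> qeqns L \<Longrightarrow> (\<forall>B\<in>K. sat_qeqn B q) \<Longrightarrow> sat_qeqn A q"
    and v: "v \<in> UNIV \<rightarrow> carrier A" and d: "d \<in> failures n A v"
  shows "\<exists>B\<in>K. \<exists>w \<in> UNIV \<rightarrow> carrier B. d \<in> failures n B w \<and> failures n B w \<subseteq> failures n A v"
proof -
  obtain ps where ps: "set ps = stage n - failures n A v"
    using finite_list[of "stage n - failures n A v"] finite_stage by auto
  have q: "(ps, d) \<in> qeqns L"
    using ps d stage_eqns[of n] failures_eqns[of n A v] unfolding qeqns_iff fst_conv snd_conv by blast
  have "\<not> sat_qeqn A (ps, d)"
    using ps d v by (auto simp: sat_qeqn_def failures_def)
  then obtain B where "B \<in> K" "\<not> sat_qeqn B (ps, d)" using A[OF q] by blast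
  then obtain w where w: "B \<in> K" "w \<in> UNIV \<rightarrow> carrier B" "\<forall>p\<in>set ps. holds_at B w p" "\<not> holds_at B w d"
    by (auto simp: sat_qeqn_def)
  then have "failures n B w \<subseteq> failures n A v" using ps by (auto simp: failures_def)
  moreover have "d \<in> failures n B w" using w(4) d by (simp add: failures_def)
  ultimately show ?thesis using w by blast
qed

lemma quasivarietyI:
  assumes "K \<subseteq> M" "\<And>A. A \<in> M \<Longrightarrow> (\<And>q. q \<in> qeqns L \<Longrightarrow> (\<forall>B\<in>K. sat_qeqn B q) \<Longrightarrow> sat_qeqn A q) \<Longrightarrow> A \<in> K"
  shows "quasivariety L K"
proof -
  have "K = {A \<in> M. \<forall>q\<in>{q \<in> qeqns L. \<forall>B\<in>K. sat_qeqn B q}. sat_qeqn A q}"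
    using assms by blast
  then show ?thesis
    using quasivariety_restrict[OF M, of "{q \<in> qeqns L. \<forall>B\<in>K. sat_qeqn B q}"] by simp
qed

text \<open>By \<open>failures_cover\<close>, a failure set of an algebra in the generated
  quasivariety is a union of failure sets of models. A stage is finite, so finitely many suffice and
  the semilattice contains their union.\<close>

lemma quasivariety_models:
  assumes W: "W \<in> codes"
  shows "quasivariety L (models W)"
proof (rule quasivarietyI)
  show "models W \<subseteq> M" by (auto simp: models_def)
  fix A assume A: "A \<in> M" "\<And>q. q \<in> qeqns L \<Longrightarrow> (\<forall>B\<in>models W. sat_qeqn B q) \<Longrightarrow> sat_qeqn A q"
  have "point n ` failures n A v \<in> W" if v: "v \<in> UNIV \<rightarrow> carrier A" for v n
  proof -
    define D where "D = {point n ` failures n B w |B w. B \<in> models W \<and> w \<in> UNIV \<rightarrow> carrier B \<and>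
      failures n B w \<subseteq> failures n A v}"
    have "D \<subseteq> Pow (point n ` failures n A v)" by (auto simp: D_def)
    moreover have "finite (Pow (point n ` failures n A v))"
      using finite_subset[OF failures_subset finite_stage] by simp
    ultimately have "finite D" by (rule finite_subset)
    moreover have "D \<subseteq> W" by (auto simp: D_def models_def)
    ultimately have "\<Union>D \<in> W" by (rule semilattice_Union[OF codesD(1)[OF W]])
    moreover have "\<Union>D = point n ` failures n A v"
    proof
      show "\<Union>D \<subseteq> point n ` failures n A v" by (auto simp: D_def)
      show "point n ` failures n A v \<subseteq> \<Union>D"
      proof
        fix x assume "x \<in> point n ` failures n A v"
        then obtain d where d: "d \<in> failures n A v" "x = point n d" by blast
        obtain B w where "B \<in> models W" "w \<in> UNIV \<rightarrow> carrier B" "d \<in> failures n B w"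
          "failures n B w \<subseteq> failures n A v"
          using failures_cover[OF A(2) v d(1)] by blast
        then show "x \<in> \<Union>D" unfolding D_def d(2) by blast
      qed
    qed
    ultimately show ?thesis by simp
  qed
  then show "A \<in> models W" using A(1) by (simp add: models_def)
qed

inductive_set code :: "('f, 'b) ualg set \<Rightarrow> nat set set" for N where
  empty: "{} \<in> code N"
| step: "X \<in> code N \<Longrightarrow> A \<in> N \<Longrightarrow> v \<in> UNIV \<rightarrow> carrier A \<Longrightarrow> X \<union> point n ` failures n A v \<in> code N"

lemma code_failures: "A \<in> N \<Longrightarrow> v \<in> UNIV \<rightarrow> carrier A \<Longrightarrow> point n ` failures n A v \<in> code N"
  using code.step[OF code.empty] by force

lemma rule_closed_code: "X \<in> code N \<Longrightarrow> rule_closed N n (level n X)"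
proof (induction rule: code.induct)
  case (step X A v m)
  then show ?case
    unfolding level_Un level_point[OF failures_eqns]
    by (auto intro!: rule_closed_Un rule_closed_failures rule_closed_empty)
qed (simp add: level_empty rule_closed_empty)

lemma code_codes:
  assumes "N \<subseteq> M"
  shows "code N \<in> codes"
proof (rule codesI)
  have "finite X" if "X \<in> code N" for X
    using that
  proof induction
    case (step X A v n)
    then show ?case using finite_subset[OF failures_subset finite_stage] by simp
  qed simp
  moreover have Un: "X \<union> Y \<in> code N" if "Y \<in> code N" "X \<in> code N" for X Y
    using that by induction (auto simp: Un_assoc[symmetric] intro: code.intros)
  ultimately show "code N \<in> union_semilattices"
    by (auto simp: union_semilattices_def intro: code.empty)
  fix X assume X: "X \<in> code N"
  show "rule_closed M n (level n X)" for n
    using rule_closed_code[OF X] assms by (rule rule_closed_antimono)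
  fix \<sigma> n m assume \<sigma>: "range \<sigma> \<subseteq> formulas L" "subst_eqn \<sigma> ` stage n \<subseteq> stage m"
  show "point n ` pullback \<sigma> n (level m X) \<in> code N"
    using X
  proof induction
    case (step X A v k)
    have "algebra_of L A" using step.hyps(2) assms algebra_of_M by blast
    then have "(\<lambda>x. eval A v (\<sigma> x)) \<in> UNIV \<rightarrow> carrier A"
      using valuation_subst step.hyps(3) \<sigma>(1) by blast
    then have "point n ` pullback \<sigma> n (failures m A v) \<in> code N"
      unfolding pullback_failures[OF \<sigma>(2)] using code_failures step.hyps(2) by blast
    then show ?case
      unfolding level_Un level_point[OF failures_eqns] pullback_Un image_Un
      using Un step.IH by (auto simp: pullback_empty)
  qed (simp add: level_empty pullback_empty code.empty)
qed

text \<open>Levels of members of \<open>code N\<close> are closed under the rules of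
  \<open>N\<close> itself, not only under those of \<open>M\<close>. Each quasi-equation involves
  finitely many equations and fits into one stage, where closure under it gives its validity at
  \<open>v\<close>.\<close>

lemma models_code:
  assumes "quasivariety L N" "N \<subseteq> M"
  shows "models (code N) = N"
proof
  show "N \<subseteq> models (code N)"
    using assms(2) code_failures by (auto simp: models_def)
  show "models (code N) \<subseteq> N"
  proof
    fix A assume A: "A \<in> models (code N)"
    then have "algebra_of L A" using algebra_of_M by (simp add: models_def)
    moreover have "sat_qeqn A q" if q: "q \<in> qeqns L" "\<forall>B\<in>N. sat_qeqn B q" for q
      unfolding sat_qeqn_def
    proof (intro ballI impI)
      fix v assume v: "v \<in> UNIV \<rightarrow> carrier A" "\<forall>p\<in>set (fst q). holds_at A v p"
      have "finite (insert (snd q) (set (fst q)))" "insert (snd q) (set (fst q)) \<subseteq> eqns L"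
        using q(1) by (auto simp: qeqns_iff)
      then obtain n where n: "insert (snd q) (set (fst q)) \<subseteq> stage n" using stage_exhausts by blast
      have "point n ` failures n A v \<in> code N" using A v(1) by (simp add: models_def)
      then have "rule_closed N n (failures n A v)"
        using rule_closed_code[of "point n ` failures n A v" N n]
        unfolding level_point[OF failures_eqns] by simp
      moreover have "set (fst q) \<subseteq> stage n - failures n A v" using n v(2) by (auto simp: failures_def)
      ultimately have "snd q \<notin> failures n A v" using q unfolding rule_closed_def by blast
      then show "holds_at A v (snd q)" using n by (simp add: failures_def)
    qed
    ultimately show "A \<in> N" unfolding quasivariety_member[OF assms(1), of A] by blast
  qed
qed

text \<open>The sets \<open>X n\<close> need not be failure sets of any algebra: each is consistent
  with the rules only within its own stage. A limit of their levels passes every rule, since a rule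
  fits into some stage; it keeps \<open>c\<close> among the failures and adds none that hold at
  \<open>v\<close>. The term quotient by its complement is the required model.\<close>

lemma limit_model:
  assumes W: "W \<in> codes" and I: "infinite I" and X: "\<And>n. n \<in> I \<Longrightarrow> X n \<in> W"
    and fail: "\<And>n. n \<in> I \<Longrightarrow> level n (X n) \<subseteq> failures n A v"
    and c: "\<And>n. n \<in> I \<Longrightarrow> c \<in> level n (X n)"
  obtains B w where "B \<in> models W" "w \<in> UNIV \<rightarrow> carrier B" "\<not> holds_at B w c"
    "\<And>d. d \<in> eqns L \<Longrightarrow> holds_at A v d \<Longrightarrow> holds_at B w d"
proof -
  obtain Z where inf_Z: "\<And>m. infinite {n \<in> I. level n (X n) \<inter> stage m = Z \<inter> stage m}"
    by (rule finite_branching_limit[of stage I "\<lambda>n. level n (X n)", OF finite_stage monoI[OF stage_mono] I])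
      (assumption | rule that; assumption)+
  have approx: "\<exists>n\<ge>m. n \<in> I \<and> level n (X n) \<inter> stage m = Z \<inter> stage m" for m
    using inf_Z[of m] unfolding infinite_nat_iff_unbounded_le by blast
  define P where "P = eqns L - Z"
  obtain i where "i \<in> I" using infinite_imp_nonempty[OF I] by blast
  then have c_eqn: "c \<in> eqns L" using c by (auto simp: level_def)
  have "c \<notin> P"
  proof -
    obtain m where m: "{c} \<subseteq> stage m" using stage_exhausts[of "{c}"] c_eqn by auto
    then show ?thesis using approx[of m] c by (auto simp: P_def)
  qed
  have pos: "d \<in> P" if d: "d \<in> eqns L" "holds_at A v d" for d
  proof -
    obtain m where "{d} \<subseteq> stage m" using stage_exhausts[of "{d}"] d by auto
    then show ?thesis using approx[of m] fail d by (fastforce simp: P_def failures_def)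
  qed
  have closed: "snd q \<in> P" if q: "q \<in> qeqns L" "\<And>A. A \<in> M \<Longrightarrow> sat_qeqn A q" "set (fst q) \<subseteq> P" for q
  proof -
    have "finite (insert (snd q) (set (fst q)))" "insert (snd q) (set (fst q)) \<subseteq> eqns L"
      using q(1) by (auto simp: qeqns_iff)
    then obtain m where m: "insert (snd q) (set (fst q)) \<subseteq> stage m" using stage_exhausts by blast
    obtain n where n: "n \<ge> m" "n \<in> I" "level n (X n) \<inter> stage m = Z \<inter> stage m" using approx by blast
    have "rule_closed M n (level n (X n))" using codesD(2)[OF W X[OF n(2)]] .
    moreover have "set (fst q) \<subseteq> stage n - level n (X n)"
      using m n q(3) stage_mono[OF n(1)] unfolding P_def by blast
    ultimately have "snd q \<notin> level n (X n)" using q(1,2) unfolding rule_closed_def by blast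
    then show ?thesis using m n(3) q(1) unfolding P_def qeqns_iff by blast
  qed
  have "P \<subseteq> eqns L" by (auto simp: P_def)
  obtain B k where B: "B \<in> M"
    and val: "\<And>v :: nat \<Rightarrow> 'b. v \<in> UNIV \<rightarrow> carrier B \<longleftrightarrow> (\<exists>\<sigma>. range \<sigma> \<subseteq> formulas L \<and> v = k \<circ> \<sigma>)"
    and holds: "\<And>\<sigma> e. range \<sigma> \<subseteq> formulas L \<Longrightarrow> e \<in> eqns L \<Longrightarrow>
           holds_at B (k \<circ> \<sigma>) e \<longleftrightarrow> subst_eqn \<sigma> e \<in> P"
    by (rule quasivariety_term_quotient[OF L inf M \<open>P \<subseteq> eqns L\<close> closed])
      (assumption | rule that; assumption)+
  have "point n ` failures n B w \<in> W" if w: "w \<in> UNIV \<rightarrow> carrier B" for n w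
  proof -
    obtain \<sigma> where \<sigma>: "range \<sigma> \<subseteq> formulas L" "w = k \<circ> \<sigma>" using w[unfolded val] by (elim exE conjE)
    have sub: "subst_eqn \<sigma> ` stage n \<subseteq> eqns L"
      by (intro image_subsetI subst_eqn_closed[OF \<sigma>(1)] stage_eqns[THEN subsetD])
    \<comment> \<open>A valuation in the quotient is a substitution, so its failures are pulled back
      from \<open>Z\<close>. The substituted stage is finite, hence \<open>Z\<close> may be replaced
      by the level of some \<open>X l\<close>, and closure of \<open>W\<close> under pullback
      applies.\<close>
    have "failures n B w = pullback \<sigma> n Z"
      unfolding failures_def pullback_def \<sigma>(2)
    proof (intro Collect_cong conj_cong refl)
      fix d assume d: "d \<in> stage n"
      then have "subst_eqn \<sigma> d \<in> eqns L" "d \<in> eqns L"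
        by (rule sub[THEN subsetD, OF imageI], rule stage_eqns[THEN subsetD])
      then show "\<not> holds_at B (k \<circ> \<sigma>) d \<longleftrightarrow> subst_eqn \<sigma> d \<in> Z"
        using holds[OF \<sigma>(1), of d] unfolding P_def by blast
    qed
    moreover obtain m where m: "subst_eqn \<sigma> ` stage n \<subseteq> stage m"
      using stage_exhausts[OF finite_imageI[OF finite_stage] sub] ..
    obtain l where l: "l \<ge> m" "l \<in> I" "level l (X l) \<inter> stage m = Z \<inter> stage m" using approx by blast
    have "pullback \<sigma> n (level l (X l)) = pullback \<sigma> n Z"
      unfolding pullback_def
    proof (intro Collect_cong conj_cong refl)
      fix d assume "d \<in> stage n"
      then have "subst_eqn \<sigma> d \<in> stage m" by (rule m[THEN subsetD, OF imageI])
      then show "subst_eqn \<sigma> d \<in> level l (X l) \<longleftrightarrow> subst_eqn \<sigma> d \<in> Z"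
        using l(3) by blast
    qed
    moreover have "subst_eqn \<sigma> ` stage n \<subseteq> stage l" using m stage_mono[OF l(1)] by (rule subset_trans)
    ultimately show ?thesis using codesD(3)[OF W X[OF l(2)] \<sigma>(1)] by metis
  qed
  then have "B \<in> models W" using B by (simp add: models_def)
  moreover have "k \<circ> Var \<in> UNIV \<rightarrow> carrier B"
    unfolding val by (intro exI[of _ Var] conjI Var_formulas refl)
  moreover have "holds_at B (k \<circ> Var) d \<longleftrightarrow> d \<in> P" if "d \<in> eqns L" for d
    using holds[OF Var_formulas that] by (cases d) (simp add: subst_Var)
  ultimately show thesis
    using that[of B "k \<circ> Var"] pos \<open>c \<notin> P\<close> c_eqn by blast
qed

text \<open>In a model of the join each failure set splits into a part from \<open>V\<close> and a
  part from \<open>W\<close>, but the splitting varies with the stage. If a quasi-equation common to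
  both classes failed, one side would receive its conclusion at infinitely many stages, and the
  limit on that side would be a model refuting it.\<close>

lemma models_join:
  assumes VW: "V \<in> codes" "W \<in> codes"
  shows "models (V \<squnion>\<^bsub>semilattice_lattice\<^esub> W) = models V \<squnion>\<^bsub>subquasivarieties L M\<^esub> models W"
proof -
  let ?J = "V \<squnion>\<^bsub>semilattice_lattice\<^esub> W"
  note J_eq = semilattice_join[OF codesD(1)[OF VW(1)] codesD(1)[OF VW(2)]]
  have sub: "models U \<subseteq> M" for U by (auto simp: models_def)
  have "V \<subseteq> ?J" "W \<subseteq> ?J"
    unfolding J_eq using union_semilatticesD(2)[OF codesD(1)[OF VW(1)]]
      union_semilatticesD(2)[OF codesD(1)[OF VW(2)]] by blast+
  then have ge: "models V \<union> models W \<subseteq> models ?J" by (auto simp: models_def)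
  show ?thesis
    unfolding subquasivarieties_join[OF M quasivariety_models[OF VW(1)] quasivariety_models[OF VW(2)] sub sub]
  proof (intro subset_antisym subsetI)
    fix A assume A: "A \<in> {A \<in> M. \<forall>q\<in>qeqns L. (\<forall>B\<in>models V \<union> models W. sat_qeqn B q) \<longrightarrow> sat_qeqn A q}"
    then show "A \<in> models ?J"
      unfolding quasivariety_member[OF quasivariety_models[OF codes_join[OF VW]], of A]
      using ge algebra_of_M by blast
  next
    fix A assume A: "A \<in> models ?J"
    have "sat_qeqn A q" if q: "q \<in> qeqns L" "\<forall>B\<in>models V \<union> models W. sat_qeqn B q" for q
      unfolding sat_qeqn_def
    proof (intro ballI impI, rule ccontr)
      fix v assume v: "v \<in> UNIV \<rightarrow> carrier A" and prem: "\<forall>p\<in>set (fst q). holds_at A v p"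
        and not: "\<not> holds_at A v (snd q)"
      have e: "set (fst q) \<subseteq> eqns L" "snd q \<in> eqns L" using q(1) by (auto simp: qeqns_iff)
      have no: False if U: "U \<in> codes" "models U \<subseteq> models V \<union> models W"
        and I: "infinite I" "\<And>n. n \<in> I \<Longrightarrow> X n \<in> U" "\<And>n. n \<in> I \<Longrightarrow> level n (X n) \<subseteq> failures n A v"
          "\<And>n. n \<in> I \<Longrightarrow> snd q \<in> level n (X n)" for U I X
      proof -
        obtain B w where B: "B \<in> models U" "w \<in> UNIV \<rightarrow> carrier B" "\<not> holds_at B w (snd q)"
          "\<And>d. d \<in> eqns L \<Longrightarrow> holds_at A v d \<Longrightarrow> holds_at B w d"
          by (rule limit_model[OF U(1) I]) (assumption | rule that; assumption)+
        have "\<forall>p\<in>set (fst q). holds_at B w p"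
          using prem e(1) B(4) by blast
        moreover have "sat_qeqn B q" using q(2) U(2) B(1) by blast
        ultimately show False using B(2,3) unfolding sat_qeqn_def by blast
      qed
      have "\<exists>X Y. X \<in> V \<and> Y \<in> W \<and> point n ` failures n A v = X \<union> Y" for n
        using A v unfolding models_def J_eq by blast
      then obtain X Y where XY: "\<And>n. X n \<in> V" "\<And>n. Y n \<in> W"
        "\<And>n. point n ` failures n A v = X n \<union> Y n" by metis
      have lev: "failures n A v = level n (X n) \<union> level n (Y n)" for n
        using level_point[OF failures_eqns[of n A v], of n n] by (simp add: XY(3) level_Un)
      obtain m where "{snd q} \<subseteq> stage m" using stage_exhausts[of "{snd q}"] e(2) by auto
      then have "snd q \<in> failures n A v" if "n \<in> {m..}" for n
        using that stage_mono[of m n] not by (auto simp: failures_def)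
      \<comment> \<open>From stage \<open>m\<close> on the conclusion is among the recorded
        failures, so at each such stage it lies in one of the two parts.\<close>
      then have "{m..} \<subseteq> {n. snd q \<in> level n (X n)} \<union> {n. snd q \<in> level n (Y n)}"
        unfolding lev by blast
      then have "infinite {n. snd q \<in> level n (X n)} \<or> infinite {n. snd q \<in> level n (Y n)}"
        using infinite_Ici finite_subset by blast
      moreover have False if "infinite {n. snd q \<in> level n (X n)}"
        by (rule no[OF VW(1) _ that, of X]) (use XY(1) lev in auto)
      moreover have False if "infinite {n. snd q \<in> level n (Y n)}"
        by (rule no[OF VW(2) _ that, of Y]) (use XY(2) lev in auto)
      ultimately show False by blast
    qed
    then show "A \<in> {A \<in> M. \<forall>q\<in>qeqns L. (\<forall>B\<in>models V \<union> models W. sat_qeqn B q) \<longrightarrow> sat_qeqn A q}"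
      using A by (simp add: models_def)
  qed
qed

theorem hom_image_subquasivarieties:
  "hom_image_of_sublattice (subquasivarieties L M) semilattice_lattice"
  unfolding hom_image_of_sublattice_iff[OF lattice_semilattice_lattice lattice_subquasivarieties[OF M]]
proof (intro exI conjI ballI)
  show "sublattice codes semilattice_lattice" by (rule sublattice_codes)
  have sub: "models U \<subseteq> M" for U by (auto simp: models_def)
  show "models ` codes = carrier (subquasivarieties L M)"
  proof
    show "models ` codes \<subseteq> carrier (subquasivarieties L M)"
      using quasivariety_models sub by (simp add: subquasivarieties_carrier image_subset_iff)
    show "carrier (subquasivarieties L M) \<subseteq> models ` codes"
    proof
      fix N assume "N \<in> carrier (subquasivarieties L M)"
      then have "quasivariety L N" "N \<subseteq> M" by (simp_all add: subquasivarieties_carrier)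
      then show "N \<in> models ` codes"
        using models_code code_codes by (metis image_eqI)
    qed
  qed
  fix V W assume VW: "V \<in> codes" "W \<in> codes"
  show "models (V \<squnion>\<^bsub>semilattice_lattice\<^esub> W) = models V \<squnion>\<^bsub>subquasivarieties L M\<^esub> models W"
    by (rule models_join) fact+
  show "models (V \<sqinter>\<^bsub>semilattice_lattice\<^esub> W) = models V \<sqinter>\<^bsub>subquasivarieties L M\<^esub> models W"
    unfolding subquasivarieties_meet[OF quasivariety_models[OF VW(1)] quasivariety_models[OF VW(2)] sub sub]
      semilattice_meet[OF codesD(1)[OF VW(1)] codesD(1)[OF VW(2)]]
    by (auto simp: models_def)
qed

end


section \<open>Lattice equations in the lattice of semilattices\<close>

lemma semilattice_eval_closed:
  assumes "\<And>i. v i \<in> union_semilattices"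
  shows "lat_eval semilattice_lattice v s \<in> union_semilattices"
  using lat_eval_closed[OF lattice_semilattice_lattice, of v s] assms by simp

text \<open>Carries a witness for a subterm into the witness for the whole term. Inclusion suffices,
  since images of intersections are contained in the intersections of images.\<close>

lemma image_lat_eval_subset:
  assumes Un: "\<And>U V. f (U \<union> V) = f U \<union> f V"
    and v: "\<And>i. v i \<in> union_semilattices" and w: "\<And>i. w i \<in> union_semilattices"
    and vw: "\<And>i. f ` v i \<subseteq> w i"
  shows "f ` lat_eval semilattice_lattice v t \<subseteq> lat_eval semilattice_lattice w t"
proof (induction t)
  case (LJoin s t)
  then show ?case
    using Un by (fastforce simp: semilattice_join semilattice_eval_closed v w)
next
  case (LMeet s t)
  then show ?case
    by (auto simp: semilattice_meet semilattice_eval_closed v w)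
qed (use vw in simp)

text \<open>
  The family \<open>G\<close> assigns to each \<open>m\<close> a semilattice of subsets of \<open>X\<close>, thought of as those of
  value at most \<open>m\<close>; the value is subadditive because each \<open>G m\<close> is closed under unions. The set
  \<open>X\<close> is a witness for the term \<open>s\<close>: a join is witnessed by a disjoint union and a meet by a
  cartesian product, in which the two factors are unrelated.
\<close>

definition term_witness ::
  "'c gorder \<Rightarrow> (nat \<Rightarrow> 'c) \<Rightarrow> lat_term \<Rightarrow> nat set \<Rightarrow> ('c \<Rightarrow> nat set set) \<Rightarrow> bool" where
  "term_witness M v s X G \<longleftrightarrow> finite X \<and>
     (\<forall>m. m \<in> carrier M \<longrightarrow> G m \<in> union_semilattices) \<and>
     (\<forall>m U. m \<in> carrier M \<longrightarrow> U \<in> G m \<longrightarrow> U \<subseteq> X) \<and>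
     (\<forall>m m' U. m \<in> carrier M \<longrightarrow> m' \<in> carrier M \<longrightarrow> m \<sqsubseteq>\<^bsub>M\<^esub> m' \<longrightarrow> U \<in> G m \<longrightarrow> U \<in> G m') \<and>
     (\<forall>m m' U. m \<in> carrier M \<longrightarrow> m' \<in> carrier M \<longrightarrow> U \<in> G m \<longrightarrow> U \<in> G m' \<longrightarrow>
       U \<in> G (m \<sqinter>\<^bsub>M\<^esub> m')) \<and>
     X \<in> lat_eval semilattice_lattice (G \<circ> v) s \<and>
     (\<forall>m. m \<in> carrier M \<longrightarrow> X \<in> G m \<longrightarrow> lat_eval M v s \<sqsubseteq>\<^bsub>M\<^esub> m)"

lemma term_witnessD:
  assumes "term_witness M v s X G"
  shows "finite X" "m \<in> carrier M \<Longrightarrow> G m \<in> union_semilattices"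
    "m \<in> carrier M \<Longrightarrow> U \<in> G m \<Longrightarrow> U \<subseteq> X"
    "m \<in> carrier M \<Longrightarrow> m' \<in> carrier M \<Longrightarrow> m \<sqsubseteq>\<^bsub>M\<^esub> m' \<Longrightarrow> U \<in> G m \<Longrightarrow> U \<in> G m'"
    "m \<in> carrier M \<Longrightarrow> m' \<in> carrier M \<Longrightarrow> U \<in> G m \<Longrightarrow> U \<in> G m' \<Longrightarrow> U \<in> G (m \<sqinter>\<^bsub>M\<^esub> m')"
    "X \<in> lat_eval semilattice_lattice (G \<circ> v) s"
    "m \<in> carrier M \<Longrightarrow> X \<in> G m \<Longrightarrow> lat_eval M v s \<sqsubseteq>\<^bsub>M\<^esub> m"
proof -
  note d = assms[unfolded term_witness_def]
  note d1 = d[THEN conjunct2]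
  note d2 = d1[THEN conjunct2]
  note d3 = d2[THEN conjunct2]
  note d4 = d3[THEN conjunct2]
  note d5 = d4[THEN conjunct2]
  show "finite X" by (rule d[THEN conjunct1])
  show "m \<in> carrier M \<Longrightarrow> G m \<in> union_semilattices" by (rule d1[THEN conjunct1, rule_format])
  show "m \<in> carrier M \<Longrightarrow> U \<in> G m \<Longrightarrow> U \<subseteq> X" by (rule d2[THEN conjunct1, rule_format])
  show "m \<in> carrier M \<Longrightarrow> m' \<in> carrier M \<Longrightarrow> m \<sqsubseteq>\<^bsub>M\<^esub> m' \<Longrightarrow> U \<in> G m \<Longrightarrow> U \<in> G m'"
    by (rule d3[THEN conjunct1, rule_format])
  show "m \<in> carrier M \<Longrightarrow> m' \<in> carrier M \<Longrightarrow> U \<in> G m \<Longrightarrow> U \<in> G m' \<Longrightarrow> U \<in> G (m \<sqinter>\<^bsub>M\<^esub> m')"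
    by (rule d4[THEN conjunct1, rule_format])
  show "X \<in> lat_eval semilattice_lattice (G \<circ> v) s" by (rule d5[THEN conjunct1])
  show "m \<in> carrier M \<Longrightarrow> X \<in> G m \<Longrightarrow> lat_eval M v s \<sqsubseteq>\<^bsub>M\<^esub> m"
    by (rule d5[THEN conjunct2, rule_format])
qed

lemma term_witnessI:
  assumes "finite X" "\<And>m. m \<in> carrier M \<Longrightarrow> G m \<in> union_semilattices"
    "\<And>m U. m \<in> carrier M \<Longrightarrow> U \<in> G m \<Longrightarrow> U \<subseteq> X"
    "\<And>m m' U. m \<in> carrier M \<Longrightarrow> m' \<in> carrier M \<Longrightarrow> m \<sqsubseteq>\<^bsub>M\<^esub> m' \<Longrightarrow> U \<in> G m \<Longrightarrow> U \<in> G m'"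
    "\<And>m m' U. m \<in> carrier M \<Longrightarrow> m' \<in> carrier M \<Longrightarrow> U \<in> G m \<Longrightarrow> U \<in> G m' \<Longrightarrow> U \<in> G (m \<sqinter>\<^bsub>M\<^esub> m')"
    "X \<in> lat_eval semilattice_lattice (G \<circ> v) s"
    "\<And>m. m \<in> carrier M \<Longrightarrow> X \<in> G m \<Longrightarrow> lat_eval M v s \<sqsubseteq>\<^bsub>M\<^esub> m"
  shows "term_witness M v s X G"
  unfolding term_witness_def by (intro conjI allI impI) (fact | rule assms; assumption)+

lemma term_witness_exists:
  assumes M: "lattice M" and v: "v \<in> UNIV \<rightarrow> carrier M"
  shows "\<exists>X G. term_witness M v s X G"
proof -
  interpret M: lattice M by fact
  have vi: "v i \<in> carrier M" for i using v by auto
  have ev: "lat_eval M v s \<in> carrier M" for s by (rule lat_eval_closed[OF M v])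
  show ?thesis
  proof (induction s)
    case (LVar i)
    have "term_witness M v (LVar i) {0} (\<lambda>m. {U. U = {} \<or> U = {0} \<and> v i \<sqsubseteq>\<^bsub>M\<^esub> m})"
      by (rule term_witnessI)
        (auto simp: union_semilattices_def vi intro: M.meet_le M.le_trans[OF _ _ vi])
    then show ?case by blast
  next
    case (LJoin s t)
    obtain X1 G1 X2 G2 where W1: "term_witness M v s X1 G1" and W2: "term_witness M v t X2 G2"
      using LJoin by blast
    note w1 = term_witnessD[OF W1] and w2 = term_witnessD[OF W2]
    \<comment> \<open>A disjoint union of \<open>U\<close> and \<open>V\<close>, realised by even
      and odd numbers.\<close>
    define f where "f U V = (\<lambda>x. 2 * x) ` U \<union> (\<lambda>x. 2 * x + 1) ` V" for U V :: "nat set"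
    have "{x. 2 * x \<in> f U V} = U" "{x. 2 * x + 1 \<in> f U V} = V" for U V
      by (auto simp: f_def image_iff) presburger+
    then have inj: "f U V = f U' V' \<longleftrightarrow> U = U' \<and> V = V'" for U V U' V' by metis
    have Un: "f U V \<union> f U' V' = f (U \<union> U') (V \<union> V')" for U V U' V' by (auto simp: f_def)
    have mono: "U \<subseteq> U' \<Longrightarrow> V \<subseteq> V' \<Longrightarrow> f U V \<subseteq> f U' V'" for U V U' V' by (auto simp: f_def)
    define G where "G m = {f U V |U V. U \<in> G1 m \<and> V \<in> G2 m}" for m
    have G_iff: "f U V \<in> G m \<longleftrightarrow> U \<in> G1 m \<and> V \<in> G2 m" for U V m by (auto simp: G_def inj)
    have G_US: "G m \<in> union_semilattices" if m: "m \<in> carrier M" for m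
      unfolding union_semilattices_def
    proof (rule CollectI, intro conjI ballI)
      show "G m \<subseteq> Collect finite"
        using union_semilatticesD(1)[OF w1(2)[OF m]] union_semilatticesD(1)[OF w2(2)[OF m]]
        by (auto simp: G_def f_def)
      have "f {} {} \<in> G m"
        using union_semilatticesD(2)[OF w1(2)[OF m]] union_semilatticesD(2)[OF w2(2)[OF m]]
        by (simp add: G_iff)
      then show "{} \<in> G m" by (simp add: f_def)
      fix Y Z assume "Y \<in> G m" "Z \<in> G m"
      then obtain U V U' V' where "U \<in> G1 m" "V \<in> G2 m" "U' \<in> G1 m" "V' \<in> G2 m" "Y = f U V" "Z = f U' V'"
        unfolding G_def by blast
      then show "Y \<union> Z \<in> G m"
        using union_semilatticesD(3)[OF w1(2)[OF m]] union_semilatticesD(3)[OF w2(2)[OF m]]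
        by (simp add: Un G_iff)
    qed
    have E: "\<And>m. m \<in> carrier M \<Longrightarrow> {} \<in> G1 m" "\<And>m. m \<in> carrier M \<Longrightarrow> {} \<in> G2 m"
      by (rule union_semilatticesD(2)[OF w1(2)] union_semilatticesD(2)[OF w2(2)]; assumption)+
    have "term_witness M v (LJoin s t) (f X1 X2) G"
    proof (rule term_witnessI)
      show "finite (f X1 X2)" using w1(1) w2(1) by (simp add: f_def)
      show "U \<subseteq> f X1 X2" if "m \<in> carrier M" "U \<in> G m" for m U
        using that(2) w1(3)[OF that(1)] w2(3)[OF that(1)] unfolding G_def
        by (smt (verit, best) mem_Collect_eq mono)
      show "U \<in> G m'" if "m \<in> carrier M" "m' \<in> carrier M" "m \<sqsubseteq>\<^bsub>M\<^esub> m'" "U \<in> G m" for m m' U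
        using that(4) w1(4)[OF that(1-3)] w2(4)[OF that(1-3)] by (auto simp: G_def)
      show "U \<in> G (m \<sqinter>\<^bsub>M\<^esub> m')" if "m \<in> carrier M" "m' \<in> carrier M" "U \<in> G m" "U \<in> G m'" for m m' U
        using that(3,4) w1(5)[OF that(1,2)] w2(5)[OF that(1,2)] by (auto simp: G_def inj)
      have GU: "\<And>i. (G \<circ> v) i \<in> union_semilattices" "\<And>i. (G1 \<circ> v) i \<in> union_semilattices"
        "\<And>i. (G2 \<circ> v) i \<in> union_semilattices"
        using G_US w1(2) w2(2) vi by simp_all
      have "(\<lambda>U. f U {}) ` lat_eval semilattice_lattice (G1 \<circ> v) s \<subseteq> lat_eval semilattice_lattice (G \<circ> v) s"
        by (rule image_lat_eval_subset) (use Un[of _ "{}" _ "{}"] GU G_iff E vi in auto)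
      then have 1: "f X1 {} \<in> lat_eval semilattice_lattice (G \<circ> v) s" using w1(6) by blast
      have "(\<lambda>U. f {} U) ` lat_eval semilattice_lattice (G2 \<circ> v) t \<subseteq> lat_eval semilattice_lattice (G \<circ> v) t"
        by (rule image_lat_eval_subset) (use Un[of "{}" _ "{}"] GU G_iff E vi in auto)
      then have 2: "f {} X2 \<in> lat_eval semilattice_lattice (G \<circ> v) t" using w2(6) by blast
      note ev' = semilattice_eval_closed[OF GU(1)]
      have "f X1 X2 = f X1 {} \<union> f {} X2" by (simp add: Un)
      then show "f X1 X2 \<in> lat_eval semilattice_lattice (G \<circ> v) (LJoin s t)"
        using 1 2 unfolding lat_eval.simps semilattice_join[OF ev' ev'] by blast
      show "lat_eval M v (LJoin s t) \<sqsubseteq>\<^bsub>M\<^esub> m" if "m \<in> carrier M" "f X1 X2 \<in> G m" for m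
        using that w1(7) w2(7) ev by (simp add: G_iff M.join_le)
    qed (rule G_US)
    then show ?case by blast
  next
    case (LMeet s t)
    obtain X1 G1 X2 G2 where W1: "term_witness M v s X1 G1" and W2: "term_witness M v t X2 G2"
      using LMeet by blast
    note w1 = term_witnessD[OF W1] and w2 = term_witnessD[OF W2]
    define c where "c = lat_eval M v (LMeet s t)"
    have c: "c \<in> carrier M" unfolding c_def by (rule ev)
    \<comment> \<open>The union of the cylinders over \<open>U\<close> and \<open>V\<close> in the
      product of \<open>X1\<close> and \<open>X2\<close>. It is the full product as soon as either
      factor is full, so both subterms reach the same set \<open>X\<close>.\<close>
    define f where "f U V = prod_encode ` (U \<times> X2 \<union> X1 \<times> V)" for U V
    define X where "X = prod_encode ` (X1 \<times> X2)"
    have Un: "f U V \<union> f U' V' = f (U \<union> U') (V \<union> V')" for U V U' V'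
      unfolding f_def image_Un[symmetric] by (rule arg_cong[of _ _ "image _"]) auto
    have fX: "f U V \<subseteq> X" if "U \<subseteq> X1" "V \<subseteq> X2" for U V
      using that by (auto simp: f_def X_def)
    have mem: "prod_encode (x, y) \<in> f U V \<longleftrightarrow> x \<in> U \<and> y \<in> X2 \<or> x \<in> X1 \<and> y \<in> V" for x y U V
      by (auto simp: f_def image_iff)
    have full: "U = X1 \<or> V = X2" if F: "f U V = X" "U \<subseteq> X1" "V \<subseteq> X2" for U V
    proof (rule ccontr)
      assume "\<not> ?thesis"
      then obtain x y where "x \<in> X1" "x \<notin> U" "y \<in> X2" "y \<notin> V" using F(2,3) by blast
      moreover from this have "prod_encode (x, y) \<in> X" by (auto simp: X_def)
      ultimately show False using mem[of x y U V] F(1) by simp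
    qed
    \<comment> \<open>A pair missing from \<open>f U V\<close> fixes a row and a column on which
      \<open>V\<close> and \<open>U\<close> can be read off. Only the full product is
      ambiguous.\<close>
    have inj: "U = U' \<and> V = V'"
      if F: "f U V = f U' V'" "f U V \<noteq> X" "U \<subseteq> X1" "V \<subseteq> X2" "U' \<subseteq> X1" "V' \<subseteq> X2" for U V U' V'
    proof -
      obtain z where "z \<in> X" "z \<notin> f U V" using F(2) fX[OF F(3,4)] by blast
      then obtain x y where xy: "x \<in> X1" "y \<in> X2" "prod_encode (x, y) \<notin> f U V"
        by (auto simp: X_def)
      then have "x \<notin> U" "y \<notin> V" "x \<notin> U'" "y \<notin> V'" using mem F(1) by metis+
      then have "a \<in> U \<longleftrightarrow> a \<in> U'" if "a \<in> X1" for a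
        using mem[of a y U V] mem[of a y U' V'] xy(2) that F(1) \<open>y \<notin> V\<close> \<open>y \<notin> V'\<close> by simp
      moreover have "b \<in> V \<longleftrightarrow> b \<in> V'" if "b \<in> X2" for b
        using mem[of x b U V] mem[of x b U' V'] xy(1) that F(1) \<open>x \<notin> U\<close> \<open>x \<notin> U'\<close> by simp
      ultimately show ?thesis using F(3-6) by blast
    qed
    \<comment> \<open>As the image of \<open>X1\<close> and of \<open>X2\<close>, the full set
      \<open>X\<close> receives the values of both subterms. Closure of \<open>G\<close> under meets
      then demands \<open>X\<close> at their meet \<open>c\<close> as well, which the second part of
      the union supplies.\<close>
    define G where "G m = {f U V |U V. U \<in> G1 m \<and> V \<in> G2 m} \<union> {Y. Y = X \<and> c \<sqsubseteq>\<^bsub>M\<^esub> m}" for m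
    have GI: "f U V \<in> G m" if "U \<in> G1 m" "V \<in> G2 m" for U V m using that by (auto simp: G_def)
    have X_iff: "X \<in> G m \<longleftrightarrow> c \<sqsubseteq>\<^bsub>M\<^esub> m" if m: "m \<in> carrier M" for m
    proof
      assume "X \<in> G m"
      then consider "c \<sqsubseteq>\<^bsub>M\<^esub> m" | U V where "U \<in> G1 m" "V \<in> G2 m" "f U V = X"
        by (auto simp: G_def)
      then show "c \<sqsubseteq>\<^bsub>M\<^esub> m"
      proof cases
        case (2 U V)
        then have "X1 \<in> G1 m \<or> X2 \<in> G2 m" using full w1(3)[OF m] w2(3)[OF m] by blast
        then have "lat_eval M v s \<sqsubseteq>\<^bsub>M\<^esub> m \<or> lat_eval M v t \<sqsubseteq>\<^bsub>M\<^esub> m" using w1(7) w2(7) m by blast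
        then show ?thesis
          using M.le_trans[OF M.meet_left[OF ev ev]] M.le_trans[OF M.meet_right[OF ev ev]] m ev
          unfolding c_def by auto
      qed
    qed (simp add: G_def)
    have sub: "Y \<subseteq> X" if "m \<in> carrier M" "Y \<in> G m" for m Y
      using that(2) fX w1(3)[OF that(1)] w2(3)[OF that(1)] unfolding G_def by blast
    have G_US: "G m \<in> union_semilattices" if m: "m \<in> carrier M" for m
      unfolding union_semilattices_def
    proof (rule CollectI, intro conjI ballI)
      have "finite X" using w1(1) w2(1) by (simp add: X_def)
      then show "G m \<subseteq> Collect finite" using sub[OF m] finite_subset by blast
      have "f {} {} \<in> G m"
        using union_semilatticesD(2)[OF w1(2)[OF m]] union_semilatticesD(2)[OF w2(2)[OF m]] by (rule GI)
      then show "{} \<in> G m" by (simp add: f_def)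
      fix Y Z assume YZ: "Y \<in> G m" "Z \<in> G m"
      show "Y \<union> Z \<in> G m"
      proof (cases "Y = X \<or> Z = X")
        case True
        then have "Y \<union> Z = X" using sub[OF m YZ(1)] sub[OF m YZ(2)] by blast
        then show ?thesis using True YZ by auto
      next
        case False
        then obtain U V U' V' where "U \<in> G1 m" "V \<in> G2 m" "U' \<in> G1 m" "V' \<in> G2 m" "Y = f U V" "Z = f U' V'"
          using YZ unfolding G_def by blast
        then show ?thesis
          using union_semilatticesD(3)[OF w1(2)[OF m]] union_semilatticesD(3)[OF w2(2)[OF m]]
          by (simp add: Un GI)
      qed
    qed
    have E: "\<And>m. m \<in> carrier M \<Longrightarrow> {} \<in> G1 m" "\<And>m. m \<in> carrier M \<Longrightarrow> {} \<in> G2 m"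
      by (rule union_semilatticesD(2)[OF w1(2)] union_semilatticesD(2)[OF w2(2)]; assumption)+
    have "term_witness M v (LMeet s t) X G"
    proof (rule term_witnessI)
      show "finite X" using w1(1) w2(1) by (simp add: X_def)
      show "U \<in> G m'" if m: "m \<in> carrier M" "m' \<in> carrier M" "m \<sqsubseteq>\<^bsub>M\<^esub> m'" "U \<in> G m" for m m' U
        using m(4) w1(4)[OF m(1-3)] w2(4)[OF m(1-3)] M.le_trans[OF _ m(3) c m(1,2)]
        unfolding G_def by blast
      show "Y \<in> G (m \<sqinter>\<^bsub>M\<^esub> m')" if m: "m \<in> carrier M" "m' \<in> carrier M" "Y \<in> G m" "Y \<in> G m'" for m m' Y
      proof (cases "Y = X")
        case True
        then show ?thesis using m X_iff c M.meet_le by simp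
      next
        case False
        then obtain U V U' V' where UV: "U \<in> G1 m" "V \<in> G2 m" "Y = f U V"
          "U' \<in> G1 m'" "V' \<in> G2 m'" "Y = f U' V'"
          using m(3,4) unfolding G_def by blast
        then have "U = U' \<and> V = V'"
          using False w1(3)[OF m(1)] w2(3)[OF m(1)] w1(3)[OF m(2)] w2(3)[OF m(2)]
          by (intro inj) auto
        then show ?thesis
          using UV w1(5)[OF m(1,2)] w2(5)[OF m(1,2)] GI by blast
      qed
      have GU: "\<And>i. (G \<circ> v) i \<in> union_semilattices" "\<And>i. (G1 \<circ> v) i \<in> union_semilattices"
        "\<And>i. (G2 \<circ> v) i \<in> union_semilattices"
        using G_US w1(2) w2(2) vi by simp_all
      have X_eq: "f X1 {} = X" "f {} X2 = X" by (auto simp: f_def X_def)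
      have "(\<lambda>U. f U {}) ` lat_eval semilattice_lattice (G1 \<circ> v) s \<subseteq> lat_eval semilattice_lattice (G \<circ> v) s"
        by (rule image_lat_eval_subset) (use Un[of _ "{}" _ "{}"] GU GI E vi in auto)
      then have 1: "X \<in> lat_eval semilattice_lattice (G \<circ> v) s" using w1(6) X_eq(1) by blast
      have "(\<lambda>U. f {} U) ` lat_eval semilattice_lattice (G2 \<circ> v) t \<subseteq> lat_eval semilattice_lattice (G \<circ> v) t"
        by (rule image_lat_eval_subset) (use Un[of "{}" _ "{}"] GU GI E vi in auto)
      then have 2: "X \<in> lat_eval semilattice_lattice (G \<circ> v) t" using w2(6) X_eq(2) by blast
      note ev' = semilattice_eval_closed[OF GU(1)]
      show "X \<in> lat_eval semilattice_lattice (G \<circ> v) (LMeet s t)"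
        using 1 2 unfolding lat_eval.simps semilattice_meet[OF ev' ev'] by blast
      show "lat_eval M v (LMeet s t) \<sqsubseteq>\<^bsub>M\<^esub> m" if "m \<in> carrier M" "X \<in> G m" for m
        using that X_iff c_def by simp
    qed (rule G_US sub; assumption)+
    then show ?case by blast
  qed
qed

text \<open>The witness \<open>X\<close> for \<open>s\<close> lies in the value of \<open>s\<close>
  under \<open>G \<circ> v\<close>. If the equation held among semilattices, \<open>X\<close> would
  lie in the value of \<open>t\<close>, which is contained in \<open>G\<close> at the value of
  \<open>t\<close> in \<open>M\<close>; minimality then puts the value of \<open>s\<close> below
  that of \<open>t\<close>. Exchanging the terms gives equality.\<close>

theorem semilattice_lattice_refutes:
  assumes M: "lattice M" and not: "\<not> sat_lat_eqn M s t"
  shows "\<not> sat_lat_eqn semilattice_lattice s t"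
proof
  assume sat: "sat_lat_eqn semilattice_lattice s t"
  interpret M: lattice M by fact
  obtain v where v: "v \<in> UNIV \<rightarrow> carrier M" "lat_eval M v s \<noteq> lat_eval M v t"
    using not by (auto simp: sat_lat_eqn_def)
  note ev = lat_eval_closed[OF M v(1)]
  have le: "lat_eval M v s \<sqsubseteq>\<^bsub>M\<^esub> lat_eval M v t" if "sat_lat_eqn semilattice_lattice s t" for s t
  proof -
    obtain X G where "term_witness M v s X G" using term_witness_exists[OF M v(1)] by blast
    note w = term_witnessD[OF this]
    have Gv: "G \<circ> v \<in> UNIV \<rightarrow> carrier semilattice_lattice" using w(2) v(1) by (simp add: Pi_iff)
    have ev': "lat_eval semilattice_lattice (G \<circ> v) r \<in> union_semilattices" for r
      using lat_eval_closed[OF lattice_semilattice_lattice Gv] by simp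
    have "lat_eval semilattice_lattice (G \<circ> v) r \<subseteq> G (lat_eval M v r)" for r
    proof (induction r)
      case (LJoin r r')
      let ?m = "lat_eval M v (LJoin r r')"
      have "lat_eval M v r \<sqsubseteq>\<^bsub>M\<^esub> ?m" "lat_eval M v r' \<sqsubseteq>\<^bsub>M\<^esub> ?m"
        using M.join_left M.join_right ev by auto
      then have "U \<in> G ?m" if "U \<in> lat_eval semilattice_lattice (G \<circ> v) r \<union> lat_eval semilattice_lattice (G \<circ> v) r'" for U
        using that LJoin w(4)[OF ev ev] by blast
      then show ?case
        using union_semilatticesD(3)[OF w(2)[OF ev[of "LJoin r r'"]]]
        unfolding lat_eval.simps(2)[of semilattice_lattice] semilattice_join[OF ev' ev'] by blast
    next
      case (LMeet r r')
      then show ?case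
        using w(5)[OF ev ev] unfolding lat_eval.simps semilattice_meet[OF ev' ev'] by blast
    qed simp
    then have "X \<in> G (lat_eval M v t)"
      using w(6) that Gv unfolding sat_lat_eqn_def by blast
    then show ?thesis by (rule w(7)[OF ev])
  qed
  have "sat_lat_eqn semilattice_lattice t s" using sat by (simp add: sat_lat_eqn_def)
  then show False using le[OF sat] le[of t s] v(2) ev by (metis M.le_antisym)
qed


section \<open>Extensions of rational product logic\<close>

abbreviation one_trm :: "rp_sym trm" where
  "one_trm \<equiv> Fun (BL BOne) []"

abbreviation imp_trm :: "rp_sym trm \<Rightarrow> rp_sym trm \<Rightarrow> rp_sym trm" where
  "imp_trm s t \<equiv> Fun (BL BImp) [s, t]"

definition unit_eqn :: "rp_sym trm \<Rightarrow> rp_sym eqn" where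
  "unit_eqn t = (t, one_trm)"

text \<open>Together with \<open>unit_eqn\<close> this is the pair of translations between equations
  and formulas that underlies the algebraic semantics.\<close>

definition eqn_formulas :: "rp_sym eqn \<Rightarrow> rp_sym trm set" where
  "eqn_formulas e = {imp_trm (fst e) (snd e), imp_trm (snd e) (fst e)}"

lemma formulas_rp_simps [simp]:
  "one_trm \<in> formulas rp_lang"
  "imp_trm s t \<in> formulas rp_lang \<longleftrightarrow> s \<in> formulas rp_lang \<and> t \<in> formulas rp_lang"
  by (auto simp: formulas_def bl_lang_def)

lemma unit_eqn_eqns [simp]: "unit_eqn t \<in> eqns rp_lang \<longleftrightarrow> t \<in> formulas rp_lang"
  by (auto simp: unit_eqn_def eqns_eq)

lemma eqn_formulas_formulas: "e \<in> eqns rp_lang \<Longrightarrow> eqn_formulas e \<subseteq> formulas rp_lang"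
  by (auto simp: eqn_formulas_def eqns_eq)

text \<open>In a BL-algebra, \<open>a (a \<rightarrow> b) = b (b \<rightarrow> a)\<close>, so \<open>a = b\<close> if both implications equal \<open>1\<close>.\<close>

lemma RPA_holds_at_iff:
  assumes A: "A \<in> RPA" and v: "v \<in> UNIV \<rightarrow> carrier A" and e: "e \<in> eqns rp_lang"
  shows "holds_at A v e \<longleftrightarrow> (\<forall>t\<in>eqn_formulas e. holds_at A v (unit_eqn t))"
proof -
  obtain s t where st: "e = (s, t)" by (cases e)
  define a b where "a = eval A v s" and "b = eval A v t"
  have alg: "algebra_of rp_lang A" using A by (simp add: RPA_iff)
  have ab: "a \<in> carrier A" "b \<in> carrier A"
    using e eval_closed[OF alg v] by (auto simp: a_def b_def st eqns_def)
  \<comment> \<open>Variables 0 and 1 name the two values, so that two-variable identities of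
    $[0,1]$, valid in every member of \<open>RPA\<close>, can be instantiated at them.\<close>
  define w where "w x = (if x = 0 then a else b)" for x :: nat
  have w: "w \<in> UNIV \<rightarrow> carrier A" using ab by (auto simp: w_def)
  have ax: "holds_at A w (map_prod (map_trm BL) (map_trm BL) d)"
    if "d \<in> eqns bl_lang" "sat_eqn std_product_algebra d" for d
  proof -
    have "map_prod (map_trm BL) (map_trm BL) d \<in> rpa_axioms"
      using that unfolding rpa_axioms_def by blast
    then show ?thesis using A w unfolding RPA_iff sat_eqn_def by blast
  qed
  have min: "p * prod_imp p q = q * prod_imp q p" if "0 \<le> p" "0 \<le> q" for p q :: real
    using that by (auto simp: prod_imp_def)
  have "holds_at A w (map_prod (map_trm BL) (map_trm BL)
      (Fun BMult [Var 0, Fun BImp [Var 0, Var 1]], Fun BMult [Var 1, Fun BImp [Var 1, Var 0]]))"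
    by (intro ax) (simp_all add: eqns_def bl_lang_def sat_eqn_def holds_at_def Pi_iff
        std_product_algebra_def min)
  moreover have unit: "holds_at A w (map_prod (map_trm BL) (map_trm BL) (Fun BMult [Var n, Fun BOne []], Var n))" for n
    by (intro ax) (simp_all add: eqns_def bl_lang_def sat_eqn_def holds_at_def std_product_algebra_def)
  note unit[of 0] unit[of 1]
  moreover have "holds_at A w (map_prod (map_trm BL) (map_trm BL) (Fun BImp [Var 0, Var 0], Fun BOne []))"
    by (intro ax) (simp_all add: eqns_def bl_lang_def sat_eqn_def holds_at_def std_product_algebra_def
        prod_imp_def)
  ultimately have "interp A (BL BMult) [a, interp A (BL BImp) [a, b]] =
      interp A (BL BMult) [b, interp A (BL BImp) [b, a]]"
    "interp A (BL BMult) [a, interp A (BL BOne) []] = a"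
    "interp A (BL BMult) [b, interp A (BL BOne) []] = b"
    "interp A (BL BImp) [a, a] = interp A (BL BOne) []"
    by (simp_all add: holds_at_def w_def)
  then have "a = b \<longleftrightarrow> interp A (BL BImp) [a, b] = interp A (BL BOne) [] \<and>
      interp A (BL BImp) [b, a] = interp A (BL BOne) []" by metis
  then show ?thesis
    by (simp add: st eqn_formulas_def unit_eqn_def holds_at_def a_def b_def)
qed

section \<open>Consequence relations of subquasivarieties\<close>

definition consequence_of :: "(rp_sym, 'a) ualg set \<Rightarrow> rp_sym consequence" where
  "consequence_of K = {(\<Gamma>, \<phi>). \<Gamma> \<subseteq> formulas rp_lang \<and> \<phi> \<in> formulas rp_lang \<and>
     (\<exists>\<Delta> \<subseteq> \<Gamma>. finite \<Delta> \<and> eq_consequence K (unit_eqn ` \<Delta>) (unit_eqn \<phi>))}"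

lemma rational_product_logic_eq:
  "rational_product_logic TYPE('a) = consequence_of (RPA :: (rp_sym, 'a) ualg set)"
  by (simp add: rational_product_logic_def consequence_of_def unit_eqn_def)

lemma consequence_ofI:
  assumes "\<Gamma> \<subseteq> formulas rp_lang" "\<phi> \<in> formulas rp_lang" "\<Delta> \<subseteq> \<Gamma>" "finite \<Delta>"
    and "\<And>A v. A \<in> K \<Longrightarrow> v \<in> UNIV \<rightarrow> carrier A \<Longrightarrow> \<forall>\<delta>\<in>\<Delta>. holds_at A v (unit_eqn \<delta>) \<Longrightarrow>
      holds_at A v (unit_eqn \<phi>)"
  shows "(\<Gamma>, \<phi>) \<in> consequence_of K"
proof -
  have "eq_consequence K (unit_eqn ` \<Delta>) (unit_eqn \<phi>)"
    using assms(5) by (simp add: eq_consequence_def)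
  then show ?thesis using assms(1-4) unfolding consequence_of_def by blast
qed

lemma consequence_ofE:
  assumes "(\<Gamma>, \<phi>) \<in> consequence_of K"
  obtains \<Delta> where "\<Gamma> \<subseteq> formulas rp_lang" "\<phi> \<in> formulas rp_lang" "\<Delta> \<subseteq> \<Gamma>" "finite \<Delta>"
    "\<And>A v. A \<in> K \<Longrightarrow> v \<in> UNIV \<rightarrow> carrier A \<Longrightarrow> \<forall>\<delta>\<in>\<Delta>. holds_at A v (unit_eqn \<delta>) \<Longrightarrow>
      holds_at A v (unit_eqn \<phi>)"
proof -
  obtain \<Delta> where \<Delta>: "\<Gamma> \<subseteq> formulas rp_lang" "\<phi> \<in> formulas rp_lang" "\<Delta> \<subseteq> \<Gamma>" "finite \<Delta>"
    "eq_consequence K (unit_eqn ` \<Delta>) (unit_eqn \<phi>)"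
    using assms unfolding consequence_of_def by blast
  show thesis
    by (rule that[OF \<Delta>(1-4)]) (use \<Delta>(5) in \<open>simp add: eq_consequence_def\<close>)
qed

lemma consequence_of_antimono:
  assumes "K \<subseteq> K'"
  shows "consequence_of K' \<subseteq> consequence_of K"
proof
  fix x assume x: "x \<in> consequence_of K'"
  obtain \<Gamma> \<phi> where x_eq: "x = (\<Gamma>, \<phi>)" by (cases x)
  show "x \<in> consequence_of K"
    using x unfolding x_eq by (rule consequence_ofE) (rule consequence_ofI, use assms in auto)
qed

lemma holds_at_unit_subst:
  "holds_at A v (unit_eqn (subst \<sigma> t)) \<longleftrightarrow> holds_at A (\<lambda>x. eval A v (\<sigma> x)) (unit_eqn t)"
  by (simp add: unit_eqn_def holds_at_def eval_subst)

lemma finitary_logic_consequence_of: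
  assumes K: "K \<subseteq> RPA"
  shows "finitary_logic rp_lang (consequence_of K)"
  unfolding finitary_logic_def
proof (intro conjI allI impI)
  show "consequence_of K \<subseteq> Pow (formulas rp_lang) \<times> formulas rp_lang"
    by (auto simp: consequence_of_def)
next
  fix \<Gamma> \<phi> assume "\<Gamma> \<subseteq> formulas rp_lang" "\<phi> \<in> \<Gamma>"
  then show "(\<Gamma>, \<phi>) \<in> consequence_of K"
    by (intro consequence_ofI[of _ _ "{\<phi>}"]) auto
next
  fix \<Gamma> \<Delta> \<phi>
  assume *: "\<Gamma> \<subseteq> formulas rp_lang" "\<forall>\<delta>\<in>\<Delta>. (\<Gamma>, \<delta>) \<in> consequence_of K" "(\<Delta>, \<phi>) \<in> consequence_of K"
  obtain D where D: "\<phi> \<in> formulas rp_lang" "D \<subseteq> \<Delta>" "finite D"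
    "\<And>A v. A \<in> K \<Longrightarrow> v \<in> UNIV \<rightarrow> carrier A \<Longrightarrow> \<forall>\<delta>\<in>D. holds_at A v (unit_eqn \<delta>) \<Longrightarrow>
      holds_at A v (unit_eqn \<phi>)"
    using *(3) by (rule consequence_ofE) (rule that; assumption)
  have "\<forall>\<delta>\<in>D. \<exists>G. G \<subseteq> \<Gamma> \<and> finite G \<and> eq_consequence K (unit_eqn ` G) (unit_eqn \<delta>)"
    using *(2) D(2) unfolding consequence_of_def by blast
  from bchoice[OF this] obtain G where
    G: "\<forall>\<delta>\<in>D. G \<delta> \<subseteq> \<Gamma> \<and> finite (G \<delta>) \<and> eq_consequence K (unit_eqn ` G \<delta>) (unit_eqn \<delta>)" ..
  show "(\<Gamma>, \<phi>) \<in> consequence_of K"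
  proof (rule consequence_ofI[of _ _ "\<Union>(G ` D)"])
    fix A and v :: "nat \<Rightarrow> 'a"
    assume A: "A \<in> K" "v \<in> UNIV \<rightarrow> carrier A" "\<forall>\<delta>\<in>\<Union>(G ` D). holds_at A v (unit_eqn \<delta>)"
    have "holds_at A v (unit_eqn \<delta>)" if "\<delta> \<in> D" for \<delta>
    proof -
      have "eq_consequence K (unit_eqn ` G \<delta>) (unit_eqn \<delta>)" using G that by blast
      moreover have "\<forall>d\<in>unit_eqn ` G \<delta>. holds_at A v d" using A(3) that by blast
      ultimately show ?thesis using A(1,2) unfolding eq_consequence_def by blast
    qed
    then show "holds_at A v (unit_eqn \<phi>)" using D(4)[OF A(1,2)] by blast
  qed (use *(1) D(1,3) G in auto)
next
  fix \<Gamma> \<phi> assume "(\<Gamma>, \<phi>) \<in> consequence_of K"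
  then obtain D where D: "\<Gamma> \<subseteq> formulas rp_lang" "\<phi> \<in> formulas rp_lang" "D \<subseteq> \<Gamma>" "finite D"
    "\<And>A v. A \<in> K \<Longrightarrow> v \<in> UNIV \<rightarrow> carrier A \<Longrightarrow> \<forall>\<delta>\<in>D. holds_at A v (unit_eqn \<delta>) \<Longrightarrow>
      holds_at A v (unit_eqn \<phi>)"
    by (rule consequence_ofE) (rule that; assumption)
  then have "(D, \<phi>) \<in> consequence_of K" by (intro consequence_ofI[of D \<phi> D]) auto
  then show "\<exists>\<Delta> \<subseteq> \<Gamma>. finite \<Delta> \<and> (\<Delta>, \<phi>) \<in> consequence_of K" using D(3,4) by blast
next
  fix \<Gamma> \<phi> and \<sigma> :: "nat \<Rightarrow> rp_sym trm"
  assume "(\<Gamma>, \<phi>) \<in> consequence_of K" and \<sigma>: "range \<sigma> \<subseteq> formulas rp_lang"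
  then obtain D where D: "\<Gamma> \<subseteq> formulas rp_lang" "\<phi> \<in> formulas rp_lang" "D \<subseteq> \<Gamma>" "finite D"
    "\<And>A v. A \<in> K \<Longrightarrow> v \<in> UNIV \<rightarrow> carrier A \<Longrightarrow> \<forall>\<delta>\<in>D. holds_at A v (unit_eqn \<delta>) \<Longrightarrow>
      holds_at A v (unit_eqn \<phi>)"
    by (elim consequence_ofE) (rule that; assumption)
  show "(subst \<sigma> ` \<Gamma>, subst \<sigma> \<phi>) \<in> consequence_of K"
  proof (rule consequence_ofI[of _ _ "subst \<sigma> ` D"])
    fix A and v :: "nat \<Rightarrow> 'a"
    assume A: "A \<in> K" and v: "v \<in> UNIV \<rightarrow> carrier A"
      and "\<forall>\<delta>\<in>subst \<sigma> ` D. holds_at A v (unit_eqn \<delta>)"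
    then have "\<forall>\<delta>\<in>D. holds_at A (\<lambda>x. eval A v (\<sigma> x)) (unit_eqn \<delta>)"
      by (simp add: holds_at_unit_subst)
    moreover have "algebra_of rp_lang A" using A K by (auto simp: RPA_iff)
    ultimately show "holds_at A v (unit_eqn (subst \<sigma> \<phi>))"
      unfolding holds_at_unit_subst by (intro D(5) A valuation_subst[OF _ v \<sigma>])
  qed (use D \<sigma> wf_subst[OF \<sigma>] in \<open>auto simp: formulas_def\<close>)
qed

text \<open>Over \<open>RPA\<close> a quasi-equation amounts to finitely many derivations: its
  premises become the finite set \<open>D\<close> of formulas, and its conclusion the two
  implications between its sides.\<close>

lemma consequence_of_order:
  fixes V W :: "(rp_sym, 'a) ualg set"
  assumes V: "V \<subseteq> RPA" and W: "quasivariety rp_lang W" "W \<subseteq> RPA"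
    and sub: "consequence_of W \<subseteq> consequence_of V"
  shows "V \<subseteq> W"
proof
  fix A assume A: "A \<in> V"
  have "sat_qeqn A q" if q: "q \<in> qeqns rp_lang" "\<forall>B\<in>W. sat_qeqn B q" for q
    unfolding sat_qeqn_def
  proof (intro ballI impI)
    fix v assume v: "v \<in> UNIV \<rightarrow> carrier A" "\<forall>p\<in>set (fst q). holds_at A v p"
    define D where "D = \<Union>(eqn_formulas ` set (fst q))"
    have e: "set (fst q) \<subseteq> eqns rp_lang" "snd q \<in> eqns rp_lang" using q(1) by (auto simp: qeqns_iff)
    have D: "D \<subseteq> formulas rp_lang" "finite D"
      using e(1) eqn_formulas_formulas unfolding D_def by (blast, simp add: eqn_formulas_def)
    have iff: "(\<forall>p\<in>set (fst q). holds_at B u p) \<longleftrightarrow> (\<forall>t\<in>D. holds_at B u (unit_eqn t))"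
      if "B \<in> RPA" "u \<in> UNIV \<rightarrow> carrier B" for B :: "(rp_sym, 'a) ualg" and u
      using RPA_holds_at_iff[OF that] e(1) unfolding D_def by blast
    have "holds_at A v (unit_eqn t)" if t: "t \<in> eqn_formulas (snd q)" for t
    proof -
      have "(D, t) \<in> consequence_of W"
      proof (rule consequence_ofI[OF D(1) _ order_refl D(2)])
        show "t \<in> formulas rp_lang" using t eqn_formulas_formulas[OF e(2)] by blast
        fix B and u :: "nat \<Rightarrow> 'a"
        assume B: "B \<in> W" "u \<in> UNIV \<rightarrow> carrier B" "\<forall>\<delta>\<in>D. holds_at B u (unit_eqn \<delta>)"
        have "B \<in> RPA" using B(1) W(2) by blast
        have "holds_at B u (snd q)"
          using q(2) B iff[OF \<open>B \<in> RPA\<close> B(2)] unfolding sat_qeqn_def by blast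
        then show "holds_at B u (unit_eqn t)"
          using RPA_holds_at_iff[OF \<open>B \<in> RPA\<close> B(2) e(2)] t by blast
      qed
      then have "(D, t) \<in> consequence_of V" using sub by blast
      then obtain D' where D': "D' \<subseteq> D" "\<And>A v. A \<in> V \<Longrightarrow> v \<in> UNIV \<rightarrow> carrier A \<Longrightarrow>
          \<forall>\<delta>\<in>D'. holds_at A v (unit_eqn \<delta>) \<Longrightarrow> holds_at A v (unit_eqn t)"
        by (rule consequence_ofE) (rule that; assumption)
      have "A \<in> RPA" using A V by blast
      then have "\<forall>t\<in>D. holds_at A v (unit_eqn t)" using iff[OF _ v(1)] v(2) by blast
      then show ?thesis using D'(2)[OF A v(1)] D'(1) by blast
    qed
    moreover have "A \<in> RPA" using A V by blast
    ultimately show "holds_at A v (snd q)"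
      using RPA_holds_at_iff[OF _ v(1) e(2)] by blast
  qed
  moreover have "algebra_of rp_lang A" using A V by (auto simp: RPA_iff)
  ultimately show "A \<in> W" unfolding quasivariety_member[OF W(1), of A] by blast
qed

lemma finitary_logicD:
  assumes "finitary_logic L C"
  shows "(\<Gamma>, \<phi>) \<in> C \<Longrightarrow> \<Gamma> \<subseteq> formulas L" "(\<Gamma>, \<phi>) \<in> C \<Longrightarrow> \<phi> \<in> formulas L"
    "\<Gamma> \<subseteq> formulas L \<Longrightarrow> \<phi> \<in> \<Gamma> \<Longrightarrow> (\<Gamma>, \<phi>) \<in> C"
    "\<Gamma> \<subseteq> formulas L \<Longrightarrow> (\<And>\<delta>. \<delta> \<in> \<Delta> \<Longrightarrow> (\<Gamma>, \<delta>) \<in> C) \<Longrightarrow> (\<Delta>, \<phi>) \<in> C \<Longrightarrow> (\<Gamma>, \<phi>) \<in> C"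
    "(\<Gamma>, \<phi>) \<in> C \<Longrightarrow> \<exists>\<Delta> \<subseteq> \<Gamma>. finite \<Delta> \<and> (\<Delta>, \<phi>) \<in> C"
    "(\<Gamma>, \<phi>) \<in> C \<Longrightarrow> range \<sigma> \<subseteq> formulas L \<Longrightarrow> (subst \<sigma> ` \<Gamma>, subst \<sigma> \<phi>) \<in> C"
proof -
  note d = assms[unfolded finitary_logic_def]
  note d1 = d[THEN conjunct2]
  note d2 = d1[THEN conjunct2]
  note d3 = d2[THEN conjunct2]
  show "(\<Gamma>, \<phi>) \<in> C \<Longrightarrow> \<Gamma> \<subseteq> formulas L" "(\<Gamma>, \<phi>) \<in> C \<Longrightarrow> \<phi> \<in> formulas L"
    using d[THEN conjunct1] by blast+
  show "\<Gamma> \<subseteq> formulas L \<Longrightarrow> \<phi> \<in> \<Gamma> \<Longrightarrow> (\<Gamma>, \<phi>) \<in> C" using d1[THEN conjunct1] by blast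
  show "(\<Gamma>, \<phi>) \<in> C" if "\<Gamma> \<subseteq> formulas L" "\<And>\<delta>. \<delta> \<in> \<Delta> \<Longrightarrow> (\<Gamma>, \<delta>) \<in> C" "(\<Delta>, \<phi>) \<in> C"
    by (rule d2[THEN conjunct1, rule_format, of _ \<Delta>]) (fact | rule that; assumption)+
  show "\<exists>\<Delta> \<subseteq> \<Gamma>. finite \<Delta> \<and> (\<Delta>, \<phi>) \<in> C" if "(\<Gamma>, \<phi>) \<in> C"
    using d3[THEN conjunct1] that by blast
  show "(subst \<sigma> ` \<Gamma>, subst \<sigma> \<phi>) \<in> C" if "(\<Gamma>, \<phi>) \<in> C" "range \<sigma> \<subseteq> formulas L"
    using d3[THEN conjunct2] that by blast
qed

text \<open>\<open>V\<close> consists of the algebras validating the rules of \<open>C\<close>, and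
  finitarity allows these to be written as quasi-equations. That \<open>V\<close> validates nothing
  more is shown by a Lindenbaum algebra for each finite set of premises.\<close>

lemma extension_completeness:
  assumes inf: "infinite (UNIV :: 'a set)" and C: "finitary_logic rp_lang C"
    and ext: "rational_product_logic TYPE('a) \<subseteq> C"
  obtains V :: "(rp_sym, 'a) ualg set" where "quasivariety rp_lang V" "V \<subseteq> RPA" "consequence_of V = C"
proof -
  note C = finitary_logicD[OF C]
  define Q where "Q = {(map unit_eqn ds, unit_eqn \<phi>) |ds \<phi>. (set ds, \<phi>) \<in> C}"
  define V :: "(rp_sym, 'a) ualg set" where "V = {A \<in> RPA. \<forall>q\<in>Q. sat_qeqn A q}"
  have "Q \<subseteq> qeqns rp_lang"
    using C(1,2) by (fastforce simp: Q_def qeqns_iff)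
  then have V: "quasivariety rp_lang V"
    unfolding V_def by (intro quasivariety_restrict quasivariety_RPA)
  have sub: "V \<subseteq> RPA" by (auto simp: V_def)
  have VQ: "holds_at A v (unit_eqn \<phi>)"
    if A: "A \<in> V" "finite D" "(D, \<phi>) \<in> C" "v \<in> UNIV \<rightarrow> carrier A" "\<forall>\<delta>\<in>D. holds_at A v (unit_eqn \<delta>)"
    for A D \<phi> v
  proof -
    obtain ds where ds: "set ds = D" using finite_list[OF A(2)] by blast
    have "(map unit_eqn ds, unit_eqn \<phi>) \<in> Q" using A(3) unfolding Q_def ds[symmetric] by blast
    then have "sat_qeqn A (map unit_eqn ds, unit_eqn \<phi>)" using A(1) unfolding V_def by blast
    then show ?thesis using A(4,5) ds by (auto simp: sat_qeqn_def)
  qed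
  have "C \<subseteq> consequence_of V"
  proof
    fix x assume "x \<in> C"
    moreover obtain \<Gamma> \<phi> where x: "x = (\<Gamma>, \<phi>)" by (cases x)
    ultimately have G: "(\<Gamma>, \<phi>) \<in> C" by simp
    then obtain D where "D \<subseteq> \<Gamma>" "finite D" "(D, \<phi>) \<in> C" using C(5) by blast
    then show "x \<in> consequence_of V"
      unfolding x by (intro consequence_ofI[of _ _ D] C(1,2)[OF G] VQ[of _ D])
  qed
  moreover have "consequence_of V \<subseteq> C"
  proof
    fix x assume "x \<in> consequence_of V"
    moreover obtain \<Gamma> \<phi> where x: "x = (\<Gamma>, \<phi>)" by (cases x)
    ultimately have "(\<Gamma>, \<phi>) \<in> consequence_of V" by simp
    then obtain D where D: "\<Gamma> \<subseteq> formulas rp_lang" "\<phi> \<in> formulas rp_lang" "D \<subseteq> \<Gamma>" "finite D"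
      "\<And>A v. A \<in> V \<Longrightarrow> v \<in> UNIV \<rightarrow> carrier A \<Longrightarrow> \<forall>\<delta>\<in>D. holds_at A v (unit_eqn \<delta>) \<Longrightarrow>
        holds_at A v (unit_eqn \<phi>)"
      by (rule consequence_ofE) (rule that; assumption)
    \<comment> \<open>The theory generated by \<open>D\<close>. It contains all consequences of its
      finite subsets over \<open>RPA\<close> because \<open>C\<close> extends the base
      logic.\<close>
    define T where "T = {\<psi>. (D, \<psi>) \<in> C}"
    have DF: "D \<subseteq> formulas rp_lang" using D(1,3) by blast
    have T_formulas: "T \<subseteq> formulas rp_lang" using C(2) by (auto simp: T_def)
    have T_cut: "\<psi> \<in> T" if "(E, \<psi>) \<in> C" "E \<subseteq> T" for E \<psi>
      using C(4)[OF DF _ that(1)] that(2) by (auto simp: T_def)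
    have T_closed: "\<psi> \<in> T" if "E \<subseteq> T" "finite E" "\<psi> \<in> formulas rp_lang"
      "\<And>A v. A \<in> RPA \<Longrightarrow> v \<in> UNIV \<rightarrow> carrier A \<Longrightarrow> \<forall>\<delta>\<in>E. holds_at A v (unit_eqn \<delta>) \<Longrightarrow>
        holds_at (A :: (rp_sym, 'a) ualg) v (unit_eqn \<psi>)" for E \<psi>
    proof (rule T_cut[OF _ that(1)])
      have "(E, \<psi>) \<in> consequence_of (RPA :: (rp_sym, 'a) ualg set)"
        by (rule consequence_ofI[of _ _ E]) (use that T_formulas in auto)
      then show "(E, \<psi>) \<in> C" using ext unfolding rational_product_logic_eq by blast
    qed
    \<comment> \<open>Two formulas are identified when both implications between them belong to the
      theory.\<close>
    define P where "P = {e \<in> eqns rp_lang. eqn_formulas e \<subseteq> T}"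
    \<comment> \<open>The two translations are inverse up to consequence over \<open>RPA\<close>, so
      a formula belongs to the theory exactly when it is identified with the unit.\<close>
    have P_unit: "unit_eqn \<psi> \<in> P \<longleftrightarrow> \<psi> \<in> T" for \<psi>
    proof
      assume P: "unit_eqn \<psi> \<in> P"
      show "\<psi> \<in> T"
      proof (rule T_closed[of "eqn_formulas (unit_eqn \<psi>)"])
        show "eqn_formulas (unit_eqn \<psi>) \<subseteq> T" "\<psi> \<in> formulas rp_lang" using P by (auto simp: P_def)
        show "finite (eqn_formulas (unit_eqn \<psi>))" by (simp add: eqn_formulas_def)
        show "holds_at A v (unit_eqn \<psi>)" if "A \<in> RPA" "v \<in> UNIV \<rightarrow> carrier A"
          "\<forall>\<delta>\<in>eqn_formulas (unit_eqn \<psi>). holds_at A v (unit_eqn \<delta>)"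
          for A :: "(rp_sym, 'a) ualg" and v
          using RPA_holds_at_iff[OF that(1,2), of "unit_eqn \<psi>"] that(3) P by (auto simp: P_def)
      qed
    next
      assume \<psi>: "\<psi> \<in> T"
      then have F: "\<psi> \<in> formulas rp_lang" using T_formulas by blast
      have "\<chi> \<in> T" if "\<chi> \<in> eqn_formulas (unit_eqn \<psi>)" for \<chi>
      proof (rule T_closed[of "{\<psi>}"])
        show "\<chi> \<in> formulas rp_lang"
          using that eqn_formulas_formulas[of "unit_eqn \<psi>"] F by auto
        show "holds_at A v (unit_eqn \<chi>)" if "A \<in> RPA" "v \<in> UNIV \<rightarrow> carrier A"
          "\<forall>\<delta>\<in>{\<psi>}. holds_at A v (unit_eqn \<delta>)" for A :: "(rp_sym, 'a) ualg" and v
          using RPA_holds_at_iff[OF that(1,2), of "unit_eqn \<psi>"] that(3)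
            \<open>\<chi> \<in> eqn_formulas (unit_eqn \<psi>)\<close> F by auto
      qed (use \<psi> in auto)
      then show "unit_eqn \<psi> \<in> P" using F by (auto simp: P_def)
    qed
    have P_eqns: "P \<subseteq> eqns rp_lang" by (auto simp: P_def)
    have closed: "snd q \<in> P" if q: "q \<in> qeqns rp_lang"
      "\<And>A. A \<in> (RPA :: (rp_sym, 'a) ualg set) \<Longrightarrow> sat_qeqn A q" "set (fst q) \<subseteq> P" for q
    proof -
      have e: "set (fst q) \<subseteq> eqns rp_lang" "snd q \<in> eqns rp_lang" using q(1) by (auto simp: qeqns_iff)
      have "\<chi> \<in> T" if \<chi>: "\<chi> \<in> eqn_formulas (snd q)" for \<chi>
      proof (rule T_closed[of "\<Union>(eqn_formulas ` set (fst q))"])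
        show "\<Union>(eqn_formulas ` set (fst q)) \<subseteq> T" using q(3) by (auto simp: P_def)
        show "finite (\<Union>(eqn_formulas ` set (fst q)))" by (simp add: eqn_formulas_def)
        show "\<chi> \<in> formulas rp_lang" using \<chi> eqn_formulas_formulas[OF e(2)] by blast
        fix A :: "(rp_sym, 'a) ualg" and v :: "nat \<Rightarrow> 'a"
        assume A: "A \<in> RPA" "v \<in> UNIV \<rightarrow> carrier A"
          "\<forall>\<delta>\<in>\<Union>(eqn_formulas ` set (fst q)). holds_at A v (unit_eqn \<delta>)"
        then have "\<forall>p\<in>set (fst q). holds_at A v p"
          using RPA_holds_at_iff[OF A(1,2)] e(1) by blast
        then have "holds_at A v (snd q)"
          using q(2)[OF A(1)] A(2) unfolding sat_qeqn_def by blast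
        then show "holds_at A v (unit_eqn \<chi>)"
          using RPA_holds_at_iff[OF A(1,2) e(2)] \<chi> by blast
      qed
      then show ?thesis using e(2) by (auto simp: P_def)
    qed
    obtain B :: "(rp_sym, 'a) ualg" and k where B: "B \<in> RPA"
      and val: "\<And>v :: nat \<Rightarrow> 'a. v \<in> UNIV \<rightarrow> carrier B \<longleftrightarrow> (\<exists>\<sigma>. range \<sigma> \<subseteq> formulas rp_lang \<and> v = k \<circ> \<sigma>)"
      and holds: "\<And>\<sigma> e. range \<sigma> \<subseteq> formulas rp_lang \<Longrightarrow> e \<in> eqns rp_lang \<Longrightarrow>
             holds_at B (k \<circ> \<sigma>) e \<longleftrightarrow> subst_eqn \<sigma> e \<in> P"
      by (rule quasivariety_term_quotient[OF countable_rp_lang inf quasivariety_RPA P_eqns closed])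
        (assumption | rule that; assumption)+
    have holds_unit: "holds_at B (k \<circ> \<sigma>) (unit_eqn \<psi>) \<longleftrightarrow> subst \<sigma> \<psi> \<in> T"
      if "range \<sigma> \<subseteq> formulas rp_lang" "\<psi> \<in> formulas rp_lang" for \<sigma> \<psi>
      using holds[OF that(1), of "unit_eqn \<psi>"] that(2) P_unit[of "subst \<sigma> \<psi>"]
      by (simp add: unit_eqn_def[of "subst _ _"] unit_eqn_def[of \<psi>] eqns_eq)
    \<comment> \<open>Valuations in \<open>B\<close> are substitutions, so substitution invariance
      of \<open>C\<close> together with cut gives the rules of \<open>C\<close> at every
      valuation.\<close>
    have "sat_qeqn B q" if q: "q \<in> Q" for q
    proof -
      obtain ds \<psi> where ds: "q = (map unit_eqn ds, unit_eqn \<psi>)" "(set ds, \<psi>) \<in> C"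
        using q unfolding Q_def by blast
      show ?thesis
        unfolding sat_qeqn_def
      proof (intro ballI impI)
        fix w assume w: "w \<in> UNIV \<rightarrow> carrier B" "\<forall>p\<in>set (fst q). holds_at B w p"
        obtain \<sigma> where \<sigma>: "range \<sigma> \<subseteq> formulas rp_lang" "w = k \<circ> \<sigma>" using w(1)[unfolded val] by (elim exE conjE)
        have F: "set ds \<subseteq> formulas rp_lang" "\<psi> \<in> formulas rp_lang" using C(1,2)[OF ds(2)] .
        have "subst \<sigma> d \<in> T" if "d \<in> set ds" for d
          using w(2) that holds_unit[OF \<sigma>(1), of d] F(1) unfolding ds(1) \<sigma>(2) by auto
        then have "subst \<sigma> \<psi> \<in> T"
          using T_cut[OF C(6)[OF ds(2) \<sigma>(1)]] by blast
        then show "holds_at B w (snd q)"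
          using holds_unit[OF \<sigma>(1) F(2)] unfolding ds(1) \<sigma>(2) by simp
      qed
    qed
    then have "B \<in> V" using B by (simp add: V_def)
    moreover have "k \<circ> Var \<in> UNIV \<rightarrow> carrier B"
      unfolding val by (intro exI[of _ Var] conjI Var_formulas refl)
    moreover have "\<forall>\<delta>\<in>D. holds_at B (k \<circ> Var) (unit_eqn \<delta>)"
    proof
      fix \<delta> assume \<delta>: "\<delta> \<in> D"
      then show "holds_at B (k \<circ> Var) (unit_eqn \<delta>)"
      using holds_unit[OF Var_formulas, of \<delta>] DF C(3)[OF DF \<delta>] by (auto simp: subst_Var T_def)
    qed
    ultimately have "holds_at B (k \<circ> Var) (unit_eqn \<phi>)" by (rule D(5))
    then have "(D, \<phi>) \<in> C"
      using holds_unit[OF Var_formulas D(2)] by (simp add: subst_Var T_def)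
    then show "x \<in> C"
      unfolding x by (rule C(4)[OF D(1), rotated]) (use C(3)[OF D(1)] D(3) in blast)
  qed
  ultimately show thesis using that[OF V sub] by blast
qed

lemma extensions_carrier:
  "carrier (extensions L C) = {C'. finitary_logic L C' \<and> C \<subseteq> C'}" "le (extensions L C) = (\<subseteq>)"
  by (simp_all add: extensions_def)

lemma consequence_of_subset_iff:
  fixes V W :: "(rp_sym, 'a) ualg set"
  assumes "quasivariety rp_lang V" "V \<subseteq> RPA" "quasivariety rp_lang W" "W \<subseteq> RPA"
  shows "consequence_of V \<subseteq> consequence_of W \<longleftrightarrow> W \<subseteq> V"
  using consequence_of_order[OF assms(4,1,2)] consequence_of_antimono[of W V] by blast

theorem bij_betw_extensions:
  assumes inf: "infinite (UNIV :: 'a set)"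
  shows "bij_betw consequence_of (carrier (subquasivarieties rp_lang (RPA :: (rp_sym, 'a) ualg set)))
    (carrier (extensions rp_lang (rational_product_logic TYPE('a))))" (is "bij_betw _ ?Q ?E")
  unfolding bij_betw_def
proof (intro conjI)
  show "inj_on consequence_of ?Q"
    by (rule inj_onI) (metis (mono_tags, lifting) consequence_of_subset_iff mem_Collect_eq order_antisym
        order_refl subquasivarieties_carrier(1))
  show "consequence_of ` ?Q = ?E"
  proof
    show "consequence_of ` ?Q \<subseteq> ?E"
      using finitary_logic_consequence_of consequence_of_antimono
      by (auto simp: subquasivarieties_carrier extensions_carrier rational_product_logic_eq)
    show "?E \<subseteq> consequence_of ` ?Q"
    proof
      fix C assume "C \<in> ?E"
      then have C: "finitary_logic rp_lang C" "rational_product_logic TYPE('a) \<subseteq> C"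
        by (simp_all add: extensions_carrier)
      obtain V :: "(rp_sym, 'a) ualg set" where "quasivariety rp_lang V" "V \<subseteq> RPA" "consequence_of V = C"
        by (rule extension_completeness[OF inf C]) (rule that; assumption)
      then show "C \<in> consequence_of ` ?Q"
        by (intro image_eqI[of _ _ V]) (simp_all add: subquasivarieties_carrier)
    qed
  qed
qed

lemma sat_lat_eqn_extensions:
  assumes inf: "infinite (UNIV :: 'a set)"
    and "sat_lat_eqn (extensions rp_lang (rational_product_logic TYPE('a))) s t"
  shows "sat_lat_eqn (subquasivarieties rp_lang (RPA :: (rp_sym, 'a) ualg set)) (dual_term s) (dual_term t)"
proof (rule sat_lat_eqn_dual_iso[OF _ _ bij_betw_extensions[OF inf] _ assms(2)])
  show "lattice (subquasivarieties rp_lang (RPA :: (rp_sym, 'a) ualg set))"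
    by (intro lattice_subquasivarieties quasivariety_RPA)
  show "partial_order (extensions rp_lang (rational_product_logic TYPE('a)))"
    unfolding extensions_def by (rule partial_order_incl_order)
qed (auto simp: subquasivarieties_carrier extensions_carrier consequence_of_subset_iff)

text \<open>A subquasivariety is determined by its valid quasi-equations, of which there are
  countably many. For the lower bound, each set of natural numbers is recovered from the semilattice
  of its finite subsets.\<close>

lemma subquasivarieties_eqpoll_reals:
  assumes inf: "infinite (UNIV :: 'a set)"
  shows "carrier (subquasivarieties rp_lang (RPA :: (rp_sym, 'a) ualg set)) \<approx> (UNIV :: real set)"
    (is "?Q \<approx> _")
proof -
  define th where "th V = {q \<in> qeqns rp_lang. \<forall>A\<in>V. sat_qeqn A q}" for V :: "(rp_sym, 'a) ualg set"
  have "inj_on th ?Q"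
  proof (rule inj_onI)
    fix V W assume "V \<in> ?Q" "W \<in> ?Q" "th V = th W"
    then have *: "quasivariety rp_lang V" "quasivariety rp_lang W" and th: "th V = th W"
      by (simp_all add: subquasivarieties_carrier)
    have **: "(\<forall>A\<in>V. sat_qeqn A q) \<longleftrightarrow> (\<forall>A\<in>W. sat_qeqn A q)" if "q \<in> qeqns rp_lang" for q
      using that arg_cong[OF th, of "\<lambda>Q. q \<in> Q"] unfolding th_def by blast
    show "V = W"
      using quasivariety_member[OF *(1)] quasivariety_member[OF *(2)] ** by blast
  qed
  then have "?Q \<lesssim> Pow (qeqns rp_lang)"
    unfolding lepoll_def by (intro exI[of _ th]) (auto simp: th_def)
  also have "Pow (qeqns rp_lang) \<lesssim> (UNIV :: nat set set)"
    unfolding lepoll_def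
    using inj_on_image_Pow[OF inj_on_to_nat_on[OF countable_qeqns[OF countable_rp_lang]]] by blast
  finally have "?Q \<lesssim> (UNIV :: nat set set)" .
  moreover have "(UNIV :: nat set set) \<lesssim> ?Q"
  proof -
    let ?hi = "\<lambda>X. semilattice_hi {Z. finite Z \<and> Z \<subseteq> X} :: (rp_sym, 'a) ualg set"
    have US: "{Z. finite Z \<and> Z \<subseteq> X} \<in> union_semilattices" for X
      by (auto simp: union_semilattices_def)
    have mono: "X \<subseteq> Y" if "?hi X = ?hi Y" for X Y
    proof -
      \<comment> \<open>Equality of the upper classes places the lower class of \<open>X\<close>
        inside the upper class of \<open>Y\<close>, which \<open>semilattice_lo_hi\<close> reads as
        an inclusion of semilattices.\<close>
      have "semilattice_lo {Z. finite Z \<and> Z \<subseteq> X} \<subseteq> ?hi Y"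
        using semilattice_lo_hi[OF inf US US, of X X] that by simp
      then have sub: "{Z. finite Z \<and> Z \<subseteq> X} \<subseteq> {Z. finite Z \<and> Z \<subseteq> Y}"
        using semilattice_lo_hi[OF inf US US, of X Y] by simp
      show ?thesis
      proof
        fix x assume "x \<in> X"
        then have "{x} \<in> {Z. finite Z \<and> Z \<subseteq> X}" by simp
        then have "{x} \<in> {Z. finite Z \<and> Z \<subseteq> Y}" by (rule subsetD[OF sub])
        then show "x \<in> Y" by simp
      qed
    qed
    have "inj ?hi"
    proof (rule injI)
      fix X Y assume eq: "?hi X = ?hi Y"
      show "X = Y" using mono[OF eq] mono[OF eq[symmetric]] by (rule subset_antisym)
    qed
    moreover have "range ?hi \<subseteq> ?Q"
    proof (rule image_subsetI)
      fix X
      have "?hi X \<subseteq> RPA" by (auto simp: semilattice_hi_def)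
      then show "?hi X \<in> ?Q" by (simp add: subquasivarieties_carrier semilattice_hi_lo_closed(2))
    qed
    ultimately show ?thesis unfolding lepoll_def by (intro exI[of _ ?hi] conjI)
  qed
  ultimately have "?Q \<approx> (UNIV :: nat set set)" by (rule lepoll_antisym)
  then show ?thesis using nat_sets_eqpoll_reals by (rule eqpoll_trans)
qed


section \<open>Q-universality\<close>

theorem theorem5p4:
  assumes "infinite (UNIV :: 'a set)" and "infinite (UNIV :: 'b set)"
  shows "Q_universal TYPE('g) TYPE('b) rp_lang (RPA :: (rp_sym, 'a) ualg set) \<and>
    carrier (extensions rp_lang (rational_product_logic TYPE('a))) \<approx> (UNIV :: real set) \<and>
    (\<forall>s t. (\<exists>M :: 'c gorder. lattice M \<and> \<not> sat_lat_eqn M s t) \<longrightarrow>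
       \<not> sat_lat_eqn (extensions rp_lang (rational_product_logic TYPE('a))) s t)"
proof (intro conjI allI impI)
  let ?Q = "subquasivarieties rp_lang (RPA :: (rp_sym, 'a) ualg set)"
  have Q: "lattice ?Q" by (intro lattice_subquasivarieties quasivariety_RPA)
  note S = hom_image_semilattice_lattice[OF assms(1)]
  show "Q_universal TYPE('g) TYPE('b) rp_lang (RPA :: (rp_sym, 'a) ualg set)"
    unfolding Q_universal_def
  proof (intro conjI allI impI quasivariety_RPA)
    fix L' :: "'g lang" and M :: "('g, 'b) ualg set"
    assume "finite (dom L')" and M: "quasivariety L' M"
    then interpret coded_quasivariety L' M
      by unfold_locales (simp_all add: countable_finite assms(2))
    show "hom_image_of_sublattice (subquasivarieties L' M) ?Q"
      by (rule hom_image_of_sublattice_trans[OF lattice_subquasivarieties[OF M]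
            lattice_semilattice_lattice Q hom_image_subquasivarieties S])
  qed
  have "carrier ?Q \<approx> carrier (extensions rp_lang (rational_product_logic TYPE('a)))"
    using bij_betw_extensions[OF assms(1)] unfolding eqpoll_def by blast
  then show "carrier (extensions rp_lang (rational_product_logic TYPE('a))) \<approx> (UNIV :: real set)"
    using subquasivarieties_eqpoll_reals[OF assms(1)] eqpoll_sym eqpoll_trans by blast
  fix s t assume "\<exists>M :: 'c gorder. lattice M \<and> \<not> sat_lat_eqn M s t"
  then obtain M :: "'c gorder" where M: "lattice M" "\<not> sat_lat_eqn M s t" by blast
  \<comment> \<open>Extensions are ordered dually to subquasivarieties, so the dual equation has to
    be refuted among the latter; it fails in the dual lattice of \<open>M\<close>.\<close>
  then have "\<not> sat_lat_eqn semilattice_lattice (dual_term s) (dual_term t)"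
    by (intro semilattice_lattice_refutes[OF lattice.dual_lattice[OF M(1)]])
      (simp only: sat_lat_eqn_inv_gorder not_False_eq_True)
  then have "\<not> sat_lat_eqn ?Q (dual_term s) (dual_term t)"
    using sat_lat_eqn_hom_image[OF Q lattice_semilattice_lattice S] by blast
  then show "\<not> sat_lat_eqn (extensions rp_lang (rational_product_logic TYPE('a))) s t"
    using sat_lat_eqn_extensions[OF assms(1)] by blast
qed

end
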